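(* Let $n\geq 2$. Let $\Omega\subseteq\mathbb{R}^{n}$ be a periodic set such that $\partial\Omega$ is a $C^{\infty}$ manifold. Let $B\subseteq\mathbb{R}^{n}$ be a periodic half space. Then $$\int_{\partial\Omega}\gamma_{n}(x)\,dx\;\geq\;(1-6\cdot 10^{-9})\int_{\partial B}\gamma_{n}(x)\,dx+\int_{\partial\Omega}\Big(1-\frac{\|N(x)\|_{1}}{\sqrt{n}}\Big)\gamma_{n}(x)\,dx.$$ In particular, $$\int_{\partial\Omega}\gamma_{n}(x)\,dx\;\geq\;(1-6\cdot 10^{-9})\int_{\partial B}\gamma_{n}(x)\,dx.$$
   Context: A (Lebesgue measurable) subset $\Omega\subseteq\mathbb{R}^{n}$ is called periodic if $\Omega+v=\Omega^{c}$ for every standard basis vector $v\in\mathbb{R}^{n}$, and $-\Omega=\Omega^{c}$, where both equalities are understood up to sets of Lebesgue measure zero. A periodic half space is any set of the form $B=\{x=(x_1,\ldots,x_n)\in\mathbb{R}^{n}\colon \sin(\pi(\epsilon_{1}x_{1}+\cdots+\epsilon_{n}x_{n}))\geq 0\}$ with $\epsilon_{1},\ldots,\epsilon_{n}\in\{-1,1\}$. $\gamma_{n}(x)=(2\pi)^{-n/2}e^{-(x_{1}^{2}+\cdots+x_{n}^{2})/2}$. Integrals over $\partial\Omega$ and $\partial B$ are with respect to $(n-1)$-dimensional surface measure, written $dx$. "$\partial\Omega$ is a $C^{\infty}$ manifold" means that near each of its points the topological boundary $\partial\Omega$ is (after a rotation) the graph of a $C^{\infty}$ function, with $\Omega$ lying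 locally on one side of $\partial\Omega$, so that the exterior normal is defined. For $x\in\partial\Omega$, $N(x)$ is the exterior normal vector to $\Omega$ at $x$, normalized so that $\|N(x)\|_{2}=1$. For $q\geq 1$, $\|x\|_{q}^{q}=|x_{1}|^{q}+\cdots+|x_{n}|^{q}$. *)

theory Defs
  imports "HOL-Analysis.Analysis"
begin

definition periodic_set :: "(real^'n) set \<Rightarrow> bool" where
  "periodic_set \<Omega> \<longleftrightarrow>
     \<Omega> \<in> sets lebesgue \<and>
     (\<forall>i. sym_diff ((\<lambda>x. x + axis i 1) ` \<Omega>) (- \<Omega>) \<in> null_sets lebesgue) \<and>
     sym_diff (uminus ` \<Omega>) (- \<Omega>) \<in> null_sets lebesgue"

definition periodic_half_space :: "(real^'n) set \<Rightarrow> bool" where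
  "periodic_half_space B \<longleftrightarrow>
     (\<exists>\<epsilon>::real^'n. (\<forall>i. \<epsilon> $ i \<in> {-1, 1}) \<and>
        B = {x. sin (pi * (\<Sum>i\<in>UNIV. \<epsilon> $ i * x $ i)) \<ge> 0})"

definition gaussian_density :: "real^'n \<Rightarrow> real" where
  "gaussian_density x =
     (2 * pi) powr (- real CARD('n) / 2) * exp (- (\<Sum>i\<in>UNIV. (x $ i)\<^sup>2) / 2)"

definition l1_norm :: "real^'n \<Rightarrow> real" where
  "l1_norm x = (\<Sum>i\<in>UNIV. \<bar>x $ i\<bar>)"


text \<open>
  Surface measure is the (n-1)-dimensional Hausdorff measure, normalized so that on
  (n-1)-dimensional affine subspaces it is Lebesgue measure.  The set \<open>C i\<close> is required to be
  bounded because \<^const>\<open>diameter\<close> is unspecified on unbounded sets; the case distinction on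
  the empty set matters only for \<open>s = 0\<close>, where \<open>0 ^ 0 = 1\<close>.
\<close>

definition hausdorff_outer :: "nat \<Rightarrow> 'a::metric_space set \<Rightarrow> ennreal" where
  "hausdorff_outer s A =
     (SUP \<delta>\<in>{0::real<..}.
        INF C\<in>{C :: nat \<Rightarrow> 'a set.
                 A \<subseteq> (\<Union>i. C i) \<and> (\<forall>i. bounded (C i) \<and> diameter (C i) \<le> \<delta>)}.
          \<Sum>i. if C i = {} then 0
              else ennreal (unit_ball_vol (real s) * (diameter (C i) / 2) ^ s))"

definition hausdorff_measure :: "nat \<Rightarrow> 'a::metric_space measure" where
  "hausdorff_measure s = measure_of UNIV (sets borel) (hausdorff_outer s)"

definition surface_measure :: "(real^'n) measure" where
  "surface_measure = hausdorff_measure (CARD('n) - 1)"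


text \<open>\<open>f\<close> is \<open>C\<^sup>k\<close> on \<open>S\<close>; intended for open \<open>S\<close>.\<close>

primrec Ck_on :: "nat \<Rightarrow> (real^'n) set \<Rightarrow> (real^'n \<Rightarrow> real) \<Rightarrow> bool" where
  "Ck_on 0 S f \<longleftrightarrow> continuous_on S f"
| "Ck_on (Suc k) S f \<longleftrightarrow>
     (\<forall>x\<in>S. f differentiable (at x)) \<and>
     (\<forall>i. Ck_on k S (\<lambda>x. frechet_derivative f (at x) (axis i 1)))"

definition smooth_on :: "(real^'n) set \<Rightarrow> (real^'n \<Rightarrow> real) \<Rightarrow> bool" where
  "smooth_on S f \<longleftrightarrow> (\<forall>k. Ck_on k S f)"

definition grad :: "(real^'n \<Rightarrow> real) \<Rightarrow> real^'n \<Rightarrow> real^'n" where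
  "grad f x = (\<chi> i. frechet_derivative f (at x) (axis i 1))"

text \<open>
  \<open>local_graph \<Omega> x e f\<close>: near \<open>x\<close>, after a rotation taking the last coordinate axis to the
  unit vector \<open>e\<close>, the boundary of \<open>\<Omega>\<close> is the graph of the smooth function \<open>f\<close> and
  \<open>\<Omega>\<close> lies below it.  A function of the first \<open>n - 1\<close> rotated coordinates is represented
  as a function on the whole space that is constant in the direction \<open>e\<close>.  Points of
  the boundary may or may not belong to \<open>\<Omega>\<close>.
\<close>

definition local_graph ::
  "(real^'n) set \<Rightarrow> real^'n \<Rightarrow> real^'n \<Rightarrow> (real^'n \<Rightarrow> real) \<Rightarrow> bool" where
  "local_graph \<Omega> x e f \<longleftrightarrow>
     norm e = 1 \<and>
     (\<forall>y t. f (y + t *\<^sub>R e) = f y) \<and>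
     (\<exists>U. open U \<and> x \<in> U \<and> smooth_on U f \<and>
        (\<forall>y\<in>U. (y \<in> frontier \<Omega> \<longleftrightarrow> y \<bullet> e = f y) \<and>
               (y \<bullet> e < f y \<longrightarrow> y \<in> \<Omega>) \<and>
               (y \<bullet> e > f y \<longrightarrow> y \<notin> \<Omega>)))"

definition smooth_boundary :: "(real^'n) set \<Rightarrow> bool" where
  "smooth_boundary \<Omega> \<longleftrightarrow> (\<forall>x\<in>frontier \<Omega>. \<exists>e f. local_graph \<Omega> x e f)"

text \<open>
  In the rotated coordinates \<open>e - grad f x\<close> is \<open>(- grad f, 1)\<close>, since \<open>grad f x\<close> is
  orthogonal to \<open>e\<close>.  The resulting unit vector does not depend on the choice of the graph.
\<close>

definition exterior_normal :: "(real^'n) set \<Rightarrow> real^'n \<Rightarrow> real^'n" where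
  "exterior_normal \<Omega> x =
     (THE \<nu>. \<exists>e f. local_graph \<Omega> x e f \<and>
        \<nu> = (e - grad f x) /\<^sub>R norm (e - grad f x))"

end

theory Submission
  imports Defs "HOL-Probability.Characteristic_Functions"
begin

text \<open>
  Write \<open>H\<close> for surface measure, \<open>M\<close> for the boundary of \<open>\<Omega>\<close>, \<open>\<gamma>\<close> for the Gaussian density
  and \<open>N\<close> for the exterior normal. Since \<open>\<gamma> = (\<parallel>N\<parallel>\<^sub>1 / \<surd>n) \<gamma> + (1 - \<parallel>N\<parallel>\<^sub>1 / \<surd>n) \<gamma>\<close> on \<open>M\<close>,
  the theorem says that the sum over \<open>i\<close> of the fluxes \<open>\<integral>\<^sub>M \<bar>N\<^sub>i\<bar> \<gamma> dH\<close> is at least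
  \<open>\<surd>n (1 - 6 \<cdot> 10\<^sup>-\<^sup>9)\<close> times the Gaussian perimeter of \<open>B\<close>. Both sides are compared with
  the Gaussian mass \<open>D\<close> of a hyperplane through the origin, which does not depend on the
  hyperplane.

  The flux through \<open>M\<close> in the direction \<open>e\<^sub>i\<close> weighs the points where lines parallel to
  \<open>e\<^sub>i\<close> cross \<open>M\<close>. Along almost every such line \<open>\<Omega>\<close> is turned into its complement by a unit
  step. So the points where membership in \<open>\<Omega>\<close> changes form a non-empty set of period 1, and
  their weight is at least \<open>\<Sum>\<^sub>k exp (- (s + k)\<^sup>2 / 2)\<close> for some \<open>s\<close>. Poisson summation gives
  \<open>\<surd>(2\<pi>) (1 + 2 \<Sum>\<^sub>m exp (- 2 \<pi>\<^sup>2 m\<^sup>2) cos (2 \<pi> m s))\<close> for this sum, and \<open>2 exp (- 2 \<pi>\<^sup>2)\<close> is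
  about \<open>5.4 \<cdot> 10\<^sup>-\<^sup>9\<close>; this is the origin of the constant in the theorem. So each flux is
  at least \<open>\<surd>(2\<pi>) (1 - 5.9 \<cdot> 10\<^sup>-\<^sup>9) D\<close> (\<open>normal_flux_lower_bound\<close>,
  \<open>gauss_sum_unit_variance_lower\<close>).

  The boundary of \<open>B\<close> lies in the hyperplanes at the distances \<open>k / \<surd>n\<close> from the origin, so
  its perimeter is at most \<open>D \<Sum>\<^sub>k exp (- k\<^sup>2 / (2 n))\<close>, and Poisson summation bounds this by
  \<open>D \<surd>(2 \<pi> n) (1 + 10\<^sup>-\<^sup>1\<^sup>0)\<close> because \<open>n \<ge> 2\<close> (\<open>half_space_perimeter_upper_bound\<close>,
  \<open>gauss_sum_large_variance_upper\<close>). As \<open>n \<surd>(2\<pi>) / \<surd>n = \<surd>(2 \<pi> n)\<close>, the two bounds give the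
  theorem.

  The crossings are counted with the help of Lebesgue measure. By uniqueness of translation
  invariant measures, the product of \<open>H\<close> on a hyperplane with length along its normal is a
  constant \<open>c\<close> times Lebesgue measure, with the same \<open>c\<close> for all hyperplanes
  (\<open>slicing_constant_exists\<close>). Since the inequality is homogeneous in \<open>H\<close>, the constant \<open>c\<close>
  cancels. Moving \<open>M\<close> by \<open>- t e\<close> for \<open>0 \<le> t \<le> h\<close> sweeps a set whose Gaussian mass,
  multiplied by \<open>c / h\<close>, is asymptotically at most the flux (\<open>global_flux_bound\<close>). On the
  other hand this set contains every \<open>x\<close> for which exactly one of \<open>x\<close> and \<open>x + h e\<close> belongs
  to \<open>\<Omega>\<close>. Cutting almost every line into steps of length \<open>h\<close>, one of the steps in a unit of
  length must be of this kind, and the same holds for all its integral translates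
  (\<open>antiperiodic_crossings\<close>). This yields the lower bound for the swept mass.
\<close>

section \<open>Fourier series at a point\<close>

lemma borel_measurable_cnj [measurable (raw)]:
  "f \<in> borel_measurable M \<Longrightarrow> (\<lambda>x. cnj (f x)) \<in> borel_measurable M"
  by (rule borel_measurable_continuous_on[of cnj]) (auto intro: continuous_intros)

abbreviation leb01 :: "real measure" where "leb01 \<equiv> lebesgue_on {0<..<1}"

lemma finite_measure_leb01: "finite_measure leb01"
  by (rule finite_measure_lebesgue_on) (simp add: lmeasurable_interval)

lemma measurable_cis [measurable]: "(\<lambda>x. cis (2 * pi * of_int m * x)) \<in> borel_measurable leb01"
  by (intro continuous_imp_measurable_on_sets_lebesgue continuous_intros) auto

lemma integral_cis:
  fixes m :: int
  shows "(LINT x|leb01. cis (2 * pi * of_int m * x)) = (if m = 0 then 1 else 0)"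
proof -
  interpret finite_measure leb01 by (rule finite_measure_leb01)
  have "integrable leb01 (\<lambda>x. cis (2 * pi * of_int m * x))"
    by (rule integrable_const_bound[where B=1]) auto
  then have "(LINT x|leb01. cis (2 * pi * of_int m * x)) = integral {0<..<1} (\<lambda>x. cis (2 * pi * of_int m * x))"
    by (rule lebesgue_integral_eq_integral) auto
  also have "\<dots> = integral {0..1} (\<lambda>x. cis (2 * pi * of_int m * x))"
    using integral_open_interval_real by (metis)
  also have "\<dots> = (if m = 0 then 1 else 0)"
  proof (cases "m = 0")
    case False
    define a where "a = complex_of_real (2 * pi * of_int m)"
    have a: "a \<noteq> 0" using False by (simp add: a_def)
    have "((\<lambda>x. cis (2 * pi * of_int m * x)) has_integral
        (cis (2 * pi * of_int m * 1) / (\<i> * a) - cis (2 * pi * of_int m * 0) / (\<i> * a))) {0..1}"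
    proof (rule fundamental_theorem_of_calculus)
      fix x :: real
      have *: "cis (2 * pi * of_int m * x) = exp (\<i> * a * of_real x)" for x
        by (simp add: cis_conv_exp a_def mult_ac)
      have "((\<lambda>z. exp (\<i> * a * z) / (\<i> * a)) has_field_derivative exp (\<i> * a * of_real x)) (at (of_real x))"
        using a by (auto intro!: derivative_eq_intros)
      from has_vector_derivative_real_field[OF this]
      show "((\<lambda>x. cis (2 * pi * of_int m * x) / (\<i> * a)) has_vector_derivative cis (2 * pi * of_int m * x))
          (at x within {0..1})"
        unfolding * by simp
    qed simp
    moreover have "cis (2 * pi * of_int m * 1) = 1"
      using cis_multiple_2pi[of "of_int m"] by (simp)
    ultimately show ?thesis using False by (simp add: integral_unique)
  qed simp
  finally show ?thesis .
qed

text \<open>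
  Bessel's inequality, from the integral of \<open>\<bar>D - P\<bar>\<^sup>2 \<ge> 0\<close> for the Fourier sum \<open>P\<close> of \<open>D\<close>
  over \<open>S\<close>. It is used only to see that Fourier coefficients of a bounded function tend to
  zero.
\<close>
lemma bessel:
  fixes D :: "real \<Rightarrow> complex"
  assumes [measurable]: "D \<in> borel_measurable leb01" and bd: "\<And>x. norm (D x) \<le> C"
  assumes S: "finite S"
  defines "d \<equiv> \<lambda>m::int. LINT x|leb01. D x * cis (- (2 * pi * of_int m * x))"
  shows "(\<Sum>m\<in>S. (norm (d m))\<^sup>2) \<le> C\<^sup>2"
proof -
  interpret finite_measure leb01 by (rule finite_measure_leb01)
  have C: "C \<ge> 0" using bd[of 0] norm_ge_zero order_trans by blast
  define e where "e m x = cis (2 * pi * of_int m * x)" for m :: int and x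
  have [measurable]: "e m \<in> borel_measurable leb01" for m unfolding e_def by measurable
  have cnj_e: "cnj (e m x) = cis (- (2 * pi * of_int m * x))" for m x by (simp add: e_def cis_cnj)
  have ne: "norm (e m x) = 1" for m x by (simp add: e_def)
  define P where "P x = (\<Sum>m\<in>S. d m * e m x)" for x
  have [measurable]: "P \<in> borel_measurable leb01" unfolding P_def by measurable
  define B where "B = (\<Sum>m\<in>S. norm (d m))"
  have B: "norm (P x) \<le> B" for x
    unfolding P_def B_def by (rule sum_norm_le) (simp add: norm_mult ne)
  have iD: "integrable leb01 (\<lambda>x. D x * cnj (e m x))" for m
    by (rule integrable_const_bound[where B=C]) (auto simp: norm_mult ne bd)
  have iE: "integrable leb01 (\<lambda>x. e m x * cnj (e l x))" for m l
    by (rule integrable_const_bound[where B=1]) (auto simp: norm_mult ne bd)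
  have dm: "(LINT x|leb01. D x * cnj (e m x)) = d m" for m
    by (simp add: d_def cnj_e)
  have ee: "(LINT x|leb01. e m x * cnj (e l x)) = (if m = l then 1 else 0)" for m l
  proof -
    have "e m x * cnj (e l x) = cis (2 * pi * of_int (m - l) * x)" for x
      unfolding cnj_e by (simp add: e_def cis_mult algebra_simps)
    then show ?thesis using integral_cis[of "m - l"] by simp
  qed
  have iDP: "integrable leb01 (\<lambda>x. D x * cnj (P x))"
    by (rule integrable_const_bound[where B="C * B"]) (auto simp: norm_mult intro!: mult_mono bd B C)
  have DP: "(LINT x|leb01. D x * cnj (P x)) = of_real (\<Sum>m\<in>S. (norm (d m))\<^sup>2)"
  proof -
    have "(LINT x|leb01. D x * cnj (P x)) = (LINT x|leb01. (\<Sum>m\<in>S. cnj (d m) * (D x * cnj (e m x))))"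
      by (simp add: P_def sum_distrib_left mult_ac)
    also have "\<dots> = (\<Sum>m\<in>S. cnj (d m) * d m)"
      using iD by (subst Bochner_Integration.integral_sum) (auto simp: dm)
    also have "\<dots> = of_real (\<Sum>m\<in>S. (norm (d m))\<^sup>2)"
      by (simp add: complex_norm_square mult.commute del: of_real_power)
    finally show ?thesis .
  qed
  have PP: "(LINT x|leb01. P x * cnj (P x)) = of_real (\<Sum>m\<in>S. (norm (d m))\<^sup>2)"
  proof -
    have "(LINT x|leb01. P x * cnj (P x)) = (LINT x|leb01. (\<Sum>m\<in>S. \<Sum>l\<in>S. (d m * cnj (d l)) * (e m x * cnj (e l x))))"
      by (simp add: P_def sum_product mult_ac)
    also have "\<dots> = (\<Sum>m\<in>S. \<Sum>l\<in>S. (d m * cnj (d l)) * (if m = l then 1 else 0))"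
      using iE by (subst Bochner_Integration.integral_sum, force,
          subst Bochner_Integration.integral_sum) (auto simp: ee simp del: mult_1_right)
    also have "\<dots> = of_real (\<Sum>m\<in>S. (norm (d m))\<^sup>2)"
      using S by (simp add: complex_norm_square if_distrib sum.delta cong: if_cong del: of_real_power)
    finally show ?thesis .
  qed
  have iPP: "integrable leb01 (\<lambda>x. P x * cnj (P x))"
    by (rule integrable_const_bound[where B="B * B"])
      (auto simp: norm_mult intro!: mult_mono B order_trans[OF norm_ge_zero B])
  have iDD: "integrable leb01 (\<lambda>x. D x * cnj (D x))"
    by (rule integrable_const_bound[where B="C * C"]) (auto simp: norm_mult intro!: mult_mono bd C)
  define u where "u x = Re (D x * cnj (P x))" for x
  define v where "v x = Re (P x * cnj (P x))" for x
  define w where "w x = Re (D x * cnj (D x))" for x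
  have r: "2 * u x - v x \<le> w x" for x
  proof -
    have "w x - 2 * u x + v x = (norm (D x - P x))\<^sup>2"
      unfolding cmod_power2 u_def v_def w_def by (simp add: power2_eq_square algebra_simps)
    then show ?thesis using zero_le_power2[of "norm (D x - P x)"] by linarith
  qed
  have iu: "integrable leb01 u" and iv: "integrable leb01 v" and iw: "integrable leb01 w"
    unfolding u_def v_def w_def by (intro integrable_Re iDP iPP iDD)+
  have "integral\<^sup>L leb01 u = (\<Sum>m\<in>S. (norm (d m))\<^sup>2)" "integral\<^sup>L leb01 v = (\<Sum>m\<in>S. (norm (d m))\<^sup>2)"
    unfolding u_def v_def integral_Re[OF iDP] integral_Re[OF iPP] DP PP by simp_all
  then have "(\<Sum>m\<in>S. (norm (d m))\<^sup>2) = (LINT x|leb01. 2 * u x - v x)"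
    using iu iv by simp
  also have "\<dots> \<le> integral\<^sup>L leb01 w"
    using iu iv iw r by (intro integral_mono) auto
  also have "\<dots> \<le> (LINT x|leb01. C\<^sup>2)"
  proof (rule integral_mono[OF iw])
    show "w x \<le> C\<^sup>2" for x
      using power_mono[OF bd norm_ge_zero, of x 2] unfolding cmod_power2 by (simp add: w_def power2_eq_square)
  qed simp
  also have "\<dots> = C\<^sup>2" by (simp add: measure_restrict_space)
  finally show ?thesis .
qed

text \<open>
  The left side is \<open>2 \<bar>sin (\<pi> x)\<bar>\<close>. The crude bound \<open>sin y \<ge> y / 3\<close> on \<open>[0, \<pi> / 2]\<close>
  suffices, since only the linear order of vanishing at the two end points matters.
\<close>
lemma norm_cis_minus_one_ge:
  assumes "0 < x" "x < 1"
  shows "norm (cis (2 * pi * x) - 1) \<ge> min x (1 - x)"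
proof -
  have sin_ge: "sin y \<ge> y / 3" if "0 \<le> y" "y \<le> pi / 2" for y :: real
  proof -
    have "\<bar>sin y - (\<Sum>m<3. sin_coeff m * y ^ m)\<bar> \<le> inverse (fact 3) * \<bar>y\<bar> ^ 3"
      by (rule Maclaurin_sin_bound)
    then have "\<bar>sin y - y\<bar> \<le> y ^ 3 / 6"
      using that by (simp add: numeral_3_eq_3 sin_coeff_def fact_numeral)
    moreover have "y ^ 3 \<le> 4 * y"
    proof -
      have "y \<le> 2" using that pi_less_4 by linarith
      then have "y * y \<le> 2 * 2" using that by (intro mult_mono) auto
      then have "y * y * y \<le> 4 * y" using that by (intro mult_right_mono) auto
      then show ?thesis by (simp add: power3_eq_cube)
    qed
    ultimately show ?thesis by linarith
  qed
  define t where "t = min x (1 - x)"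
  have t: "t \<le> x" "t \<le> 1 - x" by (auto simp: t_def)
  have "sin (pi * x) \<ge> t / 2"
  proof (cases "x \<le> 1 / 2")
    case True
    have "sin (pi * x) \<ge> (pi * x) / 3" using assms True by (intro sin_ge) auto
    moreover have "pi * x \<ge> 2 * x" using assms pi_ge_two by (intro mult_right_mono) auto
    ultimately show ?thesis using assms t by linarith
  next
    case False
    define y where "y = 1 - x"
    have y: "0 < y" "y \<le> 1 / 2" "t \<le> y" using assms False t by (auto simp: y_def)
    have "sin (pi * x) = sin (pi * y)" by (simp add: y_def right_diff_distrib sin_diff)
    moreover have "sin (pi * y) \<ge> (pi * y) / 3" using y by (intro sin_ge) auto
    moreover have "pi * y \<ge> 2 * y" using y pi_ge_two by (intro mult_right_mono) auto
    ultimately show ?thesis using y by linarith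
  qed
  then have "\<bar>sin (pi * x)\<bar> \<ge> t / 2" by linarith
  moreover have "norm (cis (2 * pi * x) - 1) = 2 * \<bar>sin (pi * x)\<bar>"
    using dist_exp_i_1[of "2 * pi * x"] by (simp add: cis_conv_exp mult_ac)
  ultimately show ?thesis by (simp add: t_def)
qed

text \<open>
  Divide \<open>F - F 0\<close> by \<open>exp (2 \<pi> \<i> x) - 1\<close>. The Lipschitz condition at the two ends makes the
  quotient \<open>D\<close> bounded, and multiplying back shows that the coefficients of \<open>F - F 0\<close> are
  successive differences of those of \<open>D\<close>. So the partial sums of the Fourier series
  telescope, and the remainder consists of two coefficients of \<open>D\<close>, which tend to zero.
\<close>
lemma fourier_series_at_0:
  fixes F :: "real \<Rightarrow> complex"
  assumes cont: "continuous_on {0..1} F"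
    and lip: "\<And>x. 0 < x \<Longrightarrow> x < 1 \<Longrightarrow> norm (F x - F 0) \<le> L * min x (1 - x)"
  shows "(\<lambda>N. \<Sum>m=-int N..int N. LINT x|leb01. F x * cis (- (2 * pi * of_int m * x))) \<longlonglongrightarrow> F 0"
proof -
  interpret finite_measure leb01 by (rule finite_measure_leb01)
  have nz: "cis (2 * pi * x) - 1 \<noteq> 0" if "0 < x" "x < 1" for x
    using norm_cis_minus_one_ge[OF that] that by auto
  define D where "D x = (if 0 < x \<and> x < 1 then (F x - F 0) / (cis (2 * pi * x) - 1) else 0)" for x
  have "continuous_on {0<..<1} (\<lambda>x. (F x - F 0) / (cis (2 * pi * x) - 1))"
    using nz by (intro continuous_intros continuous_on_subset[OF cont]) auto
  then have "continuous_on {0<..<1} D"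
    by (rule continuous_on_cong[THEN iffD1, rotated -1]) (auto simp: D_def)
  then have mD [measurable]: "D \<in> borel_measurable leb01"
    by (intro continuous_imp_measurable_on_sets_lebesgue) auto
  have mF [measurable]: "F \<in> borel_measurable leb01"
    by (intro continuous_imp_measurable_on_sets_lebesgue continuous_on_subset[OF cont]) auto
  have L0: "L \<ge> 0"
    using order_trans[OF norm_ge_zero lip[of "1/2"]] by auto
  have bD: "norm (D x) \<le> L" for x
  proof (cases "0 < x \<and> x < 1")
    case True
    then have "norm (F x - F 0) \<le> L * norm (cis (2 * pi * x) - 1)"
      using lip[of x] norm_cis_minus_one_ge[of x] L0 by (meson mult_left_mono order_trans)
    then show ?thesis using nz[of x] True by (simp add: D_def norm_divide divide_le_eq)
  qed (auto simp: D_def L0)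
  define d where "d m = (LINT x|leb01. D x * cis (- (2 * pi * of_int m * x)))" for m :: int
  define f where "f m = (LINT x|leb01. F x * cis (- (2 * pi * of_int m * x)))" for m :: int
  obtain BF where BF: "\<And>x. x \<in> {0..1} \<Longrightarrow> norm (F x) \<le> BF"
    using compact_imp_bounded[OF compact_continuous_image[OF cont]] unfolding bounded_iff by blast
  have m: "(\<lambda>x. cis (- (2 * pi * of_int m * x))) \<in> borel_measurable leb01" for m
    using measurable_cis[of "-m"] by simp
  note [measurable] = m
  have iD: "integrable leb01 (\<lambda>x. D x * cis (- (2 * pi * of_int m * x)))" for m
    by (rule integrable_const_bound[where B=L]) (auto simp: norm_mult bD)
  have iF: "integrable leb01 (\<lambda>x. F x * cis (- (2 * pi * of_int m * x)))" for m
    by (rule integrable_const_bound[where B=BF]) (auto simp: norm_mult BF)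
  have i1: "integrable leb01 (\<lambda>x. F 0 * cis (- (2 * pi * of_int m * x)))" for m
    by (rule integrable_const_bound[where B="norm (F 0)"]) (auto simp: norm_mult)
  have rec: "d (m - 1) - d m = f m - (if m = 0 then F 0 else 0)" for m
  proof -
    have "d (m - 1) - d m = (LINT x|leb01. D x * cis (- (2 * pi * of_int (m - 1) * x)) - D x * cis (- (2 * pi * of_int m * x)))"
      unfolding d_def by (rule Bochner_Integration.integral_diff[symmetric]) (rule iD)+
    also have "\<dots> = (LINT x|leb01. F x * cis (- (2 * pi * of_int m * x)) - F 0 * cis (- (2 * pi * of_int m * x)))"
    proof (rule Bochner_Integration.integral_cong)
      fix x assume "x \<in> space leb01"
      then have x: "0 < x" "x < 1" by auto
      have "cis (- (2 * pi * of_int (m - 1) * x)) = cis (2 * pi * x) * cis (- (2 * pi * of_int m * x))"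
        by (simp add: cis_mult algebra_simps)
      then have "D x * cis (- (2 * pi * of_int (m - 1) * x)) - D x * cis (- (2 * pi * of_int m * x))
          = (D x * (cis (2 * pi * x) - 1)) * cis (- (2 * pi * of_int m * x))"
        by (simp add: algebra_simps)
      also have "D x * (cis (2 * pi * x) - 1) = F x - F 0"
        using nz[OF x] x by (simp add: D_def)
      finally show "D x * cis (- (2 * pi * of_int (m - 1) * x)) - D x * cis (- (2 * pi * of_int m * x))
          = F x * cis (- (2 * pi * of_int m * x)) - F 0 * cis (- (2 * pi * of_int m * x))"
        by (simp add: algebra_simps)
    qed simp
    also have "\<dots> = f m - F 0 * (LINT x|leb01. cis (- (2 * pi * of_int m * x)))"
      unfolding f_def using iF i1 by (subst Bochner_Integration.integral_diff) auto
    also have "(LINT x|leb01. cis (- (2 * pi * of_int m * x))) = (if m = 0 then 1 else 0)"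
      using integral_cis[of "- m"] by simp
    finally show ?thesis by simp
  qed
  have sum_f: "(\<Sum>m=-int N..int N. f m) = F 0 + d (- int N - 1) - d (int N)" for N
  proof (induction N)
    case 0 show ?case using rec[of 0] by (simp add: algebra_simps)
  next
    case (Suc N)
    have "{-int (Suc N)..int (Suc N)} = insert (int N + 1) (insert (- int N - 1) {-int N..int N})"
      by auto
    then have "(\<Sum>m=-int (Suc N)..int (Suc N). f m) = f (int N + 1) + (f (- int N - 1) + (\<Sum>m=-int N..int N. f m))"
      by simp
    also have "\<dots> = F 0 + d (- int (Suc N) - 1) - d (int (Suc N))"
      using rec[of "int N + 1"] rec[of "- int N - 1"] by (simp add: Suc algebra_simps)
    finally show ?case .
  qed
  \<comment> \<open>Injectivity of g makes the sum of the squares a sum over distinct frequencies,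
    so that Bessel's inequality applies.\<close>
  have lim: "(\<lambda>N. d (g N)) \<longlonglongrightarrow> 0" if "inj g" for g :: "nat \<Rightarrow> int"
  proof -
    have "summable (\<lambda>N. (norm (d (g N)))\<^sup>2)"
    proof (rule summableI_nonneg_bounded)
      fix k :: nat
      have "(\<Sum>N<k. (norm (d (g N)))\<^sup>2) = (\<Sum>m\<in>g ` {..<k}. (norm (d m))\<^sup>2)"
        using that by (subst sum.reindex) (auto intro: inj_on_subset)
      also have "\<dots> \<le> L\<^sup>2" unfolding d_def by (rule bessel[OF mD bD]) simp
      finally show "(\<Sum>N<k. (norm (d (g N)))\<^sup>2) \<le> L\<^sup>2" .
    qed simp
    then have "(\<lambda>N. (norm (d (g N)))\<^sup>2) \<longlonglongrightarrow> 0" by (rule summable_LIMSEQ_zero)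
    then have "(\<lambda>N. sqrt ((norm (d (g N)))\<^sup>2)) \<longlonglongrightarrow> sqrt 0" by (rule tendsto_real_sqrt)
    then show ?thesis by (simp add: tendsto_norm_zero_iff)
  qed
  have "(\<lambda>N. F 0 + d (- int N - 1) - d (int N)) \<longlonglongrightarrow> F 0 + 0 - 0"
    by (intro tendsto_intros lim) (auto simp: inj_def)
  then show ?thesis using sum_f by (simp add: f_def)
qed

section \<open>Poisson summation for Gaussians\<close>

text \<open>
  The sum is finite so that it can be compared with finitely many steps along a line; the
  passage to all integers is contained in the uniform estimate \<open>gauss_sum_approx\<close>.
\<close>
definition gauss_sum :: "real \<Rightarrow> nat \<Rightarrow> real \<Rightarrow> real" where
  "gauss_sum \<sigma> K s = (\<Sum>k\<in>{-int K..<int K}. exp (- (s + of_int k)\<^sup>2 / (2 * \<sigma>\<^sup>2)))"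

text \<open>
  An affine substitution reduces this to the characteristic function of the standard normal
  distribution.
\<close>
lemma gauss_fourier:
  fixes \<sigma> s :: real and m :: int
  assumes "\<sigma> > 0"
  defines "\<psi> \<equiv> \<lambda>(m::int) y. complex_of_real (exp (- (s + y)\<^sup>2 / (2 * \<sigma>\<^sup>2))) * cis (- (2 * pi * of_int m * y))"
  shows "integrable lborel (\<psi> m)"
    and "(LINT y|lborel. \<psi> m y) = of_real (\<sigma> * sqrt (2 * pi) * exp (- 2 * pi\<^sup>2 * \<sigma>\<^sup>2 * (of_int m)\<^sup>2)) * cis (2 * pi * of_int m * s)"
proof -
  define a where "a = - (2 * pi * of_int m * \<sigma>)"
  have \<psi>: "\<psi> m (- s + \<sigma> * x) = (sqrt (2 * pi) * cis (2 * pi * of_int m * s)) * (std_normal_density x *\<^sub>R iexp (a * x))" for x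
  proof -
    have "cis (- (2 * pi * of_int m * (- s + \<sigma> * x))) = cis (2 * pi * of_int m * s) * iexp (a * x)"
    proof -
      have "iexp (a * x) = cis (a * x)" by (simp add: cis_conv_exp)
      then show ?thesis by (simp add: a_def cis_mult algebra_simps)
    qed
    then show ?thesis using assms
      by (simp add: \<psi>_def std_normal_density_def power_mult_distrib scaleR_conv_of_real)
  qed
  have int: "integrable lborel (\<lambda>x. std_normal_density x *\<^sub>R iexp (a * x))"
    by (rule integrableI_bounded_set_indicator[where B=1] Bochner_Integration.integrable_bound[OF integrable_normal_density[of 1 0]])
      (auto simp: norm_mult)
  have "integrable lborel (\<lambda>x. \<psi> m (- s + \<sigma> * x))"
    unfolding \<psi> by (intro integrable_mult_right int)
  then show "integrable lborel (\<psi> m)"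
    using assms lborel_integrable_real_affine_iff[of \<sigma> "\<psi> m" "- s"] by simp
  have "(LINT y|lborel. \<psi> m y) = \<sigma> *\<^sub>R (LINT x|lborel. \<psi> m (- s + \<sigma> * x))"
    using assms by (subst lborel_integral_real_affine[of \<sigma> "\<psi> m" "- s"]) auto
  also have "\<dots> = \<sigma> * (sqrt (2 * pi) * cis (2 * pi * of_int m * s)) * (LINT x|lborel. std_normal_density x *\<^sub>R iexp (a * x))"
    unfolding \<psi> by (simp add: scaleR_conv_of_real)
  also have "(LINT x|lborel. std_normal_density x *\<^sub>R iexp (a * x)) = char std_normal_distribution a"
    unfolding char_def by (subst integral_density) auto
  also have "\<dots> = exp (- a\<^sup>2 / 2)" by (simp add: char_std_normal_distribution)
  also have "- a\<^sup>2 / 2 = - 2 * pi\<^sup>2 * \<sigma>\<^sup>2 * (of_int m)\<^sup>2" by (simp add: a_def power_mult_distrib)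
  finally show "(LINT y|lborel. \<psi> m y) = of_real (\<sigma> * sqrt (2 * pi) * exp (- 2 * pi\<^sup>2 * \<sigma>\<^sup>2 * (of_int m)\<^sup>2)) * cis (2 * pi * of_int m * s)"
    by (simp add: mult_ac)
qed

text \<open>
  Unfolding: integrals of the translates of \<open>g\<close> over one period add up to an integral of
  \<open>g\<close>.
\<close>
lemma integral_unit_cells:
  fixes g :: "real \<Rightarrow> complex"
  assumes cont: "continuous_on UNIV g"
  shows "(\<Sum>k\<in>{-int K..<int K}. integral {0..1} (\<lambda>x. g (x + of_int k))) = integral {-real K..real K} g"
proof (induction K)
  case (Suc K)
  have ig: "g integrable_on {a..b}" for a b
    by (intro integrable_continuous_interval continuous_on_subset[OF cont]) auto
  have cell: "integral {0..1} (\<lambda>x. g (x + of_int k)) = integral {of_int k..of_int k + 1} g" for k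
    using integral_shift_real_ivl[of "of_int k" "of_int k" "of_int k + 1" g] by simp
  have "{-int (Suc K)..<int (Suc K)} = insert (int K) (insert (- int K - 1) {-int K..<int K})"
    by auto
  then have "(\<Sum>k\<in>{-int (Suc K)..<int (Suc K)}. integral {0..1} (\<lambda>x. g (x + of_int k)))
      = integral {real K..real K + 1} g + (integral {- real K - 1..- real K} g + integral {-real K..real K} g)"
    by (simp add: Suc[unfolded cell] cell del: of_nat_Suc)
  also have "integral {- real K - 1..- real K} g + integral {-real K..real K} g = integral {- real K - 1..real K} g"
    by (intro Henstock_Kurzweil_Integration.integral_combine ig) auto
  also have "integral {real K..real K + 1} g + integral {- real K - 1..real K} g = integral {- real K - 1..real K + 1} g"
    using Henstock_Kurzweil_Integration.integral_combine[OF _ _ ig, of "- real K - 1" "real K" "real K + 1"]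
    by (simp add: add.commute)
  finally show ?case
    by (simp only: of_nat_Suc minus_add_distrib add.commute[of 1] uminus_add_conv_diff
        diff_conv_add_uminus[symmetric] add_uminus_conv_diff)
qed simp

lemma integral_symmetric_LIMSEQ:
  fixes g :: "real \<Rightarrow> complex"
  assumes int: "integrable lborel g"
  shows "(\<lambda>K. integral {-real K..real K} g) \<longlonglongrightarrow> integral\<^sup>L lborel g"
proof -
  have [measurable]: "g \<in> borel_measurable borel" using int by auto
  have "(\<lambda>K. LINT x|lborel. indicator {-real K..real K} x *\<^sub>R g x) \<longlonglongrightarrow> integral\<^sup>L lborel g"
  proof (rule integral_dominated_convergence[where w="\<lambda>x. norm (g x)"])
    have "(\<lambda>K. indicator {-real K..real K} x *\<^sub>R g x) \<longlonglongrightarrow> g x" for x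
    proof (rule tendsto_eventually)
      obtain N :: nat where N: "\<bar>x\<bar> \<le> real N" using real_arch_simple by blast
      show "\<forall>\<^sub>F K in sequentially. indicator {-real K..real K} x *\<^sub>R g x = g x"
        using eventually_ge_at_top[of N] by eventually_elim (use N in \<open>auto simp: indicator_def\<close>)
    qed
    then show "AE x in lborel. (\<lambda>K. indicator {-real K..real K} x *\<^sub>R g x) \<longlonglongrightarrow> g x" by simp
  qed (use int in \<open>auto simp: indicator_def\<close>)
  moreover have "(LINT x|lborel. indicator {-real K..real K} x *\<^sub>R g x) = integral {-real K..real K} g" for K
  proof -
    have "set_integrable lborel {-real K..real K} g"
      unfolding set_integrable_def by (intro integrable_mult_indicator int) auto
    from set_borel_integral_eq_integral(2)[OF this] show ?thesis by (simp add: set_lebesgue_integral_def)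
  qed
  ultimately show ?thesis by simp
qed

text \<open>
  Completing the square, \<open>y\<^sup>2 \<ge> 4 \<bar>y\<bar> - 4\<close>, trades Gaussian decay for exponential decay.
  This makes the series of the translates, and of their derivatives, comparable with
  geometric series.
\<close>
lemma gauss_decay:
  fixes \<sigma> y c :: real
  assumes "\<sigma> > 0" "\<bar>y\<bar> \<ge> c"
  shows "exp (- y\<^sup>2 / (2 * \<sigma>\<^sup>2)) \<le> exp (2 / \<sigma>\<^sup>2) * exp (- c / \<sigma>\<^sup>2)"
    and "\<bar>y / \<sigma>\<^sup>2\<bar> * exp (- y\<^sup>2 / (2 * \<sigma>\<^sup>2)) \<le> exp (2 / \<sigma>\<^sup>2) * exp (- c / \<sigma>\<^sup>2)"
proof -
  define t where "t = \<bar>y\<bar> / \<sigma>\<^sup>2"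
  have t: "t \<ge> 0" "c / \<sigma>\<^sup>2 \<le> t" using assms by (auto simp: t_def divide_right_mono)
  have "0 \<le> (\<bar>y\<bar> - 2)\<^sup>2" by simp
  then have "4 * \<bar>y\<bar> - 4 \<le> y\<^sup>2" by (simp add: power2_diff)
  then have "(4 * \<bar>y\<bar> - 4) / (2 * \<sigma>\<^sup>2) \<le> y\<^sup>2 / (2 * \<sigma>\<^sup>2)" by (intro divide_right_mono) auto
  moreover have "(4 * \<bar>y\<bar> - 4) / (2 * \<sigma>\<^sup>2) = 2 * t - 2 / \<sigma>\<^sup>2"
    by (simp add: t_def diff_divide_distrib)
  ultimately have "- y\<^sup>2 / (2 * \<sigma>\<^sup>2) \<le> 2 / \<sigma>\<^sup>2 - 2 * t" by simp
  then have "exp (- y\<^sup>2 / (2 * \<sigma>\<^sup>2)) \<le> exp (2 / \<sigma>\<^sup>2 - 2 * t)" by simp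
  also have "\<dots> = exp (2 / \<sigma>\<^sup>2) * exp (- t) * exp (- t)" by (simp flip: exp_add)
  finally have e: "exp (- y\<^sup>2 / (2 * \<sigma>\<^sup>2)) \<le> exp (2 / \<sigma>\<^sup>2) * exp (- t) * exp (- t)" .
  have t1: "exp (- t) \<le> exp (- c / \<sigma>\<^sup>2)" using t by simp
  have "exp (2 / \<sigma>\<^sup>2) * exp (- t) * exp (- t) \<le> exp (2 / \<sigma>\<^sup>2) * exp (- c / \<sigma>\<^sup>2) * 1"
    using t t1 by (intro mult_mono) auto
  from order_trans[OF e this] show "exp (- y\<^sup>2 / (2 * \<sigma>\<^sup>2)) \<le> exp (2 / \<sigma>\<^sup>2) * exp (- c / \<sigma>\<^sup>2)"
    by simp
  have te: "t * exp (- t) \<le> 1"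
  proof -
    have "t \<le> exp t" using exp_ge_add_one_self[of t] by linarith
    then show ?thesis by (simp add: exp_minus field_simps)
  qed
  have "\<bar>y / \<sigma>\<^sup>2\<bar> * exp (- y\<^sup>2 / (2 * \<sigma>\<^sup>2)) \<le> t * (exp (2 / \<sigma>\<^sup>2) * exp (- t) * exp (- t))"
    using e t by (intro mult_mono) (auto simp: t_def abs_divide)
  also have "\<dots> = (t * exp (- t)) * (exp (2 / \<sigma>\<^sup>2) * exp (- t))" by simp
  also have "\<dots> \<le> 1 * (exp (2 / \<sigma>\<^sup>2) * exp (- c / \<sigma>\<^sup>2))"
    using te t t1 by (intro mult_mono) auto
  finally show "\<bar>y / \<sigma>\<^sup>2\<bar> * exp (- y\<^sup>2 / (2 * \<sigma>\<^sup>2)) \<le> exp (2 / \<sigma>\<^sup>2) * exp (- c / \<sigma>\<^sup>2)" by simp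
qed

text \<open>
  The interval \<open>[-2, 2]\<close> contains \<open>s + x\<close> for \<open>s\<close> and \<open>x\<close> in \<open>[0, 1]\<close>, which is where the
  limit is needed. The terms are grouped as \<open>k\<close> with \<open>- k - 1\<close>, so that the partial sums are
  those of a series indexed by naturals.
\<close>
lemma gauss_sum_limit:
  assumes \<sigma>: "\<sigma> > 0"
  obtains F L where "uniform_limit {-2..2} (gauss_sum \<sigma>) F sequentially"
    and "\<And>x y. x \<in> {-2..2} \<Longrightarrow> y \<in> {-2..2} \<Longrightarrow> \<bar>F x - F y\<bar> \<le> L * \<bar>x - y\<bar>"
    and "\<And>x. x \<in> {-2..1} \<Longrightarrow> F (x + 1) = F x"
proof -
  define \<phi> where "\<phi> y = exp (- y\<^sup>2 / (2 * \<sigma>\<^sup>2))" for y :: real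
  define g where "g k s = \<phi> (s + real k) + \<phi> (s - real k - 1)" for k s
  define r where "r = exp (- 1 / \<sigma>\<^sup>2)"
  define A where "A = exp (2 / \<sigma>\<^sup>2) * exp (2 / \<sigma>\<^sup>2)"
  have r: "0 < r" "r < 1" using \<sigma> by (auto simp: r_def)
  have bd: "\<phi> y \<le> A * r ^ k" "\<bar>y / \<sigma>\<^sup>2\<bar> * \<phi> y \<le> A * r ^ k" if "\<bar>y\<bar> \<ge> real k - 2" for y k
  proof -
    have "exp (- (real k - 2) / \<sigma>\<^sup>2) = exp (2 / \<sigma>\<^sup>2) * r ^ k"
      by (simp add: r_def flip: exp_of_nat_mult exp_add) (simp add: field_simps diff_divide_distrib)
    then show "\<phi> y \<le> A * r ^ k" "\<bar>y / \<sigma>\<^sup>2\<bar> * \<phi> y \<le> A * r ^ k"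
      using gauss_decay[OF \<sigma> that] by (simp_all add: \<phi>_def A_def mult.assoc)
  qed
  have gs: "gauss_sum \<sigma> K s = (\<Sum>k<K. g k s)" for K s
  proof (induction K)
    case (Suc K)
    have "{-int (Suc K)..<int (Suc K)} = insert (int K) (insert (- int K - 1) {-int K..<int K})"
      by auto
    then show ?case using Suc by (simp add: gauss_sum_def g_def \<phi>_def algebra_simps del: of_nat_Suc)
  qed (simp add: gauss_sum_def)
  have sumr: "summable (\<lambda>k. 2 * A * r ^ k)"
    using r by (intro summable_mult summable_geometric) auto
  define F where "F s = (\<Sum>k. g k s)" for s
  have gb: "\<bar>g k s\<bar> \<le> 2 * A * r ^ k" if "s \<in> {-2..2}" for k s
  proof -
    have "\<phi> (s + real k) \<le> A * r ^ k" "\<phi> (s - real k - 1) \<le> A * r ^ k"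
      using that by (auto intro!: bd)
    moreover have "0 \<le> \<phi> (s + real k)" "0 \<le> \<phi> (s - real k - 1)" by (auto simp: \<phi>_def)
    ultimately show ?thesis by (simp add: g_def)
  qed
  have ul: "uniform_limit {-2..2} (\<lambda>K s. \<Sum>k<K. g k s) F sequentially"
    unfolding F_def by (rule Weierstrass_m_test[OF _ sumr]) (use gb in auto)
  then have ul': "uniform_limit {-2..2} (gauss_sum \<sigma>) F sequentially"
    by (simp add: gs[abs_def] cong: uniform_limit_cong')
  define L where "L = (\<Sum>k. 2 * A * r ^ k)"
  have d\<phi>: "((\<lambda>z. \<phi> (f z)) has_field_derivative (- (f z / \<sigma>\<^sup>2) * \<phi> (f z)) * f') (at z within S)"
    if "(f has_field_derivative f') (at z within S)" for f f' z S
    unfolding \<phi>_def using \<sigma> that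
    by (auto intro!: derivative_eq_intros simp: divide_simps power4_eq_xxxx power2_eq_square)
  have glip: "\<bar>g k x - g k y\<bar> \<le> 2 * A * r ^ k * \<bar>x - y\<bar>" if "x \<in> {-2..2}" "y \<in> {-2..2}" for k x y
  proof -
    have "norm (g k x - g k y) \<le> (2 * A * r ^ k) * norm (x - y)"
    proof (rule field_differentiable_bound[of "{-2..2}"])
      fix z :: real assume z: "z \<in> {-2..2}"
      let ?u = "z + real k" and ?v = "z - real k - 1"
      show "(g k has_field_derivative (- (?u / \<sigma>\<^sup>2) * \<phi> ?u - (?v / \<sigma>\<^sup>2) * \<phi> ?v)) (at z within {-2..2})"
        unfolding g_def by (auto intro!: derivative_eq_intros d\<phi>)
      have "\<bar>?u / \<sigma>\<^sup>2\<bar> * \<phi> ?u \<le> A * r ^ k" "\<bar>?v / \<sigma>\<^sup>2\<bar> * \<phi> ?v \<le> A * r ^ k"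
      proof -
        have "real k - 2 \<le> \<bar>?u\<bar>" "real k - 2 \<le> \<bar>?v\<bar>" using z by (simp_all add: abs_real_def)
        then show "\<bar>?u / \<sigma>\<^sup>2\<bar> * \<phi> ?u \<le> A * r ^ k" "\<bar>?v / \<sigma>\<^sup>2\<bar> * \<phi> ?v \<le> A * r ^ k"
          using bd(2)[where k=k and y="?u"] bd(2)[where k=k and y="?v"] by blast+
      qed
      moreover have "\<bar>- (?u / \<sigma>\<^sup>2) * \<phi> ?u - (?v / \<sigma>\<^sup>2) * \<phi> ?v\<bar> \<le> \<bar>?u / \<sigma>\<^sup>2\<bar> * \<phi> ?u + \<bar>?v / \<sigma>\<^sup>2\<bar> * \<phi> ?v"
        by (rule order_trans[OF abs_triangle_ineq4]) (simp add: abs_mult \<phi>_def)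
      ultimately show "norm (- (?u / \<sigma>\<^sup>2) * \<phi> ?u - (?v / \<sigma>\<^sup>2) * \<phi> ?v) \<le> 2 * A * r ^ k" by simp
    qed (use that in auto)
    then show ?thesis by simp
  qed
  have lim: "(\<lambda>K. \<Sum>k<K. g k x) \<longlonglongrightarrow> F x" if "x \<in> {-2..2}" for x
    using tendsto_uniform_limitI[OF ul that] .
  show thesis
  proof (rule that[OF ul'])
    fix x y :: real assume xy: "x \<in> {-2..2}" "y \<in> {-2..2}"
    show "\<bar>F x - F y\<bar> \<le> L * \<bar>x - y\<bar>"
    proof (rule LIMSEQ_le_const2)
      show "(\<lambda>K. \<bar>(\<Sum>k<K. g k x) - (\<Sum>k<K. g k y)\<bar>) \<longlonglongrightarrow> \<bar>F x - F y\<bar>"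
        by (intro tendsto_intros lim xy)
      have "\<bar>(\<Sum>k<K. g k x) - (\<Sum>k<K. g k y)\<bar> \<le> L * \<bar>x - y\<bar>" for K
      proof -
        have "\<bar>(\<Sum>k<K. g k x) - (\<Sum>k<K. g k y)\<bar> \<le> (\<Sum>k<K. 2 * A * r ^ k * \<bar>x - y\<bar>)"
          unfolding sum_subtractf[symmetric] by (rule order_trans[OF sum_abs]) (intro sum_mono glip xy)
        also have "\<dots> = (\<Sum>k<K. 2 * A * r ^ k) * \<bar>x - y\<bar>" by (simp add: sum_distrib_right)
        also have "\<dots> \<le> L * \<bar>x - y\<bar>"
          unfolding L_def using r by (intro mult_right_mono sum_le_suminf sumr) (auto simp: A_def)
        finally show ?thesis .
      qed
      then show "\<exists>N. \<forall>K\<ge>N. \<bar>(\<Sum>k<K. g k x) - (\<Sum>k<K. g k y)\<bar> \<le> L * \<bar>x - y\<bar>" by blast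
    qed
  next
    fix x :: real assume x: "x \<in> {-2..1}"
    have eq: "(\<Sum>k<K. g k (x + 1)) = (\<Sum>k<K. g k x) + \<phi> (x + real K) - \<phi> (x - real K)" for K
      by (induction K) (auto simp: g_def algebra_simps)
    have rk: "(\<lambda>K. A * r ^ K) \<longlonglongrightarrow> A * 0" using r by (intro tendsto_intros LIMSEQ_realpow_zero) auto
    have p1: "(\<lambda>K. \<phi> (x + real K)) \<longlonglongrightarrow> 0"
      by (rule tendsto_sandwich[OF _ _ tendsto_const, where h="\<lambda>K. A * r ^ K"])
        (use x rk in \<open>auto simp: \<phi>_def[symmetric] intro!: bd(1) always_eventually\<close>, simp add: \<phi>_def)
    have p2: "(\<lambda>K. \<phi> (x - real K)) \<longlonglongrightarrow> 0"
      by (rule tendsto_sandwich[OF _ _ tendsto_const, where h="\<lambda>K. A * r ^ K"])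
        (use x rk in \<open>auto simp: \<phi>_def[symmetric] intro!: bd(1) always_eventually\<close>, simp add: \<phi>_def)
    have "(\<lambda>K. (\<Sum>k<K. g k x) + \<phi> (x + real K) - \<phi> (x - real K)) \<longlonglongrightarrow> F x + 0 - 0"
      using x by (intro tendsto_intros lim p1 p2) auto
    then have "(\<lambda>K. \<Sum>k<K. g k (x + 1)) \<longlonglongrightarrow> F x" by (simp add: eq)
    with lim[of "x + 1"] x show "F (x + 1) = F x" using LIMSEQ_unique by auto
  qed
qed

lemma integral_leb01:
  fixes g :: "real \<Rightarrow> complex"
  assumes "continuous_on {0..1} g"
  shows "integral\<^sup>L leb01 g = integral {0..1} g"
proof -
  interpret finite_measure leb01 by (rule finite_measure_leb01)
  obtain C where "\<And>x. x \<in> {0..1} \<Longrightarrow> norm (g x) \<le> C"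
    using compact_imp_bounded[OF compact_continuous_image[OF assms]] unfolding bounded_iff by blast
  then have "integrable leb01 g"
    by (intro integrable_const_bound[where B=C] continuous_imp_measurable_on_sets_lebesgue
        continuous_on_subset[OF assms]) auto
  then have "integral\<^sup>L leb01 g = integral {0<..<1} g"
    by (rule lebesgue_integral_eq_integral) auto
  then show ?thesis using integral_open_interval_real by metis
qed

text \<open>
  The periodized Gaussian is Lipschitz, so it is the sum of its Fourier series at every
  point \<open>s\<close>. Unfolding identifies the coefficient of index \<open>m\<close>, whose modulus is
  \<open>\<sigma> \<surd>(2\<pi>) q^(m\<^sup>2) \<le> \<sigma> \<surd>(2\<pi>) q^\<bar>m\<bar>\<close>. The coefficient of index 0 is the main term and a
  geometric series bounds all others.
\<close>
lemma gauss_sum_approx: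
  assumes \<sigma>: "\<sigma> > 0" and \<epsilon>: "\<epsilon> > 0"
  defines "q \<equiv> exp (- 2 * pi\<^sup>2 * \<sigma>\<^sup>2)"
  shows "\<forall>\<^sub>F K in sequentially. \<forall>s\<in>{0..1}.
    \<bar>gauss_sum \<sigma> K s - \<sigma> * sqrt (2 * pi)\<bar> \<le> \<sigma> * sqrt (2 * pi) * (2 * q / (1 - q)) + \<epsilon>"
proof -
  define c where "c = \<sigma> * sqrt (2 * pi)"
  have c: "c > 0" using \<sigma> by (simp add: c_def)
  have q: "0 < q" "q < 1" using \<sigma> by (auto simp: q_def)
  obtain F L where ul: "uniform_limit {-2..2} (gauss_sum \<sigma>) F sequentially"
    and lip: "\<And>x y. x \<in> {-2..2} \<Longrightarrow> y \<in> {-2..2} \<Longrightarrow> \<bar>F x - F y\<bar> \<le> L * \<bar>x - y\<bar>"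
    and per: "\<And>x. x \<in> {-2..1} \<Longrightarrow> F (x + 1) = F x"
    by (rule gauss_sum_limit[OF \<sigma>]) (rule that)
  have gc: "continuous_on S (gauss_sum \<sigma> K)" for S K
    unfolding gauss_sum_def by (intro continuous_intros) (use \<sigma> in auto)
  have Fc: "continuous_on {-2..2} F"
    by (rule uniform_limit_theorem[OF _ ul]) (auto intro!: always_eventually gc)
  have "\<bar>F s - c\<bar> \<le> c * (2 * q / (1 - q))" if s: "s \<in> {0..1}" for s
  proof -
    define G where "G x = complex_of_real (F (s + x))" for x
    define f where "f m = (LINT x|leb01. G x * cis (- (2 * pi * of_int m * x)))" for m :: int
    have Gc: "continuous_on {0..1} G"
      unfolding G_def using s
      by (intro continuous_intros continuous_on_compose2[OF Fc]) auto
    have "(\<lambda>N. \<Sum>m=-int N..int N. f m) \<longlonglongrightarrow> G 0"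
      unfolding f_def
    proof (rule fourier_series_at_0[OF Gc])
      fix x :: real assume x: "0 < x" "x < 1"
      have "norm (G x - G 0) = \<bar>F (s + x) - F s\<bar>"
        by (simp add: G_def flip: of_real_diff)
      moreover have "\<bar>F (s + x) - F s\<bar> \<le> L * x" using lip[of "s + x" s] s x by simp
      moreover have "\<bar>F (s + x) - F s\<bar> \<le> L * (1 - x)"
        using lip[of "s + x" "s + 1"] per[of s] s x by simp
      ultimately show "norm (G x - G 0) \<le> L * min x (1 - x)" by (simp add: min_def)
    qed
    moreover have f: "f m = of_real (c * exp (- 2 * pi\<^sup>2 * \<sigma>\<^sup>2 * (of_int m)\<^sup>2)) * cis (2 * pi * of_int m * s)" for m
    proof -
      define \<psi> where "\<psi> y = complex_of_real (exp (- (s + y)\<^sup>2 / (2 * \<sigma>\<^sup>2))) * cis (- (2 * pi * of_int m * y))" for y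
      have \<psi>c: "continuous_on S \<psi>" for S
        unfolding \<psi>_def by (intro continuous_intros) (use \<sigma> in auto)
      have \<psi>k: "\<psi> (x + of_int k) = complex_of_real (exp (- (s + x + of_int k)\<^sup>2 / (2 * \<sigma>\<^sup>2))) * cis (- (2 * pi * of_int m * x))" for x k
      proof -
        have "cis (- (2 * pi * of_int m * (x + of_int k))) = cis (- (2 * pi * of_int m * x)) * cis (2 * pi * of_int (- m * k))"
          unfolding cis_mult by (simp add: algebra_simps)
        moreover have "cis (2 * pi * of_int (- m * k)) = 1" by (rule cis_multiple_2pi) simp
        ultimately show ?thesis by (simp add: \<psi>_def add.assoc)
      qed
      have U: "uniform_limit {0..1} (\<lambda>K x. of_real (gauss_sum \<sigma> K (s + x)) * cis (- (2 * pi * of_int m * x)))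
          (\<lambda>x. G x * cis (- (2 * pi * of_int m * x))) sequentially"
        proof (rule uniform_limitI)
          fix e :: real assume "e > 0"
          from uniform_limitD[OF ul this]
          show "\<forall>\<^sub>F K in sequentially. \<forall>x\<in>{0..1}. dist (of_real (gauss_sum \<sigma> K (s + x)) * cis (- (2 * pi * of_int m * x)))
            (G x * cis (- (2 * pi * of_int m * x))) < e"
          proof eventually_elim
            case (elim K)
            show ?case
            proof
              fix x :: real assume "x \<in> {0..1}"
              then have "dist (gauss_sum \<sigma> K (s + x)) (F (s + x)) < e" using s elim by auto
              then show "dist (of_real (gauss_sum \<sigma> K (s + x)) * cis (- (2 * pi * of_int m * x)))
                (G x * cis (- (2 * pi * of_int m * x))) < e"
                by (simp add: dist_norm G_def norm_mult flip: left_diff_distrib of_real_diff)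
            qed
          qed
        qed
      have "continuous_on {0..1} (\<lambda>x. of_real (gauss_sum \<sigma> K (s + x)) * cis (- (2 * pi * of_int m * x)))" for K
        by (intro continuous_intros continuous_on_compose2[OF gc]) auto
      from uniform_limit_integral[OF U this sequentially_bot]
      have "(\<lambda>K. integral {0..1} (\<lambda>x. of_real (gauss_sum \<sigma> K (s + x)) * cis (- (2 * pi * of_int m * x))))
          \<longlonglongrightarrow> integral {0..1} (\<lambda>x. G x * cis (- (2 * pi * of_int m * x)))"
        by (metis (no_types, lifting) ext integral_unique)
      moreover have "integral {0..1} (\<lambda>x. of_real (gauss_sum \<sigma> K (s + x)) * cis (- (2 * pi * of_int m * x)))
          = integral {-real K..real K} \<psi>" for K
      proof -
        have "integral {0..1} (\<lambda>x. of_real (gauss_sum \<sigma> K (s + x)) * cis (- (2 * pi * of_int m * x)))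
          = integral {0..1} (\<lambda>x. \<Sum>k\<in>{-int K..<int K}. \<psi> (x + of_int k))"
          by (simp add: gauss_sum_def \<psi>k sum_distrib_right)
        also have "\<dots> = (\<Sum>k\<in>{-int K..<int K}. integral {0..1} (\<lambda>x. \<psi> (x + of_int k)))"
          by (intro Henstock_Kurzweil_Integration.integral_sum integrable_continuous_interval
              continuous_on_compose2[OF \<psi>c] continuous_intros) auto
        also have "\<dots> = integral {-real K..real K} \<psi>" by (rule integral_unit_cells[OF \<psi>c])
        finally show ?thesis .
      qed
      ultimately have "(\<lambda>K. integral {-real K..real K} \<psi>) \<longlonglongrightarrow> integral {0..1} (\<lambda>x. G x * cis (- (2 * pi * of_int m * x)))"
        by simp
      moreover have "(\<lambda>K. integral {-real K..real K} \<psi>) \<longlonglongrightarrow> integral\<^sup>L lborel \<psi>"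
        using gauss_fourier(1)[OF \<sigma>] unfolding \<psi>_def by (rule integral_symmetric_LIMSEQ)
      ultimately have "integral {0..1} (\<lambda>x. G x * cis (- (2 * pi * of_int m * x))) = integral\<^sup>L lborel \<psi>"
        by (rule LIMSEQ_unique)
      moreover have "f m = integral {0..1} (\<lambda>x. G x * cis (- (2 * pi * of_int m * x)))"
        unfolding f_def by (intro integral_leb01 continuous_intros Gc)
      ultimately show ?thesis
        using gauss_fourier(2)[OF \<sigma>, of s m, folded \<psi>_def c_def] by (simp only:)
    qed
    have nf: "norm (f m) \<le> c * q ^ nat \<bar>m\<bar>" for m
    proof -
      have "real_of_int (\<bar>m\<bar>) \<le> (of_int m)\<^sup>2"
      proof (cases "m = 0")
        case False
        then have "1 * \<bar>m\<bar> \<le> \<bar>m\<bar> * \<bar>m\<bar>" by (intro mult_right_mono) auto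
        then have "\<bar>m\<bar> \<le> m\<^sup>2" by (simp add: power2_eq_square)
        then have "real_of_int \<bar>m\<bar> \<le> real_of_int (m\<^sup>2)" by (rule of_int_le_iff[THEN iffD2])
        then show ?thesis by simp
      qed simp
      then have "exp (- 2 * pi\<^sup>2 * \<sigma>\<^sup>2 * (of_int m)\<^sup>2) \<le> exp (- 2 * pi\<^sup>2 * \<sigma>\<^sup>2 * of_int \<bar>m\<bar>)"
        by (simp add: mult_left_mono)
      also have "\<dots> = q ^ nat \<bar>m\<bar>" by (simp add: q_def flip: exp_of_nat2_mult)
      finally show ?thesis using c unfolding f by (simp add: norm_mult)
    qed
    have f0: "f 0 = of_real c" unfolding f by simp
    have part: "norm ((\<Sum>m=-int N..int N. f m) - of_real c) \<le> c * (2 * q / (1 - q))" for N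
    proof -
      have "norm ((\<Sum>m=-int N..int N. f m) - of_real c) \<le> 2 * c * q * (\<Sum>m<N. q ^ m)"
      proof (induction N)
        case (Suc N)
        have "{-int (Suc N)..int (Suc N)} = insert (int N + 1) (insert (- int N - 1) {-int N..int N})"
          by auto
        then have "(\<Sum>m=-int (Suc N)..int (Suc N). f m) - of_real c
          = f (int N + 1) + (f (- int N - 1) + ((\<Sum>m=-int N..int N. f m) - of_real c))" by simp
        also have "norm \<dots> \<le> norm (f (int N + 1)) + (norm (f (- int N - 1)) + norm ((\<Sum>m=-int N..int N. f m) - of_real c))"
          by (intro order_trans[OF norm_triangle_ineq] add_left_mono norm_triangle_ineq)
        also have "\<dots> \<le> c * q ^ Suc N + (c * q ^ Suc N + 2 * c * q * (\<Sum>m<N. q ^ m))"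
        proof -
          have "nat \<bar>int N + 1\<bar> = Suc N" "nat \<bar>- int N - 1\<bar> = Suc N" by auto
          then show ?thesis using nf[of "int N + 1"] nf[of "- int N - 1"] Suc by (intro add_mono) auto
        qed
        also have "\<dots> = 2 * c * q * (\<Sum>m<Suc N. q ^ m)" by (simp add: algebra_simps)
        finally show ?case .
      qed (simp add: f0)
      also have "\<dots> \<le> 2 * c * q * (1 / (1 - q))"
      proof -
        have "(\<Sum>m<N. q ^ m) \<le> (\<Sum>m. q ^ m)"
          using q by (intro sum_le_suminf summable_geometric) auto
        also have "\<dots> = 1 / (1 - q)" using q by (simp add: suminf_geometric)
        finally show ?thesis using c q by (intro mult_left_mono) auto
      qed
      finally show ?thesis by (simp add: mult_ac)
    qed
    have "norm (G 0 - of_real c) \<le> c * (2 * q / (1 - q))"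
    proof (rule LIMSEQ_le_const2)
      show "(\<lambda>N. norm ((\<Sum>m=-int N..int N. f m) - of_real c)) \<longlonglongrightarrow> norm (G 0 - of_real c)"
        using \<open>(\<lambda>N. \<Sum>m=-int N..int N. f m) \<longlonglongrightarrow> G 0\<close> by (intro tendsto_intros)
    qed (use part in blast)
    then show ?thesis by (simp add: G_def flip: of_real_diff)
  qed
  note * = this
  from uniform_limitD[OF ul \<epsilon>] show ?thesis
  proof eventually_elim
    case (elim K)
    show ?case
    proof
      fix s :: real assume s: "s \<in> {0..1}"
      then have "\<bar>gauss_sum \<sigma> K s - F s\<bar> < \<epsilon>" using elim by (auto simp: dist_real_def)
      with *[OF s] show "\<bar>gauss_sum \<sigma> K s - \<sigma> * sqrt (2 * pi)\<bar> \<le> \<sigma> * sqrt (2 * pi) * (2 * q / (1 - q)) + \<epsilon>"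
        by (simp add: c_def)
    qed
  qed
qed

section \<open>Hausdorff measure is a Borel measure\<close>

definition cover_weight :: "nat \<Rightarrow> 'a::metric_space set \<Rightarrow> ennreal" where
  "cover_weight s C = (if C = {} then 0 else ennreal (unit_ball_vol (real s) * (diameter C / 2) ^ s))"

definition fine_cover :: "real \<Rightarrow> 'a::metric_space set \<Rightarrow> (nat \<Rightarrow> 'a set) \<Rightarrow> bool" where
  "fine_cover \<delta> A C \<longleftrightarrow> A \<subseteq> (\<Union>i. C i) \<and> (\<forall>i. bounded (C i) \<and> diameter (C i) \<le> \<delta>)"

definition hausdorff_pre :: "nat \<Rightarrow> real \<Rightarrow> 'a::metric_space set \<Rightarrow> ennreal" where
  "hausdorff_pre s \<delta> A = (INF C\<in>{C. fine_cover \<delta> A C}. \<Sum>i. cover_weight s (C i))"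

lemma hausdorff_outer_eq: "hausdorff_outer s A = (SUP \<delta>\<in>{0<..}. hausdorff_pre s \<delta> A)"
  unfolding hausdorff_outer_def hausdorff_pre_def cover_weight_def fine_cover_def ..

lemma hausdorff_pre_le_outer: "\<delta> > 0 \<Longrightarrow> hausdorff_pre s \<delta> A \<le> hausdorff_outer s A"
  unfolding hausdorff_outer_eq by (rule SUP_upper) simp

lemma hausdorff_outer_le: "(\<And>\<delta>. \<delta> > 0 \<Longrightarrow> hausdorff_pre s \<delta> A \<le> b) \<Longrightarrow> hausdorff_outer s A \<le> b"
  unfolding hausdorff_outer_eq by (rule SUP_least) simp

lemma hausdorff_pre_le: "fine_cover \<delta> A C \<Longrightarrow> hausdorff_pre s \<delta> A \<le> (\<Sum>i. cover_weight s (C i))"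
  unfolding hausdorff_pre_def by (rule INF_lower) simp

lemma hausdorff_pre_less:
  "hausdorff_pre s \<delta> A < e \<Longrightarrow> \<exists>C. fine_cover \<delta> A C \<and> (\<Sum>i. cover_weight s (C i)) < e"
  unfolding hausdorff_pre_def INF_less_iff by auto

lemma diameter_le_dist:
  assumes "0 \<le> d" "\<And>x y. x \<in> S \<Longrightarrow> y \<in> S \<Longrightarrow> dist x y \<le> d"
  shows "diameter S \<le> d"
  using assms by (auto simp: diameter_def intro: cSUP_least)

lemma nonexpansive_diameter:
  assumes C: "bounded C" and f: "\<And>x y. x \<in> C \<Longrightarrow> y \<in> C \<Longrightarrow> dist (f x) (f y) \<le> dist x y"
  shows "bounded (f ` C)" "diameter (f ` C) \<le> diameter C"
proof -
  have *: "dist (f x) (f y) \<le> diameter C" if "x \<in> C" "y \<in> C" for x y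
    using f[OF that] diameter_bounded_bound[OF C that] by linarith
  show "bounded (f ` C)" unfolding bounded_two_points using * by auto
  show "diameter (f ` C) \<le> diameter C"
    using * diameter_ge_0[OF C] by (intro diameter_le_dist) auto
qed

lemma cover_weight_mono:
  assumes "bounded D" "diameter C \<le> diameter D" "D = {} \<Longrightarrow> C = {}" "bounded C"
  shows "cover_weight s C \<le> cover_weight s D"
  using assms diameter_ge_0[of C] unfolding cover_weight_def
  by (auto intro!: ennreal_leI mult_left_mono power_mono divide_right_mono)

lemma hausdorff_pre_nonexpansive:
  assumes f: "\<And>x y. x \<in> A \<Longrightarrow> y \<in> A \<Longrightarrow> dist (f x) (f y) \<le> dist x y" and B: "B \<subseteq> f ` A"
  shows "hausdorff_pre s \<delta> B \<le> hausdorff_pre s \<delta> A"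
  unfolding hausdorff_pre_def[of s \<delta> A]
proof (rule INF_greatest, clarify)
  fix C assume C: "fine_cover \<delta> A C"
  have b: "bounded (C i \<inter> A)" for i using C by (auto simp: fine_cover_def)
  have d: "diameter (C i \<inter> A) \<le> diameter (C i)" for i
    using C by (intro diameter_subset) (auto simp: fine_cover_def)
  note ne = nonexpansive_diameter[where f=f, OF b]
  have ne1: "bounded (f ` (C i \<inter> A))" for i by (rule ne) (auto intro: f)
  have ne2: "diameter (f ` (C i \<inter> A)) \<le> diameter (C i)" for i
    using d[of i] by (rule order_trans[rotated]) (rule ne, auto intro: f)
  have "fine_cover \<delta> B (\<lambda>i. f ` (C i \<inter> A))"
    unfolding fine_cover_def
  proof (intro conjI allI)
    show "B \<subseteq> (\<Union>i. f ` (C i \<inter> A))" using B C by (fastforce simp: fine_cover_def)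
    show "diameter (f ` (C i \<inter> A)) \<le> \<delta>" for i using ne2[of i] C by (auto simp: fine_cover_def intro: order_trans)
  qed (rule ne1)
  then have "hausdorff_pre s \<delta> B \<le> (\<Sum>i. cover_weight s (f ` (C i \<inter> A)))" by (rule hausdorff_pre_le)
  also have "\<dots> \<le> (\<Sum>i. cover_weight s (C i))"
    using C by (intro suminf_le cover_weight_mono ne1 ne2) (auto simp: fine_cover_def)
  finally show "hausdorff_pre s \<delta> B \<le> (\<Sum>i. cover_weight s (C i))" .
qed

text \<open>
  Every fine cover of \<open>A\<close> is mapped to a fine cover of \<open>B\<close> whose members have no larger
  diameters.
\<close>
lemma hausdorff_outer_nonexpansive:
  assumes "\<And>x y. x \<in> A \<Longrightarrow> y \<in> A \<Longrightarrow> dist (f x) (f y) \<le> dist x y" "B \<subseteq> f ` A"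
  shows "hausdorff_outer s B \<le> hausdorff_outer s A"
  unfolding hausdorff_outer_eq using hausdorff_pre_nonexpansive[OF assms] by (intro SUP_mono) auto

lemma hausdorff_outer_mono: "B \<subseteq> A \<Longrightarrow> hausdorff_outer s B \<le> hausdorff_outer s A"
  using hausdorff_outer_nonexpansive[of A "\<lambda>x. x" B] by simp

lemma hausdorff_outer_empty: "hausdorff_outer s ({} :: 'a::metric_space set) = 0"
proof -
  have "hausdorff_pre s \<delta> ({} :: 'a set) \<le> 0" if "\<delta> > 0" for \<delta>
    using hausdorff_pre_le[of \<delta> "{} :: 'a set" "\<lambda>_. {}" s] that by (simp add: fine_cover_def cover_weight_def)
  then have "hausdorff_outer s ({} :: 'a set) \<le> 0" by (rule hausdorff_outer_le)
  then show ?thesis by simp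
qed

lemma hausdorff_outer_countably_subadditive:
  fixes A :: "nat \<Rightarrow> 'a::metric_space set"
  shows "hausdorff_outer s (\<Union>i. A i) \<le> (\<Sum>i. hausdorff_outer s (A i))"
proof (rule hausdorff_outer_le)
  fix \<delta> :: real assume \<delta>: "\<delta> > 0"
  let ?O = "hausdorff_pre s \<delta> :: 'a set \<Rightarrow> ennreal"
  have "?O (\<Union>i. A i) \<le> (\<Sum>i. ?O (A i))"
  proof (rule ennreal_le_epsilon)
    fix e :: real assume e: "0 < e" and "(\<Sum>n. ?O (A n)) < top"
    then have "?O (A n) < ?O (A n) + e * (1/2)^Suc n" for n
      by (auto simp add: less_top dest!: ennreal_suminf_lessD)
    then have "\<exists>B. fine_cover \<delta> (A n) B \<and> (\<Sum>i. cover_weight s (B i)) \<le> ?O (A n) + e * (1/2)^Suc n" for n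
      using hausdorff_pre_less[of s \<delta> "A n"] less_imp_le by blast
    then obtain B where B: "\<And>n. fine_cover \<delta> (A n) (B n)"
      and Ble: "\<And>n. (\<Sum>i. cover_weight s (B n i)) \<le> ?O (A n) + e * (1/2)^Suc n" by metis
    define C where "C = case_prod B o prod_decode"
    have "fine_cover \<delta> (\<Union>i. A i) C"
      unfolding fine_cover_def
    proof (intro conjI)
      show "(\<Union>i. A i) \<subseteq> (\<Union>i. C i)"
        using B by (auto simp add: C_def fine_cover_def subset_eq) (metis prod.case prod_encode_inverse)
      show "\<forall>i. bounded (C i) \<and> diameter (C i) \<le> \<delta>"
        using B by (auto simp: C_def fine_cover_def split: prod.split)
    qed
    then have "?O (\<Union>i. A i) \<le> (\<Sum>i. cover_weight s (C i))" by (rule hausdorff_pre_le)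
    also have "\<dots> = (\<Sum>n. \<Sum>i. cover_weight s (B n i))"
      using suminf_ennreal_2dimen[where f="\<lambda>(m,n). cover_weight s (B m n)"]
      by (auto simp: C_def comp_def split_beta')
    also have "\<dots> \<le> (\<Sum>n. ?O (A n) + e * (1/2) ^ Suc n)"
      by (intro suminf_le allI Ble) auto
    also have "\<dots> = (\<Sum>n. ?O (A n)) + (\<Sum>n. ennreal e * ennreal ((1/2) ^ Suc n))"
      using e by (subst suminf_add[symmetric])
        (auto simp del: ennreal_suminf_cmult simp add: ennreal_mult[symmetric])
    also have "\<dots> = (\<Sum>n. ?O (A n)) + e"
      unfolding ennreal_suminf_cmult
      by (subst suminf_ennreal_eq[OF zero_le_power power_half_series]) auto
    finally show "?O (\<Union>i. A i) \<le> (\<Sum>n. ?O (A n)) + e" .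
  qed
  also have "\<dots> \<le> (\<Sum>i. hausdorff_outer s (A i))"
    by (intro suminf_le hausdorff_pre_le_outer \<delta>) auto
  finally show "?O (\<Union>i. A i) \<le> (\<Sum>i. hausdorff_outer s (A i))" .
qed

lemma hausdorff_outer_Un: "hausdorff_outer s (A \<union> B) \<le> hausdorff_outer s A + hausdorff_outer s B"
proof -
  have "hausdorff_outer s (A \<union> B) \<le> (\<Sum>i. hausdorff_outer s (binaryset A B i))"
    using hausdorff_outer_countably_subadditive[of s "binaryset A B"] by (simp add: UN_binaryset_eq)
  also have "\<dots> = hausdorff_outer s A + hausdorff_outer s B"
    by (rule suminf_binaryset_eq) (simp add: hausdorff_outer_empty)
  finally show ?thesis .
qed

text \<open>
  A set of diameter less than \<open>d\<close> cannot meet both \<open>A\<close> and \<open>B\<close>, so a fine cover of the union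
  splits into a cover of \<open>A\<close> and a cover of \<open>B\<close>.
\<close>
lemma hausdorff_outer_separated:
  assumes d: "d > 0" and sep: "\<And>a b. a \<in> A \<Longrightarrow> b \<in> B \<Longrightarrow> d \<le> dist a b"
  shows "hausdorff_outer s A + hausdorff_outer s B \<le> hausdorff_outer s (A \<union> B)"
proof -
  have pre: "hausdorff_pre s \<delta>1 A + hausdorff_pre s \<delta>2 B \<le> hausdorff_outer s (A \<union> B)"
    if "\<delta>1 > 0" "\<delta>2 > 0" for \<delta>1 \<delta>2
  proof -
    define \<delta> where "\<delta> = min (min \<delta>1 \<delta>2) (d / 2)"
    have \<delta>: "\<delta> > 0" "\<delta> \<le> \<delta>1" "\<delta> \<le> \<delta>2" "\<delta> < d" using that d by (auto simp: \<delta>_def)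
    have "hausdorff_pre s \<delta>1 A + hausdorff_pre s \<delta>2 B \<le> hausdorff_pre s \<delta> (A \<union> B)"
      unfolding hausdorff_pre_def[of s \<delta>]
    proof (rule INF_greatest, clarify)
      fix C assume C: "fine_cover \<delta> (A \<union> B) C"
      have bC: "bounded (C i)" "diameter (C i) \<le> \<delta>" for i using C by (auto simp: fine_cover_def)
      have sub: "bounded (C i \<inter> X)" "diameter (C i \<inter> X) \<le> diameter (C i)" for i X
        using bC by (auto intro: diameter_subset)
      have "fine_cover \<delta>1 A (\<lambda>i. C i \<inter> A)" "fine_cover \<delta>2 B (\<lambda>i. C i \<inter> B)"
      proof -
        have "diameter (C i \<inter> X) \<le> \<delta>" for i X using sub(2)[of i X] bC(2)[of i] by linarith
        then have "diameter (C i \<inter> X) \<le> \<delta>1" "diameter (C i \<inter> X) \<le> \<delta>2" for i X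
          using \<delta> order_trans by blast+
        then show "fine_cover \<delta>1 A (\<lambda>i. C i \<inter> A)" "fine_cover \<delta>2 B (\<lambda>i. C i \<inter> B)"
          using C sub(1) by (auto simp: fine_cover_def)
      qed
      then have "hausdorff_pre s \<delta>1 A + hausdorff_pre s \<delta>2 B
          \<le> (\<Sum>i. cover_weight s (C i \<inter> A)) + (\<Sum>i. cover_weight s (C i \<inter> B))"
        by (intro add_mono hausdorff_pre_le)
      also have "\<dots> = (\<Sum>i. cover_weight s (C i \<inter> A) + cover_weight s (C i \<inter> B))"
        by (rule suminf_add) auto
      also have "\<dots> \<le> (\<Sum>i. cover_weight s (C i))"
      proof (rule suminf_le)
        fix i
        have "C i \<inter> A = {} \<or> C i \<inter> B = {}"
        proof (rule ccontr)
          assume "\<not> ?thesis"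
          then obtain a b where ab: "a \<in> C i" "a \<in> A" "b \<in> C i" "b \<in> B" by auto
          then have "d \<le> dist a b" using sep by auto
          moreover have "dist a b \<le> \<delta>" using diameter_bounded_bound[OF bC(1) ab(1,3)] bC(2)[of i] by linarith
          ultimately show False using \<delta> by linarith
        qed
        moreover have "cover_weight s (C i \<inter> X) \<le> cover_weight s (C i)" for X
          using sub bC by (intro cover_weight_mono) auto
        ultimately show "cover_weight s (C i \<inter> A) + cover_weight s (C i \<inter> B) \<le> cover_weight s (C i)"
          by (auto simp: cover_weight_def[of s "{}"])
      qed auto
      finally show "hausdorff_pre s \<delta>1 A + hausdorff_pre s \<delta>2 B \<le> (\<Sum>i. cover_weight s (C i))" .
    qed
    also have "\<dots> \<le> hausdorff_outer s (A \<union> B)" by (rule hausdorff_pre_le_outer[OF \<delta>(1)])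
    finally show ?thesis .
  qed
  have "hausdorff_pre s \<delta>1 A + hausdorff_outer s B \<le> hausdorff_outer s (A \<union> B)" if "\<delta>1 > 0" for \<delta>1
    unfolding hausdorff_outer_eq[of s B] using pre[OF that]
    by (subst ennreal_SUP_add_right) (auto intro!: SUP_least)
  then show ?thesis
    unfolding hausdorff_outer_eq[of s A]
    by (subst ennreal_SUP_add_left[symmetric]) (auto intro!: SUP_least)
qed

text \<open>
  Caratheodory's criterion for metric outer measures. The part \<open>Y k\<close> of \<open>X\<close> at distance at
  least \<open>1 / (k + 1)\<close> from \<open>F\<close> is separated from \<open>X \<inter> F\<close>, so only the shells \<open>R j\<close> with
  \<open>j \<ge> k\<close> are not accounted for. Shells whose indices differ by at least two are separated
  from each other, so each of the two sums over shells of one parity is at most the measure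
  of \<open>X\<close>; hence the remainder tends to zero.
\<close>
lemma hausdorff_outer_closed_split:
  fixes F :: "'a::metric_space set"
  assumes F: "closed F"
  shows "hausdorff_outer s (X \<inter> F) + hausdorff_outer s (X - F) \<le> hausdorff_outer s X"
proof (cases "F = {} \<or> hausdorff_outer s X = top")
  case True then show ?thesis by (auto simp: hausdorff_outer_empty)
next
  case False
  let ?H = "hausdorff_outer s :: 'a set \<Rightarrow> ennreal"
  have fin: "?H X < top" using False by (auto simp: less_top)
  define Y where "Y k = {x\<in>X. infdist x F \<ge> 1 / real (Suc k)}" for k
  define R where "R k = {x\<in>X. 1 / real (Suc (Suc k)) \<le> infdist x F \<and> infdist x F < 1 / real (Suc k)}" for k
  have sepR: "1 / real (Suc (Suc k)) - 1 / real (Suc l) \<le> dist x y" if "x \<in> R k" "y \<in> R l" for x y k l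
    using that infdist_triangle[of x F y] by (auto simp: R_def)
  have ev: "(\<Sum>i<N. ?H (R (2 * i + j))) \<le> ?H (\<Union>i<N. R (2 * i + j))" for N j
  proof (induction N)
    case (Suc N)
    have "(\<Sum>i<N. ?H (R (2 * i + j))) + ?H (R (2 * N + j)) \<le> ?H (\<Union>i<N. R (2 * i + j)) + ?H (R (2 * N + j))"
      using Suc by (rule add_right_mono)
    also have "\<dots> \<le> ?H ((\<Union>i<N. R (2 * i + j)) \<union> R (2 * N + j))"
    proof (rule hausdorff_outer_separated)
      \<comment> \<open>For N = 0 the union is empty and any positive distance will do; the formula for ?d
        could then divide by zero.\<close>
      let ?d = "1 / real (2 * N + j) - 1 / real (Suc (2 * N + j))"
      show "(if N = 0 then 1 else ?d) > 0" by (auto simp: frac_less2)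
      fix a b assume "a \<in> (\<Union>i<N. R (2 * i + j))" and b: "b \<in> R (2 * N + j)"
      then obtain i where i: "i < N" "a \<in> R (2 * i + j)" by auto
      have "1 / real (2 * N + j) \<le> 1 / real (Suc (Suc (2 * i + j)))"
        using i(1) by (intro divide_left_mono) auto
      with sepR[OF i(2) b] i(1) show "(if N = 0 then 1 else ?d) \<le> dist a b" by auto
    qed
    finally show ?case by (simp add: lessThan_Suc Un_commute add.commute)
  qed (simp add: hausdorff_outer_empty)
  have evX: "(\<Sum>i. ?H (R (2 * i + j))) \<le> ?H X" for j
  proof (rule suminf_le_const)
    fix N
    show "(\<Sum>i<N. ?H (R (2 * i + j))) \<le> ?H X"
      by (rule order_trans[OF ev hausdorff_outer_mono]) (auto simp: R_def)
  qed simp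
  have "(\<Sum>k. ?H (R k)) \<le> (\<Sum>i. ?H (R (2 * i + 0))) + (\<Sum>i. ?H (R (2 * i + 1)))"
  proof (rule suminf_le_const)
    fix N
    have "(\<Sum>k<N. ?H (R k)) \<le> (\<Sum>k<2*N. ?H (R k))" by (intro sum_mono2) auto
    also have "\<dots> = (\<Sum>i<N. ?H (R (2 * i + 0))) + (\<Sum>i<N. ?H (R (2 * i + 1)))"
      by (induction N) (auto simp: algebra_simps)
    also have "\<dots> \<le> (\<Sum>i. ?H (R (2 * i + 0))) + (\<Sum>i. ?H (R (2 * i + 1)))"
      by (intro add_mono sum_le_suminf) auto
    finally show "(\<Sum>k<N. ?H (R k)) \<le> (\<Sum>i. ?H (R (2 * i + 0))) + (\<Sum>i. ?H (R (2 * i + 1)))" .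
  qed simp
  also have "\<dots> \<le> ?H X + ?H X" by (intro add_mono evX)
  also have "\<dots> < top" using fin by simp
  finally have sumR: "(\<Sum>k. ?H (R k)) < top" .
  have cover: "X - F \<subseteq> Y k \<union> (\<Union>i. R (i + k))" for k
  proof
    fix x assume x: "x \<in> X - F"
    have pos: "infdist x F > 0" using x F False infdist_pos_not_in_closed by auto
    show "x \<in> Y k \<union> (\<Union>i. R (i + k))"
    proof (cases "x \<in> Y k")
      case False
      then have lt: "infdist x F < 1 / real (Suc k)" using x by (auto simp: Y_def)
      obtain m where "1 / real (Suc m) < infdist x F"
        using nat_approx_posE[OF pos] by auto
      then have ex: "\<exists>m. 1 / real (Suc m) \<le> infdist x F" by (auto intro: less_imp_le)
      define m0 where "m0 = (LEAST m. 1 / real (Suc m) \<le> infdist x F)"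
      have m0: "1 / real (Suc m0) \<le> infdist x F" unfolding m0_def by (rule LeastI_ex[OF ex])
      have mk: "m0 > k"
      proof (rule ccontr)
        assume "\<not> m0 > k"
        then have "1 / real (Suc k) \<le> 1 / real (Suc m0)" by (intro divide_left_mono) auto
        with m0 lt show False by linarith
      qed
      define j where "j = m0 - 1"
      have j: "m0 = Suc j" "j \<ge> k" using mk by (auto simp: j_def)
      have "\<not> 1 / real (Suc j) \<le> infdist x F"
        using not_less_Least[of j "\<lambda>m. 1 / real (Suc m) \<le> infdist x F"] j(1) by (simp add: m0_def)
      then have "x \<in> R j" using m0 x j by (auto simp: R_def)
      then have "x \<in> R ((j - k) + k)" using j by simp
      then show ?thesis by blast
    qed simp
  qed
  have bound: "?H (X \<inter> F) + ?H (X - F) \<le> ?H X + (\<Sum>i. ?H (R (i + k)))" for k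
  proof -
    have "?H (X - F) \<le> ?H (Y k) + (\<Sum>i. ?H (R (i + k)))"
      by (rule order_trans[OF hausdorff_outer_mono[OF cover]], rule order_trans[OF hausdorff_outer_Un],
          rule add_left_mono, rule hausdorff_outer_countably_subadditive)
    then have "?H (X \<inter> F) + ?H (X - F) \<le> (?H (X \<inter> F) + ?H (Y k)) + (\<Sum>i. ?H (R (i + k)))"
      by (simp add: add.assoc add_left_mono)
    also have "?H (X \<inter> F) + ?H (Y k) \<le> ?H ((X \<inter> F) \<union> Y k)"
    proof (rule hausdorff_outer_separated[of "1 / real (Suc k)"])
      fix a b assume ab: "a \<in> X \<inter> F" "b \<in> Y k"
      then have "infdist b F \<le> dist b a" by (intro infdist_le) auto
      then show "1 / real (Suc k) \<le> dist a b" using ab by (auto simp: Y_def dist_commute)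
    qed simp
    also have "\<dots> \<le> ?H X" by (rule hausdorff_outer_mono) (auto simp: Y_def)
    finally show ?thesis by (simp add: add_right_mono)
  qed
  have "(\<lambda>k. \<Sum>i. ?H (R (i + k))) \<longlonglongrightarrow> 0"
  proof -
    have fR: "?H (R i) < top" for i
      using ennreal_suminf_lessD[OF sumR] .
    have sR: "summable (\<lambda>i. enn2real (?H (R i)))"
      by (rule summable_suminf_not_top) (use sumR fR in \<open>auto simp: less_top\<close>)
    then have "(\<lambda>k. \<Sum>i. enn2real (?H (R (i + k)))) \<longlonglongrightarrow> 0"
      by (rule suminf_exist_split2)
    have eq: "(\<Sum>i. ?H (R (i + k))) = ennreal (\<Sum>i. enn2real (?H (R (i + k))))" for k
    proof -
      have "summable (\<lambda>i. enn2real (?H (R (i + k))))" using sR summable_iff_shift[of "\<lambda>i. enn2real (?H (R i))" k] by simp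
      then have "(\<Sum>i. ennreal (enn2real (?H (R (i + k))))) = ennreal (\<Sum>i. enn2real (?H (R (i + k))))"
        by (intro suminf_ennreal2) auto
      then show ?thesis using fR by simp
    qed
    show ?thesis unfolding eq
      using tendsto_ennrealI[OF \<open>(\<lambda>k. \<Sum>i. enn2real (?H (R (i + k)))) \<longlonglongrightarrow> 0\<close>] by simp
  qed
  then have "(\<lambda>k. ?H X + (\<Sum>i. ?H (R (i + k)))) \<longlonglongrightarrow> ?H X + 0"
    by (intro tendsto_intros)
  then show ?thesis using bound by (intro LIMSEQ_le_const[where a="?H (X \<inter> F) + ?H (X - F)" and x="?H X"]) auto
qed

lemma measure_space_hausdorff:
  "measure_space UNIV (sets borel) (hausdorff_outer s :: 'a::metric_space set \<Rightarrow> ennreal)"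
proof -
  let ?H = "hausdorff_outer s :: 'a set \<Rightarrow> ennreal"
  interpret sigma_algebra UNIV "UNIV :: 'a set set" by (metis Pow_UNIV sigma_algebra_Pow)
  have "outer_measure_space UNIV ?H"
    unfolding outer_measure_space_def positive_def increasing_def countably_subadditive_def
    by (intro conjI ballI allI impI hausdorff_outer_countably_subadditive hausdorff_outer_mono hausdorff_outer_empty)
  from caratheodory_lemma[OF this]
  have L: "measure_space UNIV (lambda_system UNIV UNIV ?H) ?H" .
  then interpret L: sigma_algebra UNIV "lambda_system UNIV UNIV ?H" by (simp add: measure_space_def)
  have "F \<in> lambda_system UNIV UNIV ?H" if "closed F" for F
    unfolding lambda_system_eq
  proof (clarify, intro conjI ballI antisym)
    fix x
    show "?H (x \<inter> F) + ?H (x - F) \<le> ?H x" by (rule hausdorff_outer_closed_split[OF that])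
    show "?H x \<le> ?H (x \<inter> F) + ?H (x - F)" using hausdorff_outer_Un[of s "x \<inter> F" "x - F"] by (simp add: Int_Diff_Un)
  qed simp
  then have "sigma_sets UNIV (Collect closed) \<subseteq> lambda_system UNIV UNIV ?H"
    by (intro L.sigma_sets_subset) auto
  then have "sets borel \<subseteq> lambda_system UNIV UNIV ?H"
    by (simp add: borel_eq_closed)
  then show ?thesis
    using L sets.sigma_algebra_axioms[of "borel :: 'a measure"]
    unfolding measure_space_def positive_def countably_additive_def by (simp add: subset_iff)
qed

lemma space_surface_measure [simp]: "space surface_measure = UNIV"
  and sets_surface_measure [simp, measurable_cong]: "sets surface_measure = sets borel"
  by (simp_all add: surface_measure_def hausdorff_measure_def space_measure_of_conv sets_measure_of_conv
      sigma_algebra.sigma_sets_eq[OF sets.sigma_algebra_axioms, of borel, simplified])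

section \<open>Surface measure on hyperplanes and slicing\<close>

lemma emeasure_surface_measure:
  fixes A :: "(real^'n) set"
  assumes "A \<in> sets borel"
  shows "emeasure surface_measure A = hausdorff_outer (CARD('n) - 1) A"
  unfolding surface_measure_def hausdorff_measure_def
  using measure_space_hausdorff sets.sigma_algebra_axioms[of "borel :: (real^'n) measure"] assms
  by (intro emeasure_measure_of_sigma) (auto simp: measure_space_def)

lemma surface_measure_nonexpansive:
  fixes A B :: "(real^'n) set"
  assumes "A \<in> sets borel" "B \<in> sets borel" "B \<subseteq> f ` A"
    and "\<And>x y. x \<in> A \<Longrightarrow> y \<in> A \<Longrightarrow> dist (f x) (f y) \<le> dist x y"
  shows "emeasure surface_measure B \<le> emeasure surface_measure A"
  unfolding emeasure_surface_measure[OF assms(1)] emeasure_surface_measure[OF assms(2)]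
  using assms(3,4) by (intro hausdorff_outer_nonexpansive) auto

lemma isometry_measurable:
  fixes f :: "'a::metric_space \<Rightarrow> 'b::metric_space"
  assumes "\<And>x y. dist (f x) (f y) = dist x y"
  shows "f \<in> borel_measurable borel"
proof (rule borel_measurable_continuous_onI)
  show "continuous_on UNIV f" using assms by (auto simp: continuous_on_iff)
qed

lemma distr_surface_measure_isometry:
  fixes f :: "real^'n \<Rightarrow> real^'n"
  assumes iso: "\<And>x y. dist (f x) (f y) = dist x y" and surj: "surj f"
  shows "distr surface_measure borel f = surface_measure"
proof (rule measure_eqI)
  have [measurable]: "f \<in> borel_measurable borel" by (rule isometry_measurable[OF iso])
  fix A assume "A \<in> sets (distr surface_measure borel f)"
  then have A [measurable]: "A \<in> sets borel" by simp
  have inj: "inj f" using iso by (metis dist_eq_0_iff injI)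
  have fA: "f -` A \<in> sets borel" using measurable_sets[of f borel borel A] by simp
  have g: "f (inv f x) = x" for x by (rule surj_f_inv_f[OF surj])
  have "emeasure (distr surface_measure borel f) A = emeasure surface_measure (f -` A)"
    by (subst emeasure_distr) auto
  also have "\<dots> = emeasure surface_measure A"
  proof (rule antisym)
    show "emeasure surface_measure (f -` A) \<le> emeasure surface_measure A"
    proof (rule surface_measure_nonexpansive[OF A fA, of "inv f"])
      show "dist (inv f x) (inv f y) \<le> dist x y" for x y using iso[of "inv f x" "inv f y"] by (simp add: g)
      show "f -` A \<subseteq> inv f ` A" using inj by (auto intro!: image_eqI[where x="f _"])
    qed
    show "emeasure surface_measure A \<le> emeasure surface_measure (f -` A)"
      by (intro surface_measure_nonexpansive[OF fA A, of f]) (simp_all add: surj iso surj_image_vimage_eq)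
  qed
  finally show "emeasure (distr surface_measure borel f) A = emeasure surface_measure A" .
qed simp

lemma nn_integral_surface_isometry:
  fixes f :: "real^'n \<Rightarrow> real^'n"
  assumes "\<And>x y. dist (f x) (f y) = dist x y" "surj f" and [measurable]: "h \<in> borel_measurable borel"
  shows "(\<integral>\<^sup>+x. h (f x) \<partial>surface_measure) = (\<integral>\<^sup>+x. h x \<partial>surface_measure)"
proof -
  have [measurable]: "f \<in> borel_measurable borel" by (rule isometry_measurable) fact
  have "(\<integral>\<^sup>+x. h x \<partial>surface_measure) = (\<integral>\<^sup>+x. h x \<partial>distr surface_measure borel f)"
    using distr_surface_measure_isometry[OF assms(1,2)] by simp
  also have "\<dots> = (\<integral>\<^sup>+x. h (f x) \<partial>surface_measure)"
    by (subst nn_integral_distr) auto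
  finally show ?thesis by simp
qed

lemma nn_integral_surface_translate:
  fixes v :: "real^'n"
  assumes "h \<in> borel_measurable borel"
  shows "(\<integral>\<^sup>+x. h (x + v) \<partial>surface_measure) = (\<integral>\<^sup>+x. h x \<partial>surface_measure)"
  using assms by (intro nn_integral_surface_isometry) (auto simp: surj_plus_right)

lemma orthogonal_dist:
  fixes R :: "real^'n \<Rightarrow> real^'n"
  shows "orthogonal_transformation R \<Longrightarrow> dist (R x) (R y) = dist x y"
  unfolding orthogonal_transformation_isometry by blast

lemma nn_integral_surface_orthogonal:
  fixes R :: "real^'n \<Rightarrow> real^'n"
  assumes R: "orthogonal_transformation R" and "h \<in> borel_measurable borel"
  shows "(\<integral>\<^sup>+x. h (R x) \<partial>surface_measure) = (\<integral>\<^sup>+x. h x \<partial>surface_measure)"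
  using assms orthogonal_transformation_surj[OF R]
  by (intro nn_integral_surface_isometry) (auto simp: orthogonal_dist)

lemma hausdorff_pre_finite_cover:
  assumes I: "finite I" and cov: "A \<subseteq> (\<Union>g\<in>I. C g)" and d: "\<delta> \<ge> 0"
    and C: "\<And>g. g \<in> I \<Longrightarrow> bounded (C g) \<and> diameter (C g) \<le> \<delta>"
  shows "hausdorff_pre s \<delta> A \<le> (\<Sum>g\<in>I. cover_weight s (C g))"
proof -
  obtain h where h: "bij_betw h {0..<card I} I" using ex_bij_betw_nat_finite[OF I] by blast
  define D where "D i = (if i < card I then C (h i) else {})" for i
  have "fine_cover \<delta> A D"
    unfolding fine_cover_def
  proof (intro conjI allI)
    show "A \<subseteq> (\<Union>i. D i)"
    proof
      fix x assume "x \<in> A"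
      then obtain g where "g \<in> I" "x \<in> C g" using cov by auto
      moreover have "g \<in> h ` {0..<card I}" using h \<open>g \<in> I\<close> by (simp add: bij_betw_def)
      then obtain i where "i < card I" "h i = g" by auto
      ultimately show "x \<in> (\<Union>i. D i)" by (auto simp: D_def)
    qed
    show "bounded (D i)" "diameter (D i) \<le> \<delta>" for i
      using C d bij_betwE[OF h] by (auto simp: D_def)
  qed
  then have "hausdorff_pre s \<delta> A \<le> (\<Sum>i. cover_weight s (D i))" by (rule hausdorff_pre_le)
  also have "\<dots> = (\<Sum>i\<in>{0..<card I}. cover_weight s (D i))"
    by (rule suminf_finite) (auto simp: D_def cover_weight_def)
  also have "\<dots> = (\<Sum>i\<in>{0..<card I}. cover_weight s (C (h i)))"
    by (intro sum.cong) (auto simp: D_def)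
  also have "\<dots> = (\<Sum>g\<in>I. cover_weight s (C g))" by (rule sum.reindex_bij_betw[OF h])
  finally show ?thesis .
qed

lemma grid_cell_exists:
  fixes a t :: real
  assumes "m > 0" "a > 0" "\<bar>t\<bar> \<le> a"
  obtains k where "k < m" "- a + 2 * a * real k / real m \<le> t" "t \<le> - a + 2 * a * (real k + 1) / real m"
proof -
  define u where "u = (t + a) * real m / (2 * a)"
  have t: "t = - a + 2 * a * u / real m" using assms by (simp add: u_def field_simps)
  have u: "0 \<le> u" "u \<le> real m" using assms by (auto simp: u_def divide_le_eq mult.commute intro!: mult_right_mono)
  define k where "k = (if u = real m then m - 1 else nat \<lfloor>u\<rfloor>)"
  have k: "k < m" "real k \<le> u" "u \<le> real k + 1"
    using u assms(1) unfolding k_def by (auto simp: of_nat_diff) linarith+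
  show thesis
  proof (rule that[OF k(1)])
    show "- a + 2 * a * real k / real m \<le> t" "t \<le> - a + 2 * a * (real k + 1) / real m"
      unfolding t using k assms by (auto intro!: divide_right_mono)
  qed
qed

text \<open>
  Cut the box into \<open>m\<^sup>d\<close> equal cubes of dimension \<open>d = n - 1\<close>. Their diameters are at most
  \<open>2 n a / m\<close>, so the total weight does not depend on \<open>m\<close>.
\<close>
lemma hausdorff_finite_on_coordinate_box:
  fixes j :: "'n::finite"
  assumes a: "a > 0"
  shows "hausdorff_outer (CARD('n) - 1) {x::real^'n. x $ j = 0 \<and> (\<forall>i. \<bar>x $ i\<bar> \<le> a)} < top"
proof -
  let ?A = "{x::real^'n. x $ j = 0 \<and> (\<forall>i. \<bar>x $ i\<bar> \<le> a)}"
  let ?d = "CARD('n) - 1" and ?n = "real CARD('n)"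
  have n: "?n > 0" by simp
  have "hausdorff_outer ?d ?A \<le> ennreal (unit_ball_vol (real ?d) * (?n * a) ^ ?d)"
  proof (rule hausdorff_outer_le)
    fix \<delta> :: real assume \<delta>: "\<delta> > 0"
    obtain m :: nat where "?n * (2 * a) / \<delta> < real m" using reals_Archimedean2 by blast
    moreover have "?n * (2 * a) / \<delta> > 0" using n a \<delta> by simp
    ultimately have m: "m > 0" by (metis less_trans of_nat_0_less_iff)
    then have m\<delta>: "?n * (2 * a / real m) \<le> \<delta>"
      using \<open>?n * (2 * a) / \<delta> < real m\<close> \<delta> by (simp add: field_simps)
    define I where "I = (UNIV - {j} \<rightarrow>\<^sub>E {..<m})"
    define C where "C g = {x::real^'n. x $ j = 0 \<and> (\<forall>i. i \<noteq> j \<longrightarrow>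
        - a + 2 * a * real (g i) / real m \<le> x $ i \<and> x $ i \<le> - a + 2 * a * (real (g i) + 1) / real m)}" for g
    have I: "finite I" "card I = m ^ ?d"
      unfolding I_def by (auto intro!: finite_PiE simp: card_PiE card_Diff_singleton)
    have cov: "?A \<subseteq> (\<Union>g\<in>I. C g)"
    proof
      fix x assume x: "x \<in> ?A"
      have "\<exists>k<m. - a + 2 * a * real k / real m \<le> x $ i \<and> x $ i \<le> - a + 2 * a * (real k + 1) / real m" for i
        using grid_cell_exists[OF m a, of "x $ i"] x by auto
      then obtain k where k: "\<And>i. k i < m \<and> - a + 2 * a * real (k i) / real m \<le> x $ i \<and> x $ i \<le> - a + 2 * a * (real (k i) + 1) / real m"
        by metis
      have "restrict k (UNIV - {j}) \<in> I" using k by (auto simp: I_def)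
      moreover have "x \<in> C (restrict k (UNIV - {j}))" using x k by (auto simp: C_def)
      ultimately show "x \<in> (\<Union>g\<in>I. C g)" by blast
    qed
    have dist_C: "dist x y \<le> ?n * (2 * a / real m)" if "x \<in> C g" "y \<in> C g" for x y g
    proof -
      have "dist x y \<le> (\<Sum>i\<in>UNIV. \<bar>(x - y) $ i\<bar>)" unfolding dist_norm by (rule norm_le_l1_cart)
      also have "\<dots> \<le> (\<Sum>i\<in>(UNIV::'n set). 2 * a / real m)"
      proof (rule sum_mono)
        fix i
        show "\<bar>(x - y) $ i\<bar> \<le> 2 * a / real m"
        proof (cases "i = j")
          case False
          have "- a + 2 * a * (real (g i) + 1) / real m = (- a + 2 * a * real (g i) / real m) + 2 * a / real m"
            by (simp add: distrib_left add_divide_distrib)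
          then show ?thesis using that False unfolding C_def by (auto simp: abs_le_iff) (smt (verit))+
        qed (use that a in \<open>auto simp: C_def\<close>)
      qed
      also have "\<dots> = ?n * (2 * a / real m)" by simp
      finally show ?thesis .
    qed
    have bC: "bounded (C g)" for g using dist_C unfolding bounded_two_points by blast
    have dC: "diameter (C g) \<le> ?n * (2 * a / real m)" for g
      using dist_C n a m by (intro diameter_le_dist) auto
    have "hausdorff_pre ?d \<delta> ?A \<le> (\<Sum>g\<in>I. cover_weight ?d (C g))"
      using I cov \<delta> bC order_trans[OF dC m\<delta>] by (intro hausdorff_pre_finite_cover) auto
    also have "\<dots> \<le> (\<Sum>g\<in>I. ennreal (unit_ball_vol (real ?d) * (?n * a / real m) ^ ?d))"
    proof (rule sum_mono)
      fix g
      have "diameter (C g) / 2 \<le> ?n * a / real m" using dC[of g] by (simp add: mult_ac)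
      moreover have "0 \<le> diameter (C g)" by (rule diameter_ge_0[OF bC])
      ultimately show "cover_weight ?d (C g) \<le> ennreal (unit_ball_vol (real ?d) * (?n * a / real m) ^ ?d)"
        unfolding cover_weight_def by (auto intro!: ennreal_leI mult_left_mono power_mono)
    qed
    also have "\<dots> = ennreal (real m ^ ?d * (unit_ball_vol (real ?d) * (?n * a / real m) ^ ?d))"
      using n a by (simp add: I ennreal_mult' ennreal_power ennreal_of_nat_eq_real_of_nat)
    also have "real m ^ ?d * (unit_ball_vol (real ?d) * (?n * a / real m) ^ ?d) = unit_ball_vol (real ?d) * (?n * a) ^ ?d"
      using m by (simp add: power_divide)
    finally show "hausdorff_pre ?d \<delta> ?A \<le> ennreal (unit_ball_vol (real ?d) * (?n * a) ^ ?d)" .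
  qed
  also have "\<dots> < top" by simp
  finally show ?thesis .
qed

definition hyperplane_measure :: "real^'n \<Rightarrow> (real^'n) measure" where
  "hyperplane_measure u = density surface_measure (indicator {z. z \<bullet> u = 0})"

lemma borel_hyperplane [measurable]: "{z::real^'n. z \<bullet> u = a} \<in> sets borel"
  by (intro borel_closed closed_Collect_eq) (auto intro: continuous_intros)

lemma sets_hyperplane_measure [simp, measurable_cong]: "sets (hyperplane_measure u) = sets borel"
  and space_hyperplane_measure [simp]: "space (hyperplane_measure u) = UNIV"
  by (simp_all add: hyperplane_measure_def)

lemma nn_integral_hyperplane:
  assumes [measurable]: "f \<in> borel_measurable borel"
  shows "(\<integral>\<^sup>+z. f z \<partial>hyperplane_measure u) = (\<integral>\<^sup>+z. indicator {z. z \<bullet> u = 0} z * f z \<partial>surface_measure)"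
  unfolding hyperplane_measure_def by (rule nn_integral_density) auto

lemma emeasure_hyperplane_measure:
  assumes [measurable]: "A \<in> sets borel"
  shows "emeasure (hyperplane_measure u) A = emeasure surface_measure (A \<inter> {z. z \<bullet> u = 0})"
  unfolding hyperplane_measure_def
  by (subst emeasure_density) (auto simp: Int_commute simp flip: indicator_inter_arith)

lemma AE_hyperplane_measure: "AE z in hyperplane_measure u. z \<bullet> u = 0"
  unfolding hyperplane_measure_def by (subst AE_density) (auto simp: indicator_def)

lemma nn_integral_hyperplane_orthogonal:
  fixes R :: "real^'n \<Rightarrow> real^'n"
  assumes R: "orthogonal_transformation R" and [measurable]: "f \<in> borel_measurable borel"
  shows "(\<integral>\<^sup>+z. f (R z) \<partial>hyperplane_measure u) = (\<integral>\<^sup>+z. f z \<partial>hyperplane_measure (R u))"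
proof -
  have [measurable]: "R \<in> borel_measurable borel"
    by (rule isometry_measurable) (use R orthogonal_dist in blast)
  have inn: "R z \<bullet> R u = z \<bullet> u" for z using R by (simp add: orthogonal_transformation_def)
  have "(\<integral>\<^sup>+z. f (R z) \<partial>hyperplane_measure u)
      = (\<integral>\<^sup>+z. (\<lambda>z. indicator {z. z \<bullet> R u = 0} z * f z) (R z) \<partial>surface_measure)"
    by (subst nn_integral_hyperplane) (auto simp: inn indicator_def)
  also have "\<dots> = (\<integral>\<^sup>+z. indicator {z. z \<bullet> R u = 0} z * f z \<partial>surface_measure)"
    by (rule nn_integral_surface_orthogonal[OF R]) measurable
  also have "\<dots> = (\<integral>\<^sup>+z. f z \<partial>hyperplane_measure (R u))" by (simp add: nn_integral_hyperplane)
  finally show ?thesis .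
qed

lemma nn_integral_hyperplane_translate:
  assumes v: "v \<bullet> u = 0" and [measurable]: "f \<in> borel_measurable borel"
  shows "(\<integral>\<^sup>+z. f (z + v) \<partial>hyperplane_measure u) = (\<integral>\<^sup>+z. f z \<partial>hyperplane_measure u)"
proof -
  have "(\<integral>\<^sup>+z. f (z + v) \<partial>hyperplane_measure u)
      = (\<integral>\<^sup>+z. (\<lambda>z. indicator {z. z \<bullet> u = 0} z * f z) (z + v) \<partial>surface_measure)"
    by (subst nn_integral_hyperplane) (auto simp: v inner_add_left indicator_def)
  also have "\<dots> = (\<integral>\<^sup>+z. indicator {z. z \<bullet> u = 0} z * f z \<partial>surface_measure)"
    by (rule nn_integral_surface_translate) measurable
  also have "\<dots> = (\<integral>\<^sup>+z. f z \<partial>hyperplane_measure u)" by (simp add: nn_integral_hyperplane)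
  finally show ?thesis .
qed

lemma orthogonal_axis_to_unit:
  fixes u v :: "real^'n"
  assumes "norm u = 1" "norm v = 1"
  obtains R where "orthogonal_transformation R" "R u = v"
  using orthogonal_transformation_exists[of u v] assms by metis

lemma hyperplane_measure_cball_finite:
  fixes u :: "real^'n"
  assumes u: "norm u = 1"
  shows "emeasure (hyperplane_measure u) (cball 0 r) < top"
proof -
  obtain j :: 'n where True by simp
  define a where "a = \<bar>r\<bar> + 1"
  define e :: "real^'n" where "e = axis j 1"
  have e: "norm e = 1" by (simp add: e_def)
  obtain R where R: "orthogonal_transformation R" "R e = u" using orthogonal_axis_to_unit[OF e u] .
  have [measurable]: "R \<in> borel_measurable borel"
    by (rule isometry_measurable) (use R orthogonal_dist in blast)
  let ?A = "{x::real^'n. x $ j = 0 \<and> (\<forall>i. \<bar>x $ i\<bar> \<le> a)}"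
  have [measurable]: "cball (0::real^'n) r \<in> sets borel" by (rule borel_closed) simp
  have "closed ?A"
    by (intro closed_Collect_conj closed_Collect_all closed_Collect_eq closed_Collect_le continuous_intros)
  then have [measurable]: "?A \<in> sets borel" by simp
  have "emeasure (hyperplane_measure u) (cball 0 r) = (\<integral>\<^sup>+z. indicator (cball 0 r) z \<partial>hyperplane_measure (R (e)))"
    by (simp add: R)
  also have "\<dots> = (\<integral>\<^sup>+z. indicator (cball 0 r) (R z) \<partial>hyperplane_measure (e))"
    by (rule nn_integral_hyperplane_orthogonal[OF R(1), symmetric]) measurable
  also have "\<dots> = (\<integral>\<^sup>+z. indicator {z. z \<bullet> e = 0} z * indicator (cball 0 r) (R z) \<partial>surface_measure)"
    by (rule nn_integral_hyperplane) measurable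
  also have "\<dots> \<le> (\<integral>\<^sup>+z. indicator ?A z \<partial>surface_measure)"
  proof (rule nn_integral_mono)
    fix z :: "real^'n"
    have "\<bar>z $ i\<bar> \<le> a" if "norm (R z) \<le> r" for i
      using that component_le_norm_cart[of z i] by (simp add: a_def orthogonal_transformation_norm[OF R(1)])
    then show "indicator {z. z \<bullet> e = 0} z * indicator (cball 0 r) (R z) \<le> (indicator ?A z :: ennreal)"
      by (auto simp: indicator_def inner_axis e_def)
  qed
  also have "\<dots> = hausdorff_outer (CARD('n) - 1) ?A"
    using emeasure_surface_measure[of ?A] by simp
  also have "\<dots> < top" by (rule hausdorff_finite_on_coordinate_box) (simp add: a_def)
  finally show ?thesis .
qed

lemma sigma_finite_hyperplane_measure:
  fixes u :: "real^'n"
  assumes u: "norm u = 1"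
  shows "sigma_finite_measure (hyperplane_measure u)"
proof
  let ?A = "range (\<lambda>k::nat. cball (0::real^'n) (real k))"
  have "\<Union>?A = UNIV" using real_arch_simple by (auto simp: dist_norm)
  then show "\<exists>A. countable A \<and> A \<subseteq> sets (hyperplane_measure u) \<and> \<Union>A = space (hyperplane_measure u) \<and>
      (\<forall>a\<in>A. emeasure (hyperplane_measure u) a \<noteq> \<infinity>)"
    using hyperplane_measure_cball_finite[OF u] by (intro exI[of _ ?A]) (auto simp: less_top)
qed

text \<open>
  Fubini's formula for the product of surface measure on the hyperplane orthogonal to \<open>u\<close>
  with length in the direction \<open>u\<close>. It makes sense of integration over \<open>n - 1\<close> dimensions
  without a type of that dimension.
\<close>
definition slice_integral :: "real^'n \<Rightarrow> (real^'n \<Rightarrow> ennreal) \<Rightarrow> ennreal" where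
  "slice_integral u f = (\<integral>\<^sup>+z. (\<integral>\<^sup>+s. f (z + s *\<^sub>R u) \<partial>lborel) \<partial>hyperplane_measure u)"

text \<open>
  A translation splits into one within the hyperplane and one along \<open>u\<close>.
\<close>
lemma slice_integral_translate:
  fixes u :: "real^'n"
  assumes u: "norm u = 1" and [measurable]: "f \<in> borel_measurable borel"
  shows "slice_integral u (\<lambda>x. f (x + v)) = slice_integral u f"
proof -
  define w where "w = v - (v \<bullet> u) *\<^sub>R u"
  have w: "w \<bullet> u = 0" using u by (simp add: w_def inner_diff_left norm_eq_1)
  have "slice_integral u (\<lambda>x. f (x + v)) = (\<integral>\<^sup>+z. (\<integral>\<^sup>+s. f (z + w + s *\<^sub>R u) \<partial>lborel) \<partial>hyperplane_measure u)"
    unfolding slice_integral_def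
  proof (rule nn_integral_cong)
    fix z
    have "(\<integral>\<^sup>+s. f (z + s *\<^sub>R u + v) \<partial>lborel) = (\<integral>\<^sup>+s. f (z + w + (v \<bullet> u + 1 * s) *\<^sub>R u) \<partial>lborel)"
      by (simp add: w_def algebra_simps)
    also have "\<dots> = (\<integral>\<^sup>+s. f (z + w + s *\<^sub>R u) \<partial>lborel)"
      by (subst nn_integral_real_affine[where c=1 and t="v \<bullet> u" and f="\<lambda>s. f (z + w + s *\<^sub>R u)"]) auto
    finally show "(\<integral>\<^sup>+s. f (z + s *\<^sub>R u + v) \<partial>lborel) = (\<integral>\<^sup>+s. f (z + w + s *\<^sub>R u) \<partial>lborel)" .
  qed
  also have "\<dots> = slice_integral u f"
    unfolding slice_integral_def by (rule nn_integral_hyperplane_translate[OF w]) measurable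
  finally show ?thesis .
qed

lemma slice_integral_orthogonal:
  fixes u :: "real^'n" and R :: "real^'n \<Rightarrow> real^'n"
  assumes R: "orthogonal_transformation R" and [measurable]: "f \<in> borel_measurable borel"
  shows "slice_integral u (\<lambda>x. f (R x)) = slice_integral (R u) f"
proof -
  have [measurable]: "R \<in> borel_measurable borel"
    by (rule isometry_measurable) (use R orthogonal_dist in blast)
  have lin: "R (z + s *\<^sub>R u) = R z + s *\<^sub>R R u" for z s
    using R by (simp add: orthogonal_transformation_def linear_add linear_scale)
  show ?thesis
    unfolding slice_integral_def lin
    using nn_integral_hyperplane_orthogonal[OF R, of "\<lambda>z. \<integral>\<^sup>+s. f (z + s *\<^sub>R R u) \<partial>lborel" u] by simp
qed

text \<open>
  Uniqueness of translation invariant measures. Integrate \<open>1\<^sub>B y * f (x + y)\<close> over both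
  measures, with \<open>B\<close> the unit ball: integrating over \<open>x\<close> first gives the left side by
  invariance of the slice measure, integrating over \<open>y\<close> first gives the right side by
  invariance of Lebesgue measure, together with \<open>B = - B\<close>.
\<close>
lemma slice_integral_proportional:
  fixes u :: "real^'n"
  assumes u: "norm u = 1" and [measurable]: "f \<in> borel_measurable borel"
  shows "emeasure lborel (cball (0::real^'n) 1) * slice_integral u f
       = slice_integral u (indicator (cball 0 1)) * (\<integral>\<^sup>+x. f x \<partial>lborel)"
proof -
  let ?H = "hyperplane_measure u" and ?B = "cball (0::real^'n) 1"
  interpret H: sigma_finite_measure ?H by (rule sigma_finite_hyperplane_measure[OF u])
  interpret HL: pair_sigma_finite ?H "lborel :: real measure" ..
  interpret P: pair_sigma_finite "lborel :: (real^'n) measure" "?H \<Otimes>\<^sub>M (lborel :: real measure)" ..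
  have B [simp, measurable]: "?B \<in> sets borel" by (rule borel_closed) simp
  define p where "p q = fst q + snd q *\<^sub>R u" for q :: "(real^'n) \<times> real"
  have p [measurable]: "p \<in> borel_measurable (?H \<Otimes>\<^sub>M (lborel :: real measure))" unfolding p_def by measurable
  have T: "slice_integral u g = (\<integral>\<^sup>+q. g (p q) \<partial>(?H \<Otimes>\<^sub>M lborel))" if [measurable]: "g \<in> borel_measurable borel" for g
    unfolding slice_integral_def by (subst lborel.nn_integral_fst[symmetric]) (auto simp: p_def)
  have "emeasure lborel ?B * slice_integral u f = (\<integral>\<^sup>+y. indicator ?B y * slice_integral u f \<partial>lborel)"
    by (subst nn_integral_multc) simp_all
  also have "\<dots> = (\<integral>\<^sup>+y. (\<integral>\<^sup>+q. indicator ?B y * f (p q + y) \<partial>(?H \<Otimes>\<^sub>M lborel)) \<partial>lborel)"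
  proof (rule nn_integral_cong)
    fix y :: "real^'n"
    show "indicator ?B y * slice_integral u f = (\<integral>\<^sup>+q. indicator ?B y * f (p q + y) \<partial>(?H \<Otimes>\<^sub>M lborel))"
      using T[of "\<lambda>x. f (x + y)"] slice_integral_translate[OF u, of f y] by (simp add: nn_integral_cmult)
  qed
  also have "\<dots> = (\<integral>\<^sup>+q. (\<integral>\<^sup>+y. indicator ?B y * f (p q + y) \<partial>lborel) \<partial>(?H \<Otimes>\<^sub>M lborel))"
    by (rule P.Fubini'[symmetric]) measurable
  also have "\<dots> = (\<integral>\<^sup>+q. (\<integral>\<^sup>+y. indicator ?B (y - p q) * f y \<partial>lborel) \<partial>(?H \<Otimes>\<^sub>M lborel))"
  proof (rule nn_integral_cong)
    fix q
    have "(\<integral>\<^sup>+y. indicator ?B (y - p q) * f y \<partial>lborel) = (\<integral>\<^sup>+y. indicator ?B (y - p q) * f y \<partial>distr lborel borel ((+) (p q)))"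
      by (simp add: lborel_distr_plus)
    also have "\<dots> = (\<integral>\<^sup>+y. indicator ?B y * f (p q + y) \<partial>lborel)"
      by (subst nn_integral_distr) auto
    finally show "(\<integral>\<^sup>+y. indicator ?B y * f (p q + y) \<partial>lborel) = (\<integral>\<^sup>+y. indicator ?B (y - p q) * f y \<partial>lborel)" ..
  qed
  also have "\<dots> = (\<integral>\<^sup>+y. (\<integral>\<^sup>+q. indicator ?B (y - p q) * f y \<partial>(?H \<Otimes>\<^sub>M lborel)) \<partial>lborel)"
    by (rule P.Fubini') measurable
  also have "\<dots> = (\<integral>\<^sup>+y. slice_integral u (indicator ?B) * f y \<partial>lborel)"
  proof (rule nn_integral_cong)
    fix y
    have "indicator ?B (y - p q) = (indicator ?B (p q + - y) :: ennreal)" for q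
      by (auto simp: indicator_def norm_minus_commute)
    then show "(\<integral>\<^sup>+q. indicator ?B (y - p q) * f y \<partial>(?H \<Otimes>\<^sub>M lborel)) = slice_integral u (indicator ?B) * f y"
      using T[of "\<lambda>x. indicator ?B (x + - y)"] slice_integral_translate[OF u, of "indicator ?B" "- y"]
      by (simp add: nn_integral_multc)
  qed
  also have "\<dots> = slice_integral u (indicator ?B) * (\<integral>\<^sup>+x. f x \<partial>lborel)"
    by (rule nn_integral_cmult) simp
  finally show ?thesis .
qed

text \<open>
  The argument of type \<open>itself\<close> fixes the dimension, which \<open>c\<close> alone does not show.
\<close>
definition slicing_constant :: "'n::finite itself \<Rightarrow> ennreal \<Rightarrow> bool" where
  "slicing_constant _ c \<longleftrightarrow> (\<forall>(u::real^'n) f. norm u = 1 \<longrightarrow> f \<in> borel_measurable borel \<longrightarrow>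
      slice_integral u f = c * (\<integral>\<^sup>+x. f x \<partial>lborel))"

text \<open>
  The constant of proportionality is the slice integral of the unit ball divided by its
  volume. The ball is invariant under rotations, so the constant is the same for all
  directions.
\<close>
lemma slicing_constant_exists:
  obtains c where "slicing_constant TYPE('n::finite) c"
proof -
  obtain j :: 'n where True by simp
  define e :: "real^'n" where "e = axis j 1"
  have e: "norm e = 1" by (simp add: e_def)
  let ?B = "cball (0::real^'n) 1"
  let ?b = "emeasure lborel ?B"
  have [simp, measurable]: "?B \<in> sets borel" by (rule borel_closed) simp
  define T where "T = slice_integral e (indicator ?B)"
  have b: "?b < top" "?b \<noteq> 0"
    using less_imp_neq[OF unit_ball_vol_pos[of "real CARD('n)"]] by (simp_all add: emeasure_cball)
  have "slice_integral u f = T / ?b * (\<integral>\<^sup>+x. f x \<partial>lborel)"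
    if u: "norm u = 1" and f: "f \<in> borel_measurable borel" for u :: "real^'n" and f :: "real^'n \<Rightarrow> ennreal"
  proof -
    obtain R where R: "orthogonal_transformation R" "R e = u" using orthogonal_axis_to_unit[OF e u] .
    have "(\<lambda>x. indicator ?B (R x)) = (indicator ?B :: real^'n \<Rightarrow> ennreal)"
      by (auto simp: fun_eq_iff indicator_def orthogonal_transformation_norm[OF R(1)])
    then have "slice_integral u (indicator ?B) = T"
      using slice_integral_orthogonal[OF R(1), of "indicator ?B" e] R by (simp add: T_def)
    then have "?b * slice_integral u f = T * (\<integral>\<^sup>+x. f x \<partial>lborel)"
      using slice_integral_proportional[OF u f] by simp
    then show ?thesis
      using mult_divide_eq_ennreal[of ?b "slice_integral u f"] b
      by (simp add: mult.commute ennreal_times_divide less_top)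
  qed
  then show thesis using that unfolding slicing_constant_def by blast
qed

section \<open>The exterior normal of a smooth boundary\<close>

lemma smooth_on_has_derivative:
  assumes "smooth_on U f" "x \<in> U"
  shows "(f has_derivative (\<lambda>v. grad f x \<bullet> v)) (at x)"
proof -
  have "Ck_on (Suc 0) U f" using assms(1) unfolding smooth_on_def by blast
  then have "f differentiable (at x)" using assms(2) by simp
  then have d: "(f has_derivative frechet_derivative f (at x)) (at x)" by (rule frechet_derivative_works[THEN iffD1])
  then have lin: "linear (frechet_derivative f (at x))" by (rule has_derivative_linear)
  have "frechet_derivative f (at x) v = grad f x \<bullet> v" for v
  proof -
    have "v = (\<Sum>i\<in>UNIV. v $ i *\<^sub>R axis i 1)"
      by (simp add: basis_expansion flip: scalar_mult_eq_scaleR)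
    then have "frechet_derivative f (at x) v = frechet_derivative f (at x) (\<Sum>i\<in>UNIV. v $ i *\<^sub>R axis i 1)"
      by (rule arg_cong)
    also have "\<dots> = (\<Sum>i\<in>UNIV. v $ i * frechet_derivative f (at x) (axis i 1))"
      by (simp add: linear_sum[OF lin] linear_scale[OF lin])
    also have "\<dots> = grad f x \<bullet> v" by (simp add: grad_def inner_vec_def mult.commute)
    finally show ?thesis .
  qed
  then have "frechet_derivative f (at x) = (\<lambda>v. grad f x \<bullet> v)" by (rule ext)
  then show ?thesis using d by (simp only:)
qed

lemma smooth_on_continuous_grad:
  assumes "smooth_on U f"
  shows "continuous_on U (grad f)"
proof -
  have "Ck_on (Suc 0) U f" using assms(1) unfolding smooth_on_def by blast
  then show ?thesis unfolding grad_def by (intro continuous_on_vec_lambda) simp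
qed

text \<open>
  The mean value inequality for \<open>f - grad f x\<close>, whose gradient is small near \<open>x\<close> by
  continuity.
\<close>
lemma smooth_on_strictly_differentiable:
  assumes sm: "smooth_on U f" and U: "open U" "x \<in> U" and \<eta>: "\<eta> > 0"
  obtains r where "r > 0" "ball x r \<subseteq> U"
    and "\<And>y z. y \<in> ball x r \<Longrightarrow> z \<in> ball x r \<Longrightarrow> \<bar>f y - f z - grad f x \<bullet> (y - z)\<bar> \<le> \<eta> * norm (y - z)"
proof -
  obtain r1 where r1: "r1 > 0" "ball x r1 \<subseteq> U" using U open_contains_ball by blast
  have "continuous (at x) (grad f)"
    using smooth_on_continuous_grad[OF sm] U by (simp add: continuous_on_eq_continuous_at)
  then obtain r2 where r2: "r2 > 0" "\<And>y. dist y x < r2 \<Longrightarrow> dist (grad f y) (grad f x) < \<eta>"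
    using \<eta> unfolding continuous_at by (metis LIM_def dist_self)
  define r where "r = min r1 r2"
  show thesis
  proof (rule that[of r])
    show "r > 0" "ball x r \<subseteq> U" using r1 r2 by (auto simp: r_def)
    fix y z assume yz: "y \<in> ball x r" "z \<in> ball x r"
    let ?g = "\<lambda>y. f y - grad f x \<bullet> y"
    have "norm (?g y - ?g z) \<le> \<eta> * norm (y - z)"
    proof (rule differentiable_bound[of "ball x r"])
      fix w assume w: "w \<in> ball x r"
      then have "w \<in> U" using r1 by (auto simp: r_def)
      show "(?g has_derivative (\<lambda>v. (grad f w - grad f x) \<bullet> v)) (at w within ball x r)"
        using has_derivative_diff[OF has_derivative_at_withinI[OF smooth_on_has_derivative[OF sm \<open>w \<in> U\<close>]]
            bounded_linear_imp_has_derivative[OF bounded_linear_inner_right]]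
        by (simp add: inner_diff_left)
      show "onorm (\<lambda>v. (grad f w - grad f x) \<bullet> v) \<le> \<eta>"
      proof (rule onorm_le)
        fix v
        have "norm (grad f w - grad f x) \<le> \<eta>" using r2(2)[of w] w by (auto simp: r_def dist_norm norm_minus_commute)
        then show "norm ((grad f w - grad f x) \<bullet> v) \<le> \<eta> * norm v"
          using Cauchy_Schwarz_ineq2[of "grad f w - grad f x" v]
            mult_right_mono[of "norm (grad f w - grad f x)" \<eta> "norm v"] by simp
      qed
    qed (use yz in auto)
    then show "\<bar>f y - f z - grad f x \<bullet> (y - z)\<bar> \<le> \<eta> * norm (y - z)"
      by (simp add: inner_diff_right algebra_simps)
  qed
qed

lemma local_graphE:
  assumes "local_graph \<Omega> x e f"
  obtains U where "norm e = 1" "\<And>y t. f (y + t *\<^sub>R e) = f y" "open U" "x \<in> U" "smooth_on U f"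
    "\<And>y. y \<in> U \<Longrightarrow> y \<in> frontier \<Omega> \<longleftrightarrow> y \<bullet> e = f y"
    "\<And>y. y \<in> U \<Longrightarrow> y \<bullet> e < f y \<Longrightarrow> y \<in> \<Omega>" "\<And>y. y \<in> U \<Longrightarrow> y \<bullet> e > f y \<Longrightarrow> y \<notin> \<Omega>"
  using assms unfolding local_graph_def by blast

lemma local_graph_grad_orthogonal:
  assumes "local_graph \<Omega> x e f"
  shows "grad f x \<bullet> e = 0"
proof -
  obtain U where U: "norm e = 1" "\<And>y t. f (y + t *\<^sub>R e) = f y" "open U" "x \<in> U" "smooth_on U f"
    using local_graphE[OF assms] by metis
  have "((\<lambda>t. f (x + t *\<^sub>R e)) has_derivative (\<lambda>t. grad f x \<bullet> (t *\<^sub>R e))) (at 0)"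
    by (rule has_derivative_compose[of "\<lambda>t. x + t *\<^sub>R e" "\<lambda>t. t *\<^sub>R e" 0 UNIV f])
      (auto intro!: derivative_eq_intros simp: smooth_on_has_derivative[OF U(5,4)])
  moreover have "((\<lambda>t. f (x + t *\<^sub>R e)) has_derivative (\<lambda>t. 0)) (at 0)"
    unfolding U(2) by simp
  ultimately have "(\<lambda>t. grad f x \<bullet> (t *\<^sub>R e)) = (\<lambda>t. 0)" by (rule has_derivative_unique)
  then show ?thesis by (metis scaleR_one)
qed

lemma local_graph_normal_ge_1:
  assumes "local_graph \<Omega> x e f"
  shows "norm (e - grad f x) \<ge> 1"
proof -
  have e: "norm e = 1" using assms by (simp add: local_graph_def)
  have "(e - grad f x) \<bullet> e = 1"
    using local_graph_grad_orthogonal[OF assms] e by (simp add: inner_diff_left norm_eq_1)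
  then show ?thesis using norm_cauchy_schwarz[of "e - grad f x" e] e by simp
qed

text \<open>
  Along the ray in the direction \<open>v\<close> the height above the graph has the derivative
  \<open>v \<bullet> (e - grad f x)\<close> at 0. So the sign of this inner product decides whether the ray
  enters \<open>\<Omega>\<close>, a question that does not refer to the graph; this makes the normal independent
  of the graph.
\<close>
lemma local_graph_sides:
  assumes lg: "local_graph \<Omega> x e f" and x: "x \<in> frontier \<Omega>"
  shows "v \<bullet> (e - grad f x) < 0 \<Longrightarrow> \<forall>\<^sub>F t in at_right 0. x + t *\<^sub>R v \<in> \<Omega>"
    and "v \<bullet> (e - grad f x) > 0 \<Longrightarrow> \<forall>\<^sub>F t in at_right 0. x + t *\<^sub>R v \<notin> \<Omega>"
proof -
  obtain U where U: "open U" "x \<in> U" "smooth_on U f"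
    and fr: "\<And>y. y \<in> U \<Longrightarrow> y \<in> frontier \<Omega> \<longleftrightarrow> y \<bullet> e = f y"
    and below: "\<And>y. y \<in> U \<Longrightarrow> y \<bullet> e < f y \<Longrightarrow> y \<in> \<Omega>"
    and above: "\<And>y. y \<in> U \<Longrightarrow> y \<bullet> e > f y \<Longrightarrow> y \<notin> \<Omega>"
    using local_graphE[OF lg] by metis
  define \<phi> where "\<phi> t = (x + t *\<^sub>R v) \<bullet> e - f (x + t *\<^sub>R v)" for t
  have \<phi>0: "\<phi> 0 = 0" using fr[OF U(2)] x by (simp add: \<phi>_def)
  have df: "((\<lambda>t. f (x + t *\<^sub>R v)) has_derivative (\<lambda>t. grad f x \<bullet> (t *\<^sub>R v))) (at 0)"
    by (rule has_derivative_compose[of "\<lambda>t. x + t *\<^sub>R v" "\<lambda>t. t *\<^sub>R v" 0 UNIV f])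
      (auto intro!: derivative_eq_intros simp: smooth_on_has_derivative[OF U(3,2)])
  have d: "(\<phi> has_real_derivative (v \<bullet> (e - grad f x))) (at 0)"
    unfolding \<phi>_def has_field_derivative_def
    by (rule derivative_eq_intros df refl)+
      (auto simp: fun_eq_iff inner_add_left inner_diff_right inner_commute algebra_simps)
  have inU: "\<forall>\<^sub>F t in at_right 0. x + t *\<^sub>R v \<in> U"
  proof -
    have "((\<lambda>t. x + t *\<^sub>R v) \<longlongrightarrow> x + 0 *\<^sub>R v) (at_right 0)" by (intro tendsto_intros)
    then show ?thesis using topological_tendstoD[OF _ U(1)] U(2) by auto
  qed
  show "\<forall>\<^sub>F t in at_right 0. x + t *\<^sub>R v \<in> \<Omega>" if neg: "v \<bullet> (e - grad f x) < 0"
  proof -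
    obtain \<delta> where "\<delta> > 0" "\<And>h. 0 < h \<Longrightarrow> h < \<delta> \<Longrightarrow> \<phi> (0 + h) < \<phi> 0"
      using has_real_derivative_neg_dec_right[OF d neg] by auto
    then have "\<forall>\<^sub>F t in at_right 0. \<phi> t < 0"
      unfolding eventually_at_right_field by (auto simp: \<phi>0 intro!: exI[of _ \<delta>])
    with inU show ?thesis
      by eventually_elim (auto simp: \<phi>_def intro: below)
  qed
  show "\<forall>\<^sub>F t in at_right 0. x + t *\<^sub>R v \<notin> \<Omega>" if pos: "v \<bullet> (e - grad f x) > 0"
  proof -
    obtain \<delta> where "\<delta> > 0" "\<And>h. 0 < h \<Longrightarrow> h < \<delta> \<Longrightarrow> \<phi> 0 < \<phi> (0 + h)"
      using has_real_derivative_pos_inc_right[OF d pos] by auto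
    then have "\<forall>\<^sub>F t in at_right 0. \<phi> t > 0"
      unfolding eventually_at_right_field by (auto simp: \<phi>0 intro!: exI[of _ \<delta>])
    with inU show ?thesis
      by eventually_elim (use above in \<open>auto simp: \<phi>_def\<close>)
  qed
qed

text \<open>
  If two graphs gave unit normals \<open>\<nu> \<noteq> \<nu>'\<close>, the ray in the direction \<open>\<nu>' - \<nu>\<close> would enter
  \<open>\<Omega>\<close> according to the first graph and leave it according to the second.
\<close>
lemma exterior_normal_eq:
  assumes lg: "local_graph \<Omega> x e f" and x: "x \<in> frontier \<Omega>"
  shows "exterior_normal \<Omega> x = (e - grad f x) /\<^sub>R norm (e - grad f x)"
  unfolding exterior_normal_def
proof (rule the_equality)
  show "\<exists>e' f'. local_graph \<Omega> x e' f' \<and>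
      (e - grad f x) /\<^sub>R norm (e - grad f x) = (e' - grad f' x) /\<^sub>R norm (e' - grad f' x)"
    using lg by blast
  fix \<nu>' assume "\<exists>e' f'. local_graph \<Omega> x e' f' \<and> \<nu>' = (e' - grad f' x) /\<^sub>R norm (e' - grad f' x)"
  then obtain e' f' where lg': "local_graph \<Omega> x e' f'"
    and \<nu>': "\<nu>' = (e' - grad f' x) /\<^sub>R norm (e' - grad f' x)" by blast
  define \<nu> where "\<nu> = (e - grad f x) /\<^sub>R norm (e - grad f x)"
  have w: "norm (e - grad f x) > 0" "norm (e' - grad f' x) > 0"
    using local_graph_normal_ge_1[OF lg] local_graph_normal_ge_1[OF lg'] by linarith+
  have n: "norm \<nu> = 1" "norm \<nu>' = 1" using w by (auto simp: \<nu>_def \<nu>')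
  show "\<nu>' = (e - grad f x) /\<^sub>R norm (e - grad f x)"
  proof (rule ccontr)
    assume "\<nu>' \<noteq> (e - grad f x) /\<^sub>R norm (e - grad f x)"
    then have "norm (\<nu>' - \<nu>) > 0" by (simp add: \<nu>_def)
    then have "(\<nu>' - \<nu>) \<bullet> (\<nu>' - \<nu>) > 0" by (simp flip: power2_norm_eq_inner)
    then have lt: "\<nu> \<bullet> \<nu>' < 1"
      using n by (simp add: inner_diff_left inner_diff_right inner_commute norm_eq_1)
    define v where "v = \<nu>' - \<nu>"
    have "v \<bullet> \<nu> < 0" "v \<bullet> \<nu>' > 0" using lt n inner_commute[of \<nu>' \<nu>] by (simp_all add: v_def inner_diff_left norm_eq_1)
    moreover have "v \<bullet> \<nu> = v \<bullet> (e - grad f x) / norm (e - grad f x)"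
      "v \<bullet> \<nu>' = v \<bullet> (e' - grad f' x) / norm (e' - grad f' x)"
      by (simp_all add: \<nu>_def \<nu>' divide_inverse mult.commute)
    ultimately have "v \<bullet> (e - grad f x) < 0" "v \<bullet> (e' - grad f' x) > 0"
      using w by (simp_all add: divide_less_0_iff zero_less_divide_iff)
    then have "\<forall>\<^sub>F t in at_right 0. x + t *\<^sub>R v \<in> \<Omega> \<and> x + t *\<^sub>R v \<notin> \<Omega>"
      by (intro eventually_conj local_graph_sides(1)[OF lg x] local_graph_sides(2)[OF lg' x])
    then show False by simp
  qed
qed

context
  fixes \<Omega> :: "(real^'n) set"
  assumes smooth: "smooth_boundary \<Omega>"
begin

lemma norm_exterior_normal:
  assumes "x \<in> frontier \<Omega>"
  shows "norm (exterior_normal \<Omega> x) = 1"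
proof -
  obtain e f where lg: "local_graph \<Omega> x e f" using smooth assms unfolding smooth_boundary_def by blast
  have "norm (e - grad f x) \<noteq> 0" using local_graph_normal_ge_1[OF lg] by linarith
  then show ?thesis by (simp add: exterior_normal_eq[OF lg assms])
qed

lemma continuous_on_exterior_normal: "continuous_on (frontier \<Omega>) (exterior_normal \<Omega>)"
  unfolding continuous_on_eq_continuous_within
proof
  fix x assume x: "x \<in> frontier \<Omega>"
  obtain e f where lg: "local_graph \<Omega> x e f" using smooth x unfolding smooth_boundary_def by blast
  obtain U where U: "open U" "x \<in> U" "smooth_on U f" and lgU: "\<And>y. y \<in> U \<Longrightarrow> local_graph \<Omega> y e f"
    using lg unfolding local_graph_def by blast
  let ?N = "\<lambda>y. (e - grad f y) /\<^sub>R norm (e - grad f y)"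
  have "continuous (at x) (grad f)"
    using smooth_on_continuous_grad[OF U(3)] U by (simp add: continuous_on_eq_continuous_at)
  then have "continuous (at x) ?N"
    using local_graph_normal_ge_1[OF lg] by (intro continuous_intros) auto
  then have "(?N \<longlongrightarrow> ?N x) (at x within frontier \<Omega>)"
    using continuous_at_imp_continuous_at_within continuous_within by blast
  moreover have "\<forall>\<^sub>F y in at x within frontier \<Omega>. ?N y = exterior_normal \<Omega> y"
    using eventually_at_in_open'[OF U(1,2)]
    by (auto simp: eventually_at_filter exterior_normal_eq[OF lgU] elim!: eventually_mono)
  ultimately have "(exterior_normal \<Omega> \<longlongrightarrow> ?N x) (at x within frontier \<Omega>)"
    by (rule Lim_transform_eventually)
  then show "continuous (at x within frontier \<Omega>) (exterior_normal \<Omega>)"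
    by (simp add: continuous_within exterior_normal_eq[OF lg x])
qed

text \<open>
  On the boundary \<open>y \<bullet> e = f y\<close>, so \<open>(y - z) \<bullet> (e - grad f x)\<close> is the error of the linear
  approximation of \<open>f\<close>. Dividing by the length of \<open>e - grad f x\<close>, which is at least 1, does
  not increase it.
\<close>
lemma frontier_nearly_flat:
  assumes x: "x \<in> frontier \<Omega>" and \<eta>: "\<eta> > 0"
  obtains r where "r > 0"
    and "\<And>y z. y \<in> frontier \<Omega> \<inter> ball x r \<Longrightarrow> z \<in> frontier \<Omega> \<inter> ball x r \<Longrightarrow>
      \<bar>(y - z) \<bullet> exterior_normal \<Omega> x\<bar> \<le> \<eta> * norm (y - z)"
proof -
  obtain e f where lg: "local_graph \<Omega> x e f" using smooth x unfolding smooth_boundary_def by blast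
  obtain U where U: "open U" "x \<in> U" "smooth_on U f"
    and fr: "\<And>y. y \<in> U \<Longrightarrow> y \<in> frontier \<Omega> \<longleftrightarrow> y \<bullet> e = f y"
    using local_graphE[OF lg] by metis
  obtain r where r: "r > 0" "ball x r \<subseteq> U"
    and sd: "\<And>y z. y \<in> ball x r \<Longrightarrow> z \<in> ball x r \<Longrightarrow> \<bar>f y - f z - grad f x \<bullet> (y - z)\<bar> \<le> \<eta> * norm (y - z)"
    using smooth_on_strictly_differentiable[OF U(3,1,2) \<eta>] by metis
  define w where "w = e - grad f x"
  have w: "norm w \<ge> 1" unfolding w_def by (rule local_graph_normal_ge_1[OF lg])
  show thesis
  proof (rule that[OF r(1)])
    fix y z assume yz: "y \<in> frontier \<Omega> \<inter> ball x r" "z \<in> frontier \<Omega> \<inter> ball x r"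
    then have "y \<bullet> e = f y" "z \<bullet> e = f z" using fr r by auto
    then have "(y - z) \<bullet> w = f y - f z - grad f x \<bullet> (y - z)"
      by (simp add: w_def inner_diff_left inner_diff_right inner_commute)
    then have "\<bar>(y - z) \<bullet> w\<bar> \<le> \<eta> * norm (y - z)" using sd[of y z] yz by simp
    moreover have "\<bar>(y - z) \<bullet> exterior_normal \<Omega> x\<bar> = \<bar>(y - z) \<bullet> w\<bar> / norm w"
      using w by (simp add: exterior_normal_eq[OF lg x] flip: w_def) (simp add: divide_inverse mult.commute abs_mult)
    moreover have "\<bar>(y - z) \<bullet> w\<bar> / norm w \<le> \<bar>(y - z) \<bullet> w\<bar>"
      using w by (simp add: divide_le_eq mult_ge1_I mult_left_mono[of 1 "norm w" "\<bar>(y - z) \<bullet> w\<bar>", simplified])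
    ultimately show "\<bar>(y - z) \<bullet> exterior_normal \<Omega> x\<bar> \<le> \<eta> * norm (y - z)" by linarith
  qed
qed

end

section \<open>The mass swept out by a boundary piece\<close>

lemma ennreal_less_add_pos: "x \<le> y \<Longrightarrow> x < top \<Longrightarrow> \<kappa> > 0 \<Longrightarrow> x < y + ennreal \<kappa>"
  by (cases x rule: ennreal_cases; cases y rule: ennreal_cases)
    (auto simp: ennreal_less_iff simp flip: ennreal_plus)

lemma gaussian_density_norm:
  fixes x :: "real^'n"
  shows "gaussian_density x = gaussian_density (0::real^'n) * exp (- (norm x)\<^sup>2 / 2)"
proof -
  have "(\<Sum>i\<in>UNIV. (x $ i)\<^sup>2) = (norm x)\<^sup>2"
    unfolding power2_norm_eq_inner inner_vec_def by (simp add: power2_eq_square)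
  then show ?thesis by (simp add: gaussian_density_def)
qed

lemma gaussian_density_pos: "gaussian_density x > 0"
  by (simp add: gaussian_density_def)

lemma continuous_on_gaussian_density [continuous_intros]: "continuous_on S gaussian_density"
  unfolding gaussian_density_def by (intro continuous_intros) simp_all

lemma borel_measurable_gaussian_density [measurable]: "gaussian_density \<in> borel_measurable borel"
  by (intro borel_measurable_continuous_onI continuous_intros)

abbreviation gauss_mass :: "(real^'n) measure \<Rightarrow> (real^'n) set \<Rightarrow> ennreal" where
  "gauss_mass M A \<equiv> \<integral>\<^sup>+x\<in>A. ennreal (gaussian_density x) \<partial>M"

abbreviation hyperplane_mass :: "real^'n \<Rightarrow> ennreal" where
  "hyperplane_mass u \<equiv> \<integral>\<^sup>+z. ennreal (gaussian_density z) \<partial>hyperplane_measure u"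

definition sweep :: "(real^'n) set \<Rightarrow> real \<Rightarrow> real^'n \<Rightarrow> (real^'n) set" where
  "sweep A h e = {x. \<exists>t\<in>{0..h}. x + t *\<^sub>R e \<in> A}"

lemma compact_sweep:
  assumes "compact A"
  shows "compact (sweep A h e)"
proof -
  have "sweep A h e = (\<lambda>(a, t). a - t *\<^sub>R e) ` (A \<times> {0..h})"
    unfolding sweep_def by (force simp: image_iff)
  moreover have "compact \<dots>"
    using assms by (intro compact_continuous_image compact_Times)
      (auto simp: case_prod_beta intro!: continuous_intros)
  ultimately show ?thesis by simp
qed

lemma borel_sweep [measurable]: "compact A \<Longrightarrow> sweep A h e \<in> sets borel"
  by (simp add: compact_sweep compact_imp_closed)

definition orth_proj :: "real^'n \<Rightarrow> real^'n \<Rightarrow> real^'n" where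
  "orth_proj \<nu> x = x - (x \<bullet> \<nu>) *\<^sub>R \<nu>"

lemma orth_proj_diff: "orth_proj \<nu> x - orth_proj \<nu> y = orth_proj \<nu> (x - y)"
  by (simp add: orth_proj_def inner_diff_left algebra_simps)

lemma norm_orth_proj_le:
  assumes "norm \<nu> = 1"
  shows "norm (orth_proj \<nu> x) \<le> norm x"
proof -
  have "(norm (orth_proj \<nu> x))\<^sup>2 = (norm x)\<^sup>2 - (x \<bullet> \<nu>)\<^sup>2"
    using assms unfolding power2_norm_eq_inner orth_proj_def
    by (simp add: inner_diff_left inner_diff_right inner_commute norm_eq_1 power2_eq_square)
  then have "(norm (orth_proj \<nu> x))\<^sup>2 \<le> (norm x)\<^sup>2" by simp
  then show ?thesis by (rule power2_le_imp_le) simp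
qed

lemma dist_orth_proj_le: "norm \<nu> = 1 \<Longrightarrow> dist (orth_proj \<nu> x) (orth_proj \<nu> y) \<le> dist x y"
  by (simp add: dist_norm orth_proj_diff norm_orth_proj_le)

lemma compact_orth_proj: "compact A \<Longrightarrow> compact (orth_proj \<nu> ` A)"
  unfolding orth_proj_def by (intro compact_continuous_image continuous_intros)

lemma hyperplane_measure_compact_finite:
  assumes "norm u = 1" "compact A"
  shows "emeasure (hyperplane_measure u) A < top"
proof -
  obtain r where "\<forall>x\<in>A. norm x \<le> r"
    using compact_imp_bounded[OF assms(2)] unfolding bounded_iff by auto
  then have "A \<subseteq> cball 0 r" by auto
  then have "emeasure (hyperplane_measure u) A \<le> emeasure (hyperplane_measure u) (cball 0 r)"
    by (rule emeasure_mono) (simp add: borel_closed)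
  also have "\<dots> < top" by (rule hyperplane_measure_cball_finite[OF assms(1)])
  finally show ?thesis .
qed

lemma hyperplane_measure_orth_proj_le:
  assumes "norm \<nu> = 1" and A: "compact A"
  shows "emeasure (hyperplane_measure \<nu>) (orth_proj \<nu> ` A) \<le> emeasure surface_measure A"
proof -
  have b: "A \<in> sets borel" "orth_proj \<nu> ` A \<in> sets borel"
    using A compact_orth_proj[OF A] by (auto simp: compact_imp_closed)
  have "emeasure (hyperplane_measure \<nu>) (orth_proj \<nu> ` A) \<le> emeasure surface_measure (orth_proj \<nu> ` A)"
    using b by (subst emeasure_hyperplane_measure) (auto intro!: emeasure_mono)
  also have "\<dots> \<le> emeasure surface_measure A"
    by (rule surface_measure_nonexpansive[OF b order_refl]) (rule dist_orth_proj_le[OF assms(1)])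
  finally show ?thesis .
qed

text \<open>
  The swept sets decrease to the compact set \<open>A\<close> as the time tends to zero, and so do their
  projections; continuity from above applies because compact subsets of a hyperplane have
  finite measure.
\<close>
lemma orth_proj_sweep_LIMSEQ:
  assumes \<nu>: "norm \<nu> = 1" and e: "norm e = 1" and A: "compact A"
  shows "(\<lambda>m. emeasure (hyperplane_measure \<nu>) (orth_proj \<nu> ` sweep A (1 / real (Suc m)) e))
    \<longlonglongrightarrow> emeasure (hyperplane_measure \<nu>) (orth_proj \<nu> ` A)"
proof -
  let ?S = "\<lambda>m. orth_proj \<nu> ` sweep A (1 / real (Suc m)) e"
  have cS: "compact (?S m)" for m by (intro compact_orth_proj compact_sweep A)
  have "(\<Inter>m. ?S m) = orth_proj \<nu> ` A"
  proof (intro equalityI subsetI)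
    fix z assume z: "z \<in> (\<Inter>m. ?S m)"
    show "z \<in> orth_proj \<nu> ` A"
    proof (cases "A = {}")
      case True then show ?thesis using z by (auto simp: sweep_def)
    next
      case False
      have "infdist z (orth_proj \<nu> ` A) \<le> 1 / real (Suc m)" for m
      proof -
        have "z \<in> ?S m" using z by (rule INT_D) simp
        then obtain x where x: "z = orth_proj \<nu> x" "x \<in> sweep A (1 / real (Suc m)) e" by (rule imageE)
        then obtain t where xt: "z = orth_proj \<nu> x" "0 \<le> t" "t \<le> 1 / real (Suc m)" "x + t *\<^sub>R e \<in> A"
          unfolding sweep_def by auto
        have "infdist z (orth_proj \<nu> ` A) \<le> dist z (orth_proj \<nu> (x + t *\<^sub>R e))" using xt by (intro infdist_le) auto
        also have "\<dots> \<le> dist x (x + t *\<^sub>R e)" unfolding xt(1) by (rule dist_orth_proj_le[OF \<nu>])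
        also have "\<dots> \<le> 1 / real (Suc m)" using xt e by (simp add: dist_norm)
        finally show ?thesis .
      qed
      then have "infdist z (orth_proj \<nu> ` A) \<le> 0"
        by (intro LIMSEQ_le_const[OF LIMSEQ_inverse_real_of_nat]) (auto simp: inverse_eq_divide)
      then show ?thesis
        using False compact_orth_proj[OF A, of \<nu>] infdist_nonneg[of z "orth_proj \<nu> ` A"]
        by (subst in_closed_iff_infdist_zero) (auto simp: compact_imp_closed)
    qed
  next
    fix z assume "z \<in> orth_proj \<nu> ` A"
    moreover have "A \<subseteq> sweep A (1 / real (Suc m)) e" for m
      by (auto simp: sweep_def intro!: bexI[of _ 0])
    ultimately show "z \<in> (\<Inter>m. ?S m)" by blast
  qed
  moreover have "(\<lambda>m. emeasure (hyperplane_measure \<nu>) (?S m)) \<longlonglongrightarrow> emeasure (hyperplane_measure \<nu>) (\<Inter>m. ?S m)"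
  proof (rule Lim_emeasure_decseq)
    show "range ?S \<subseteq> sets (hyperplane_measure \<nu>)" using cS by (auto simp: compact_imp_closed)
    show "decseq ?S"
    proof (rule decseq_SucI)
      fix m
      have "1 / real (Suc (Suc m)) \<le> 1 / real (Suc m)" by (intro divide_left_mono) auto
      then show "?S (Suc m) \<subseteq> ?S m"
        by (intro image_mono) (auto simp: sweep_def simp del: of_nat_Suc intro: order_trans)
    qed
    show "emeasure (hyperplane_measure \<nu>) (?S m) \<noteq> \<infinity>" for m
      using hyperplane_measure_compact_finite[OF \<nu> cS[of m]] by simp
  qed
  ultimately show ?thesis by simp
qed

lemma emeasure_real_set_diameter_le:
  assumes F: "F \<in> sets borel" and D: "\<And>s t::real. s \<in> F \<Longrightarrow> t \<in> F \<Longrightarrow> \<bar>s - t\<bar> \<le> D"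
  shows "emeasure lborel F \<le> ennreal D"
proof (cases "F = {}")
  case False
  then obtain s0 where s0: "s0 \<in> F" by blast
  have "F \<subseteq> {Inf F..Inf F + D}"
  proof
    fix s assume s: "s \<in> F"
    have "s0 - D \<le> t" if "t \<in> F" for t using D[OF that s0] by linarith
    then have "bdd_below F" by (rule bdd_belowI)
    moreover have "s - D \<le> Inf F"
    proof (rule cInf_greatest[OF False])
      fix t assume "t \<in> F"
      from D[OF s this] show "s - D \<le> t" by linarith
    qed
    ultimately show "s \<in> {Inf F..Inf F + D}" using s by (auto intro: cInf_lower)
  qed
  then have "emeasure lborel F \<le> emeasure lborel {Inf F..Inf F + D}" by (intro emeasure_mono) auto
  also have "\<dots> = ennreal D" using D[OF s0 s0] by simp
  finally show ?thesis .
qed simp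

text \<open>
  Slicing along \<open>\<nu>\<close>: the lines that meet \<open>S\<close> are those through the projection of \<open>S\<close>, and
  each meets it in a set of length at most \<open>D\<close>.
\<close>
lemma slab_volume_le:
  fixes S :: "(real^'n) set"
  assumes c: "slicing_constant TYPE('n) c" and \<nu>: "norm \<nu> = 1" and S: "compact S"
    and D: "\<And>z s s'. z + s *\<^sub>R \<nu> \<in> S \<Longrightarrow> z + s' *\<^sub>R \<nu> \<in> S \<Longrightarrow> \<bar>s - s'\<bar> \<le> D"
  shows "c * emeasure lborel S \<le> ennreal D * emeasure (hyperplane_measure \<nu>) (orth_proj \<nu> ` S)"
proof -
  have [measurable]: "S \<in> sets borel" "orth_proj \<nu> ` S \<in> sets borel"
    using S compact_orth_proj[OF S] by (auto simp: compact_imp_closed)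
  have "c * emeasure lborel S = c * (\<integral>\<^sup>+x. indicator S x \<partial>lborel)" by simp
  also have "\<dots> = slice_integral \<nu> (indicator S)"
    using c \<nu> unfolding slicing_constant_def by (metis borel_measurable_indicator \<open>S \<in> sets borel\<close>)
  also have "\<dots> \<le> (\<integral>\<^sup>+z. ennreal D * indicator (orth_proj \<nu> ` S) z \<partial>hyperplane_measure \<nu>)"
    unfolding slice_integral_def
  proof (rule nn_integral_mono_AE)
    show "AE z in hyperplane_measure \<nu>. (\<integral>\<^sup>+s. indicator S (z + s *\<^sub>R \<nu>) \<partial>lborel)
        \<le> ennreal D * indicator (orth_proj \<nu> ` S) z"
      using AE_hyperplane_measure
    proof eventually_elim
      case (elim z)
      let ?F = "{s. z + s *\<^sub>R \<nu> \<in> S}"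
      have F: "?F \<in> sets borel" by measurable
      have "(\<integral>\<^sup>+s. indicator S (z + s *\<^sub>R \<nu>) \<partial>lborel) = (\<integral>\<^sup>+s. indicator ?F s \<partial>lborel)"
        by (intro nn_integral_cong) (auto simp: indicator_def)
      also have "\<dots> = emeasure lborel ?F" using F by simp
      also have "\<dots> \<le> ennreal D * indicator (orth_proj \<nu> ` S) z"
      proof (cases "?F = {}")
        case False
        then obtain s where s: "z + s *\<^sub>R \<nu> \<in> S" by auto
        have "orth_proj \<nu> (z + s *\<^sub>R \<nu>) = z" using elim \<nu> by (simp add: orth_proj_def inner_add_left norm_eq_1)
        then have "z \<in> orth_proj \<nu> ` S" using s by (metis imageI)
        then show ?thesis using emeasure_real_set_diameter_le[OF F] D by simp
      qed simp
      finally show ?case .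
    qed
  qed
  also have "\<dots> = ennreal D * emeasure (hyperplane_measure \<nu>) (orth_proj \<nu> ` S)"
    by (simp add: nn_integral_cmult)
  finally show ?thesis .
qed

definition flux_density :: "(real^'n) set \<Rightarrow> real^'n \<Rightarrow> real^'n \<Rightarrow> real" where
  "flux_density \<Omega> e x = \<bar>exterior_normal \<Omega> x \<bullet> e\<bar> * gaussian_density x"

text \<open>
  The Gaussian mass swept out by \<open>A\<close> in time \<open>1 / (m + 1)\<close> against the direction \<open>e\<close>, scaled
  by \<open>c (m + 1)\<close>, has an upper limit of at most the flux through \<open>A\<close>. The error \<open>\<epsilon>\<close> is
  charged per unit of area, so that pieces with small errors can be put together, and \<open>\<kappa>\<close>
  expresses the upper limit.
\<close>
definition flux_bound :: "(real^'n) set \<Rightarrow> ennreal \<Rightarrow> real^'n \<Rightarrow> real \<Rightarrow> (real^'n) set \<Rightarrow> bool" where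
  "flux_bound \<Omega> c e \<epsilon> A \<longleftrightarrow> (\<forall>\<kappa>>0. \<forall>\<^sub>F m in sequentially.
     of_nat (Suc m) * (c * gauss_mass lborel (sweep A (1 / real (Suc m)) e))
     \<le> (\<integral>\<^sup>+x\<in>A. ennreal (flux_density \<Omega> e x + \<epsilon>) \<partial>surface_measure) + ennreal \<kappa>)"

text \<open>
  Near \<open>x0\<close> the boundary is almost orthogonal to \<open>\<nu> = N x0\<close>: by \<open>frontier_nearly_flat\<close>, two
  points on a line parallel to \<open>\<nu>\<close> that are swept in time \<open>h\<close> have a distance of at most
  about \<open>h \<bar>\<nu> \<bullet> e\<bar>\<close>. So the volume is at most this length times the area of the projection
  along \<open>\<nu>\<close> of the swept set, up to the factor \<open>c\<close>. As \<open>h\<close> tends to zero the latter area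
  tends to that of the projection of \<open>A\<close>, which is at most the area of \<open>A\<close>. Projecting along
  \<open>\<nu>\<close> and not along \<open>e\<close> treats directions \<open>e\<close> that are tangent to the boundary in the same
  way as all others.
\<close>
lemma local_flux_bound:
  fixes \<Omega> :: "(real^'n) set"
  assumes smooth: "smooth_boundary \<Omega>" and c: "slicing_constant TYPE('n) c"
    and e: "norm e = 1" and x0: "x0 \<in> frontier \<Omega>" and \<epsilon>: "\<epsilon> > 0"
  obtains r where "r > 0" "\<And>A. compact A \<Longrightarrow> A \<subseteq> frontier \<Omega> \<inter> ball x0 r \<Longrightarrow> flux_bound \<Omega> c e \<epsilon> A"
proof -
  define \<nu> where "\<nu> = exterior_normal \<Omega> x0"
  have \<nu>: "norm \<nu> = 1" unfolding \<nu>_def by (rule norm_exterior_normal[OF smooth x0])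
  define a where "a = gaussian_density x0"
  define b where "b = \<bar>\<nu> \<bullet> e\<bar>"
  have ab: "a > 0" "b \<ge> 0" by (auto simp: a_def b_def gaussian_density_pos)
  obtain \<eta> where \<eta>: "0 < \<eta>" "\<eta> < 1" "(a + \<eta>) * (b + \<eta>) / (1 - \<eta>) < a * b + \<epsilon> / 2"
  proof -
    have "((\<lambda>\<eta>. (a + \<eta>) * (b + \<eta>) / (1 - \<eta>)) \<longlongrightarrow> (a + 0) * (b + 0) / (1 - 0)) (at_right 0)"
      by (intro tendsto_intros) auto
    then have "\<forall>\<^sub>F \<eta> in at_right 0. (a + \<eta>) * (b + \<eta>) / (1 - \<eta>) < a * b + \<epsilon> / 2"
      using \<epsilon> by (intro order_tendstoD) auto
    moreover have "\<forall>\<^sub>F \<eta> in at_right 0. \<eta> < (1::real)" by (intro order_tendstoD tendsto_intros) auto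
    moreover have "\<forall>\<^sub>F \<eta> in at_right 0. 0 < (\<eta>::real)" by (simp add: eventually_at_right_less)
    ultimately have "\<forall>\<^sub>F \<eta> in at_right 0. 0 < \<eta> \<and> \<eta> < 1 \<and> (a + \<eta>) * (b + \<eta>) / (1 - \<eta>) < a * b + \<epsilon> / 2"
      by eventually_elim auto
    then show thesis using that eventually_happens by (metis (no_types, lifting) trivial_limit_at_right_real)
  qed
  obtain r1 where r1: "r1 > 0"
    and flat: "\<And>y z. y \<in> frontier \<Omega> \<inter> ball x0 r1 \<Longrightarrow> z \<in> frontier \<Omega> \<inter> ball x0 r1 \<Longrightarrow>
      \<bar>(y - z) \<bullet> \<nu>\<bar> \<le> \<eta> * norm (y - z)"
    using frontier_nearly_flat[OF smooth x0 \<eta>(1)] unfolding \<nu>_def by metis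
  obtain r2 where r2: "r2 > 0" and G: "\<And>y. dist y x0 < r2 \<Longrightarrow> gaussian_density y < a + \<eta>"
  proof -
    have "continuous_on UNIV gaussian_density" by (intro continuous_intros)
    then obtain d where "d > 0" "\<And>y. dist y x0 < d \<Longrightarrow> dist (gaussian_density y) (gaussian_density x0) < \<eta>"
      using \<eta>(1) unfolding continuous_on_iff by (metis UNIV_I)
    then show thesis using that[of d] by (force simp: a_def dist_real_def)
  qed
  obtain r3 where r3: "r3 > 0"
    and \<phi>: "\<And>y. y \<in> frontier \<Omega> \<Longrightarrow> dist y x0 < r3 \<Longrightarrow> a * b - \<epsilon> / 2 < flux_density \<Omega> e y"
  proof -
    have "continuous_on (frontier \<Omega>) (flux_density \<Omega> e)"
      unfolding flux_density_def by (intro continuous_intros continuous_on_exterior_normal[OF smooth])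
    then obtain d where "d > 0" and d: "\<And>y. y \<in> frontier \<Omega> \<Longrightarrow> dist y x0 < d \<Longrightarrow> dist (flux_density \<Omega> e y) (flux_density \<Omega> e x0) < \<epsilon> / 2"
      using \<epsilon> x0 unfolding continuous_on_iff by (metis half_gt_zero)
    have "flux_density \<Omega> e x0 = a * b" by (simp add: flux_density_def a_def b_def \<nu>_def)
    show thesis
    proof (rule that[OF \<open>d > 0\<close>])
      fix y assume "y \<in> frontier \<Omega>" "dist y x0 < d"
      from d[OF this] \<open>flux_density \<Omega> e x0 = a * b\<close> show "a * b - \<epsilon> / 2 < flux_density \<Omega> e y"
        by (simp add: dist_real_def abs_real_def split: if_splits)
    qed
  qed
  define r where "r = min r1 (min (r2 / 2) r3)"
  have r: "r > 0" "r \<le> r1" "2 * r \<le> r2" "r \<le> r3" using r1 r2 r3 by (auto simp: r_def)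
  define q where "q = (a + \<eta>) * (b + \<eta>) / (1 - \<eta>)"
  have q: "q \<ge> 0" "q < a * b + \<epsilon> / 2" using \<eta> ab by (auto simp: q_def)
  have "flux_bound \<Omega> c e \<epsilon> A" if A: "compact A" and Ar: "A \<subseteq> frontier \<Omega> \<inter> ball x0 r" for A
    unfolding flux_bound_def
  proof (intro allI impI)
    fix \<kappa> :: real assume \<kappa>: "\<kappa> > 0"
    let ?H = "hyperplane_measure \<nu>"
    let ?S = "\<lambda>m. sweep A (1 / real (Suc m)) e"
    have Am [measurable]: "A \<in> sets borel" using A by (simp add: compact_imp_closed)
    have Sm [measurable]: "?S m \<in> sets borel" for m using A by (rule borel_sweep)
    have step: "of_nat (Suc m) * (c * gauss_mass lborel (?S m))
        \<le> ennreal q * emeasure ?H (orth_proj \<nu> ` ?S m)" if m: "1 / real (Suc m) < r" for m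
    proof -
      define h where "h = 1 / real (Suc m)"
      have h: "h > 0" "h < r" "real (Suc m) * h = 1" using m by (auto simp: h_def)
      have "gauss_mass lborel (?S m) \<le> (\<integral>\<^sup>+x\<in>?S m. ennreal (a + \<eta>) \<partial>lborel)"
      proof (rule nn_integral_mono)
        fix x
        have "gaussian_density x \<le> a + \<eta>" if xS: "x \<in> ?S m"
        proof -
          obtain t where t: "0 \<le> t" "t \<le> h" "x + t *\<^sub>R e \<in> A"
            using xS unfolding sweep_def h_def by auto
          then have "dist x0 (x + t *\<^sub>R e) < r" using Ar by auto
          moreover have "dist x (x + t *\<^sub>R e) < r" using t e h by (simp add: dist_norm)
          ultimately have "dist x x0 < r2" using r dist_triangle2[of x x0 "x + t *\<^sub>R e"] by linarith
          then show ?thesis using G by (simp add: less_imp_le)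
        qed
        then show "ennreal (gaussian_density x) * indicator (?S m) x \<le> ennreal (a + \<eta>) * indicator (?S m) x"
          by (auto simp: indicator_def intro: ennreal_leI)
      qed
      also have "\<dots> = ennreal (a + \<eta>) * emeasure lborel (?S m)"
        by (rule nn_integral_cmult_indicator) (use Sm in simp)
      finally have 1: "c * gauss_mass lborel (?S m) \<le> ennreal (a + \<eta>) * (c * emeasure lborel (?S m))"
        by (subst mult.left_commute) (rule mult_left_mono, simp_all)
      define D where "D = h * (b + \<eta>) / (1 - \<eta>)"
      have D: "D \<ge> 0" using h ab \<eta> by (auto simp: D_def)
      have "c * emeasure lborel (?S m) \<le> ennreal D * emeasure ?H (orth_proj \<nu> ` ?S m)"
      proof (rule slab_volume_le[OF c \<nu> compact_sweep[OF A]])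
        fix z s s' assume "z + s *\<^sub>R \<nu> \<in> ?S m" "z + s' *\<^sub>R \<nu> \<in> ?S m"
        then obtain t t' where t: "0 \<le> t" "t \<le> h" "z + s *\<^sub>R \<nu> + t *\<^sub>R e \<in> A"
          and t': "0 \<le> t'" "t' \<le> h" "z + s' *\<^sub>R \<nu> + t' *\<^sub>R e \<in> A"
          unfolding sweep_def h_def by auto
        \<comment> \<open>w is the difference of two boundary points; near-flatness bounds its component along \<nu>,
          which is s - s' up to the effect of the different sweeping times.\<close>
        define w where "w = (z + s *\<^sub>R \<nu> + t *\<^sub>R e) - (z + s' *\<^sub>R \<nu> + t' *\<^sub>R e)"
        have w: "w = (s - s') *\<^sub>R \<nu> + (t - t') *\<^sub>R e" by (simp add: w_def algebra_simps)
        have "\<bar>w \<bullet> \<nu>\<bar> \<le> \<eta> * norm w"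
          unfolding w_def using t(3) t'(3) Ar r by (intro flat) auto
        moreover have "norm w \<le> \<bar>s - s'\<bar> + h"
        proof -
          have "norm w \<le> norm ((s - s') *\<^sub>R \<nu>) + norm ((t - t') *\<^sub>R e)" unfolding w by (rule norm_triangle_ineq)
          then show ?thesis using \<nu> e t t' by simp
        qed
        moreover have "w \<bullet> \<nu> = (s - s') + (t - t') * (\<nu> \<bullet> e)"
          using \<nu> inner_commute[of \<nu> e] by (simp add: w inner_add_left norm_eq_1)
        moreover have "\<bar>(t - t') * (\<nu> \<bullet> e)\<bar> \<le> h * b"
          unfolding abs_mult b_def using t t' by (intro mult_right_mono) auto
        ultimately have "\<bar>s - s'\<bar> \<le> \<eta> * (\<bar>s - s'\<bar> + h) + h * b"
          using mult_left_mono[of "norm w" "\<bar>s - s'\<bar> + h" \<eta>] \<eta> by linarith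
        then have "\<bar>s - s'\<bar> * (1 - \<eta>) \<le> h * (b + \<eta>)" by (simp add: algebra_simps)
        then show "\<bar>s - s'\<bar> \<le> D" using \<eta> by (simp add: D_def pos_le_divide_eq)
      qed
      then have "ennreal (a + \<eta>) * (c * emeasure lborel (?S m)) \<le> ennreal (a + \<eta>) * (ennreal D * emeasure ?H (orth_proj \<nu> ` ?S m))"
        by (rule mult_left_mono) simp
      with 1 have "c * gauss_mass lborel (?S m)
          \<le> ennreal (a + \<eta>) * (ennreal D * emeasure ?H (orth_proj \<nu> ` ?S m))" by (rule order_trans)
      then have "of_nat (Suc m) * (c * gauss_mass lborel (?S m))
          \<le> of_nat (Suc m) * (ennreal (a + \<eta>) * (ennreal D * emeasure ?H (orth_proj \<nu> ` ?S m)))"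
        by (rule mult_left_mono) simp
      also have "\<dots> = ennreal (real (Suc m) * ((a + \<eta>) * D)) * emeasure ?H (orth_proj \<nu> ` ?S m)"
        using ab \<eta> D by (simp add: ennreal_mult'' ennreal_of_nat_eq_real_of_nat mult.assoc del: of_nat_Suc)
      also have "real (Suc m) * ((a + \<eta>) * D) = (real (Suc m) * h) * q"
        by (simp add: D_def q_def)
      also have "(real (Suc m) * h) * q = q" by (simp only: h(3) mult_1)
      finally show ?thesis .
    qed
    have "ennreal q * emeasure ?H (orth_proj \<nu> ` A) \<le> (\<integral>\<^sup>+x\<in>A. ennreal (flux_density \<Omega> e x + \<epsilon>) \<partial>surface_measure)"
    proof -
      have "ennreal q * emeasure ?H (orth_proj \<nu> ` A) \<le> ennreal q * emeasure surface_measure A"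
        by (intro mult_left_mono hyperplane_measure_orth_proj_le \<nu> A) simp
      also have "\<dots> = (\<integral>\<^sup>+x\<in>A. ennreal q \<partial>surface_measure)" by (rule nn_integral_cmult_indicator[symmetric]) simp
      also have "\<dots> \<le> (\<integral>\<^sup>+x\<in>A. ennreal (flux_density \<Omega> e x + \<epsilon>) \<partial>surface_measure)"
      proof (rule nn_integral_mono)
        fix x
        have "q \<le> flux_density \<Omega> e x + \<epsilon>" if "x \<in> A"
          using \<phi>[of x] that Ar r q by (force simp: dist_commute)
        then show "ennreal q * indicator A x \<le> ennreal (flux_density \<Omega> e x + \<epsilon>) * indicator A x"
          by (auto simp: indicator_def intro: ennreal_leI)
      qed
      finally show ?thesis .
    qed
    moreover have "ennreal q * emeasure ?H (orth_proj \<nu> ` A) < top"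
      using hyperplane_measure_compact_finite[OF \<nu> compact_orth_proj[OF A]] by (simp add: ennreal_mult_less_top)
    ultimately have lt: "ennreal q * emeasure ?H (orth_proj \<nu> ` A)
        < (\<integral>\<^sup>+x\<in>A. ennreal (flux_density \<Omega> e x + \<epsilon>) \<partial>surface_measure) + ennreal \<kappa>"
      using \<kappa> by (rule ennreal_less_add_pos)
    have "(\<lambda>m. ennreal q * emeasure ?H (orth_proj \<nu> ` ?S m)) \<longlonglongrightarrow> ennreal q * emeasure ?H (orth_proj \<nu> ` A)"
      by (intro ennreal_tendsto_cmult orth_proj_sweep_LIMSEQ \<nu> e A) simp
    then have "\<forall>\<^sub>F m in sequentially. ennreal q * emeasure ?H (orth_proj \<nu> ` ?S m)
        < (\<integral>\<^sup>+x\<in>A. ennreal (flux_density \<Omega> e x + \<epsilon>) \<partial>surface_measure) + ennreal \<kappa>"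
      using lt by (rule order_tendstoD(2))
    moreover have "\<forall>\<^sub>F m in sequentially. 1 / real (Suc m) < r"
      using order_tendstoD(2)[OF LIMSEQ_inverse_real_of_nat r(1)] by (simp add: inverse_eq_divide)
    ultimately show "\<forall>\<^sub>F m in sequentially. of_nat (Suc m) * (c * gauss_mass lborel (?S m))
     \<le> (\<integral>\<^sup>+x\<in>A. ennreal (flux_density \<Omega> e x + \<epsilon>) \<partial>surface_measure) + ennreal \<kappa>"
    proof eventually_elim
      case (elim m)
      show ?case by (rule order_trans[OF step[OF elim(2)] less_imp_le[OF elim(1)]])
    qed
  qed
  then show thesis by (rule that[OF r(1)])
qed

lemma flux_measurable:
  assumes smooth: "smooth_boundary \<Omega>" and S: "S \<in> sets borel" "S \<subseteq> frontier \<Omega>"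
  shows "(\<lambda>x. ennreal (flux_density \<Omega> e x + \<epsilon>) * indicator S x) \<in> borel_measurable borel"
proof -
  have "continuous_on S (\<lambda>x. flux_density \<Omega> e x + \<epsilon>)"
    unfolding flux_density_def
    by (intro continuous_intros continuous_on_subset[OF continuous_on_exterior_normal[OF smooth] S(2)])
  then have "(\<lambda>x. indicator S x *\<^sub>R (flux_density \<Omega> e x + \<epsilon>)) \<in> borel_measurable borel"
    by (rule borel_measurable_continuous_on_indicator[OF S(1)])
  then have "(\<lambda>x. ennreal (indicator S x *\<^sub>R (flux_density \<Omega> e x + \<epsilon>))) \<in> borel_measurable borel"
    by measurable
  moreover have "(\<lambda>x. ennreal (indicator S x *\<^sub>R (flux_density \<Omega> e x + \<epsilon>)))
      = (\<lambda>x. ennreal (flux_density \<Omega> e x + \<epsilon>) * indicator S x)"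
    by (auto simp: fun_eq_iff indicator_def)
  ultimately show ?thesis by simp
qed

text \<open>
  The swept mass is subadditive and the flux is additive, as the common part of the two
  pieces is a null set.
\<close>
lemma flux_bound_Un:
  assumes smooth: "smooth_boundary \<Omega>"
    and A: "compact A1" "compact A2" "A1 \<subseteq> frontier \<Omega>" "A2 \<subseteq> frontier \<Omega>"
    and null: "emeasure surface_measure (A1 \<inter> A2) = 0"
    and fb: "flux_bound \<Omega> c e \<epsilon> A1" "flux_bound \<Omega> c e \<epsilon> A2"
  shows "flux_bound \<Omega> c e \<epsilon> (A1 \<union> A2)"
  unfolding flux_bound_def
proof (intro allI impI)
  fix \<kappa> :: real assume \<kappa>: "\<kappa> > 0"
  let ?S = "\<lambda>A m. sweep A (1 / real (Suc m)) e"
  let ?g = "\<lambda>x. ennreal (gaussian_density x)" and ?f = "\<lambda>x. ennreal (flux_density \<Omega> e x + \<epsilon>)"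
  let ?I = "\<lambda>A m. (\<integral>\<^sup>+x\<in>?S A m. ?g x \<partial>lborel)"
  let ?J = "\<lambda>A. (\<integral>\<^sup>+x\<in>A. ?f x \<partial>surface_measure)"
  have b: "A1 \<in> sets borel" "A2 \<in> sets borel" using A by (auto simp: compact_imp_closed)
  have S [measurable]: "?S A1 m \<in> sets borel" "?S A2 m \<in> sets borel" for m using A by (auto intro: borel_sweep)
  have I: "?I (A1 \<union> A2) m \<le> ?I A1 m + ?I A2 m" for m
  proof -
    have "?I (A1 \<union> A2) m \<le> (\<integral>\<^sup>+x. ?g x * indicator (?S A1 m) x + ?g x * indicator (?S A2 m) x \<partial>lborel)"
      by (intro nn_integral_mono) (auto simp: indicator_def sweep_def)
    also have "\<dots> = ?I A1 m + ?I A2 m" by (rule nn_integral_add) measurable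
    finally show ?thesis .
  qed
  have J: "?J A1 + ?J A2 = ?J (A1 \<union> A2)"
  proof -
    have m: "(\<lambda>x. ?f x * indicator A1 x) \<in> borel_measurable surface_measure"
      "(\<lambda>x. ?f x * indicator A2 x) \<in> borel_measurable surface_measure"
      using flux_measurable[OF smooth b(1) A(3)] flux_measurable[OF smooth b(2) A(4)]
      by (simp_all cong: measurable_cong_sets)
    have "?J A1 + ?J A2 = (\<integral>\<^sup>+x. ?f x * indicator A1 x + ?f x * indicator A2 x \<partial>surface_measure)"
      by (rule nn_integral_add[symmetric]) (rule m)+
    also have "\<dots> = ?J (A1 \<union> A2)"
    proof (rule nn_integral_cong_AE)
      have "A1 \<inter> A2 \<in> null_sets surface_measure" using null b by (auto simp: null_sets_def)
      from AE_not_in[OF this]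
      show "AE x in surface_measure. ?f x * indicator A1 x + ?f x * indicator A2 x = ?f x * indicator (A1 \<union> A2) x"
        by eventually_elim (auto simp: indicator_def)
    qed
    finally show ?thesis .
  qed
  have "\<kappa> / 2 > 0" using \<kappa> by simp
  with fb have
    "\<forall>\<^sub>F m in sequentially. of_nat (Suc m) * (c * ?I A1 m) \<le> ?J A1 + ennreal (\<kappa> / 2)"
    "\<forall>\<^sub>F m in sequentially. of_nat (Suc m) * (c * ?I A2 m) \<le> ?J A2 + ennreal (\<kappa> / 2)"
    unfolding flux_bound_def by blast+
  then show "\<forall>\<^sub>F m in sequentially. of_nat (Suc m) * (c * ?I (A1 \<union> A2) m) \<le> ?J (A1 \<union> A2) + ennreal \<kappa>"
  proof eventually_elim
    case (elim m)
    have "of_nat (Suc m) * (c * ?I (A1 \<union> A2) m) \<le> of_nat (Suc m) * (c * (?I A1 m + ?I A2 m))"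
      by (intro mult_left_mono I) simp_all
    also have "\<dots> = of_nat (Suc m) * (c * ?I A1 m) + of_nat (Suc m) * (c * ?I A2 m)"
      by (simp only: distrib_left)
    also have "\<dots> \<le> (?J A1 + ennreal (\<kappa> / 2)) + (?J A2 + ennreal (\<kappa> / 2))"
      by (intro add_mono elim)
    also have "\<dots> = ?J (A1 \<union> A2) + (ennreal (\<kappa> / 2) + ennreal (\<kappa> / 2))"
      unfolding J[symmetric] by (simp only: ac_simps)
    also have "ennreal (\<kappa> / 2) + ennreal (\<kappa> / 2) = ennreal \<kappa>"
      using \<kappa> by (subst ennreal_plus[symmetric]) auto
    finally show ?case .
  qed
qed

text \<open>
  The spheres around \<open>x\<close> are disjoint, so at most countably many of them can meet \<open>A\<close> in
  positive measure.
\<close>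
lemma null_sphere_exists:
  fixes A :: "(real^'n) set"
  assumes [measurable]: "A \<in> sets borel" and fin: "emeasure surface_measure A < top" and r: "r > 0"
  obtains \<rho> where "0 < \<rho>" "\<rho> < r" "emeasure surface_measure (A \<inter> sphere x \<rho>) = 0"
proof -
  define \<mu> where "\<mu> = distr (density surface_measure (indicator A)) borel (dist x)"
  have em: "emeasure \<mu> X = emeasure surface_measure (A \<inter> (dist x -` X))" if [measurable]: "X \<in> sets borel" for X
  proof -
    have [measurable]: "dist x -` X \<in> sets borel"
      using measurable_sets[of "dist x" borel borel X] by simp
    have "emeasure \<mu> X = emeasure (density surface_measure (indicator A)) (dist x -` X)"
      unfolding \<mu>_def by (subst emeasure_distr) auto
    also have "\<dots> = emeasure surface_measure (A \<inter> (dist x -` X))"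
      by (subst emeasure_density) (auto simp flip: indicator_inter_arith)
    finally show ?thesis .
  qed
  interpret finite_measure \<mu>
  proof
    show "emeasure \<mu> (space \<mu>) \<noteq> \<infinity>" using em[of UNIV] fin by (simp add: \<mu>_def)
  qed
  have "uncountable ({0<..<r} - {t. measure \<mu> {t} \<noteq> 0})"
    using countable_support r by (intro uncountable_minus_countable) (simp_all add: uncountable_open_interval)
  then have "{0<..<r} - {t. measure \<mu> {t} \<noteq> 0} \<noteq> {}" by (metis countable_empty)
  then obtain \<rho> where \<rho>: "0 < \<rho>" "\<rho> < r" "measure \<mu> {\<rho>} = 0" by auto
  have "dist x -` {\<rho>} = sphere x \<rho>" by auto
  then have "emeasure surface_measure (A \<inter> sphere x \<rho>) = 0"
    using em[of "{\<rho>}"] \<rho>(3) by (simp add: emeasure_eq_measure)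
  then show thesis using that \<rho> by blast
qed

text \<open>
  By compactness finitely many balls on which the local bound holds cover \<open>A\<close>. Cutting \<open>A\<close>
  successively into its parts inside and outside these balls produces compact pieces; the
  radii are chosen such that the pieces overlap only in null sets.
\<close>
lemma global_flux_bound:
  fixes \<Omega> :: "(real^'n) set"
  assumes smooth: "smooth_boundary \<Omega>" and c: "slicing_constant TYPE('n) c"
    and e: "norm e = 1" and \<epsilon>: "\<epsilon> > 0"
    and A: "compact A" "A \<subseteq> frontier \<Omega>" and fin: "emeasure surface_measure A < top"
  shows "flux_bound \<Omega> c e \<epsilon> A"
proof -
  have bA: "A \<in> sets borel" using A by (simp add: compact_imp_closed)
  have "\<exists>\<rho>>0. emeasure surface_measure (A \<inter> sphere x \<rho>) = 0 \<and>
      (\<forall>X. compact X \<longrightarrow> X \<subseteq> frontier \<Omega> \<inter> cball x \<rho> \<longrightarrow> flux_bound \<Omega> c e \<epsilon> X)" if x: "x \<in> A" for x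
  proof -
    have xf: "x \<in> frontier \<Omega>" using x A by auto
    obtain r where r: "r > 0" "\<And>X. compact X \<Longrightarrow> X \<subseteq> frontier \<Omega> \<inter> ball x r \<Longrightarrow> flux_bound \<Omega> c e \<epsilon> X"
      using local_flux_bound[OF smooth c e xf \<epsilon>] by metis
    obtain \<rho> where \<rho>: "0 < \<rho>" "\<rho> < r" "emeasure surface_measure (A \<inter> sphere x \<rho>) = 0"
      using null_sphere_exists[OF bA fin r(1)] by metis
    have "cball x \<rho> \<subseteq> ball x r" using \<rho>(2) by auto
    then show ?thesis using r(2) \<rho> by (meson Int_mono order_refl order_trans)
  qed
  then obtain \<rho> where \<rho>: "\<And>x. x \<in> A \<Longrightarrow> \<rho> x > 0"
    "\<And>x. x \<in> A \<Longrightarrow> emeasure surface_measure (A \<inter> sphere x (\<rho> x)) = 0"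
    "\<And>x X. x \<in> A \<Longrightarrow> compact X \<Longrightarrow> X \<subseteq> frontier \<Omega> \<inter> cball x (\<rho> x) \<Longrightarrow> flux_bound \<Omega> c e \<epsilon> X"
    by metis
  have "A \<subseteq> (\<Union>x\<in>A. ball x (\<rho> x))" using \<rho>(1) by fastforce
  then obtain F where F: "F \<subseteq> A" "finite F" "A \<subseteq> (\<Union>x\<in>F. ball x (\<rho> x))"
    using compactE_image[OF A(1), of A "\<lambda>x. ball x (\<rho> x)"] by auto
  have "flux_bound \<Omega> c e \<epsilon> X" if "compact X" "X \<subseteq> A" "X \<subseteq> (\<Union>x\<in>F. ball x (\<rho> x))" for X
    using F(2,1) that
  proof (induction F arbitrary: X rule: finite_induct)
    case empty
    then show ?case by (auto simp: flux_bound_def sweep_def)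
  next
    case (insert x F)
    let ?X1 = "X \<inter> cball x (\<rho> x)" and ?X2 = "X - ball x (\<rho> x)"
    have x: "x \<in> A" using insert by auto
    have cX: "compact ?X1" "compact ?X2"
      using insert.prems by (auto intro: compact_Int_closed compact_diff)
    have fr: "?X1 \<subseteq> frontier \<Omega>" "?X2 \<subseteq> frontier \<Omega>" using insert.prems A by auto
    have "?X1 \<inter> ?X2 \<subseteq> A \<inter> sphere x (\<rho> x)" using insert.prems by (auto simp: dist_commute)
    then have "emeasure surface_measure (?X1 \<inter> ?X2) \<le> emeasure surface_measure (A \<inter> sphere x (\<rho> x))"
      using bA by (intro emeasure_mono) (auto simp: borel_closed)
    then have null: "emeasure surface_measure (?X1 \<inter> ?X2) = 0" using \<rho>(2)[OF x] by simp
    have 1: "flux_bound \<Omega> c e \<epsilon> ?X1" using fr by (intro \<rho>(3)[OF x] cX) auto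
    have 2: "flux_bound \<Omega> c e \<epsilon> ?X2"
      using insert.prems by (intro insert.IH cX) auto
    have "X = ?X1 \<union> ?X2" by auto
    then show ?case using flux_bound_Un[OF smooth cX fr null 1 2] by simp
  qed
  then show ?thesis using A F by blast
qed

section \<open>Crossings of an antiperiodic set\<close>

lemma AE_lborel_shift:
  fixes P :: "real \<Rightarrow> bool"
  assumes "AE s in lborel. P s"
  shows "AE s in lborel. P (s + a)"
proof -
  have "AE s in distr lborel borel ((+) a). P s" using assms by (subst lborel_distr_plus)
  then have "AE s in lborel. P (a + s)" by (rule AE_distrD[rotated]) simp
  then show ?thesis by (simp add: add.commute)
qed

text \<open>
  Divide the line into steps of length \<open>h = 1 / m\<close>. Starting from almost every \<open>s\<close>,
  membership in \<open>T\<close> changes over a unit of length, so it changes over one of the \<open>m\<close> steps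
  in it, and by antiperiodicity also over all translates of this step by integers. The left
  ends of these steps belong to \<open>V\<close> and contribute a sum of Gaussians over a coset of the
  integers. Integrating over \<open>s\<close> in \<open>[0, h)\<close> gives the claim.
\<close>
lemma antiperiodic_crossings:
  fixes T V :: "real set" and K m :: nat
  assumes [measurable]: "V \<in> sets borel" and m: "m > 0"
    and anti: "AE s in lborel. (s \<in> T) \<noteq> (s + 1 \<in> T)"
    and V: "\<And>s. - real K \<le> s \<Longrightarrow> s < real K \<Longrightarrow> (s \<in> T) \<noteq> (s + 1 / real m \<in> T) \<Longrightarrow> s \<in> V"
    and \<theta>: "\<And>s. s \<in> {0..1} \<Longrightarrow> \<theta> \<le> gauss_sum 1 K s"
  shows "ennreal (\<theta> / real m) \<le> (\<integral>\<^sup>+s\<in>V. ennreal (exp (- s\<^sup>2 / 2)) \<partial>lborel)"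
proof -
  define h where "h = 1 / real m"
  have h: "h > 0" "real m * h = 1" using m by (auto simp: h_def)
  define w where "w s = exp (- s\<^sup>2 / 2)" for s :: real
  have [measurable]: "w \<in> borel_measurable borel" unfolding w_def by measurable
  define J where "J = {- int (m * K)..<int (m * K)}"
  define C where "C k = {of_int k * h..<of_int k * h + h}" for k :: int
  have C_le: "(\<Sum>k\<in>J. indicator (C k) s :: ennreal) \<le> 1" for s
  proof -
    have "indicator (C k) s = (if k = \<lfloor>s * real m\<rfloor> then 1 else 0 :: ennreal)" for k
    proof -
      have "s \<in> C k \<longleftrightarrow> of_int k \<le> s * real m \<and> s * real m < of_int k + 1"
        using m by (simp add: C_def h_def field_simps)
      also have "\<dots> \<longleftrightarrow> k = \<lfloor>s * real m\<rfloor>" by linarith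
      finally show ?thesis by (simp add: indicator_def)
    qed
    then show ?thesis by (simp add: J_def)
  qed
  have "AE s in lborel. \<forall>k::int. (s + of_int k * h \<in> T) \<noteq> (s + of_int k * h + 1 \<in> T)"
    unfolding AE_all_countable using AE_lborel_shift[OF anti] by simp
  then have ae: "AE s in lborel. ennreal \<theta> * indicator {0..<h} s
      \<le> (\<Sum>k\<in>J. indicator {0..<h} s * (indicator V (s + of_int k * h) * ennreal (w (s + of_int k * h))))"
  proof eventually_elim
    case (elim s)
    show ?case
    proof (cases "s \<in> {0..<h}")
      case True
      define D where "D k \<longleftrightarrow> (s + of_int k * h \<in> T) \<noteq> (s + of_int (k + 1) * h \<in> T)" for k :: int
      have flip: "(s + of_int (k + int m) * h \<in> T) \<longleftrightarrow> s + of_int k * h \<notin> T" for k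
      proof -
        have "of_int (k + int m) * h = of_int k * h + 1" using h(2) by (simp add: distrib_right)
        then show ?thesis using elim[rule_format, of k] by (simp add: add.assoc)
      qed
      have Dm: "D (k + int m) \<longleftrightarrow> D k" for k
        using flip[of k] flip[of "k + 1"] unfolding D_def by (simp add: ac_simps)
      have Dml: "D (k + int m * l) \<longleftrightarrow> D k" for k l
      proof (induction l rule: int_induct[where k=0])
        case (step1 l)
        then show ?case using Dm[of "k + int m * l"] by (simp add: algebra_simps)
      next
        case (step2 l)
        then show ?case using Dm[of "k + int m * (l - 1)"] by (simp add: algebra_simps)
      qed simp
      obtain k0 :: nat where k0: "k0 < m" "D (int k0)"
      proof (rule ccontr)
        assume "\<not> thesis"
        then have nD: "\<not> D (int k)" if "k < m" for k using that \<open>\<And>k0. k0 < m \<Longrightarrow> D (int k0) \<Longrightarrow> thesis\<close> by blast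
        have "(s + of_int (int k) * h \<in> T) \<longleftrightarrow> s \<in> T" if "k \<le> m" for k
          using that
        proof (induction k)
          case (Suc k)
          then show ?case using nD[of k] unfolding D_def by (simp add: add.commute)
        qed simp
        from this[of m] flip[of 0] show False by simp
      qed
      have sk: "s + real k0 * h \<in> {0..1}"
      proof -
        have "(real k0 + 1) * h \<le> real m * h" using k0 h(1) by (intro mult_right_mono) auto
        then show ?thesis using True h k0 by (simp add: distrib_right)
      qed
      \<comment> \<open>The indices of the steps that are integral translates of the step with index k0.\<close>
      define g where "g l = int k0 + int m * l" for l :: int
      have g_inj: "inj_on g X" for X using m by (auto simp: g_def inj_on_def)
      have gJ: "g ` {- int K..<int K} \<subseteq> J"
      proof
        fix k assume "k \<in> g ` {- int K..<int K}"
        then obtain l where l: "- int K \<le> l" "l \<le> int K - 1" "k = int k0 + int m * l" by (auto simp: g_def)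
        have "int m * (- int K) \<le> int m * l" "int m * l \<le> int m * (int K - 1)"
          using l by (auto intro: mult_left_mono simp del: mult_minus_right)
        then show "k \<in> J" using l(3) k0(1) by (simp add: J_def algebra_simps)
      qed
      have eqg: "s + of_int (g l) * h = (s + real k0 * h) + of_int l" for l
        using h(2) by (simp add: g_def algebra_simps)
      have gV: "s + of_int (g l) * h \<in> V" if l: "l \<in> {- int K..<int K}" for l
      proof (rule V)
        have "real_of_int l \<le> real_of_int (int K - 1)" "real_of_int (- int K) \<le> real_of_int l"
          using l by (simp_all only: of_int_le_iff) auto
        then have "real_of_int l \<le> real K - 1" "- real K \<le> real_of_int l" by simp_all
        moreover have "s + real k0 * h < 1"
        proof -
          have "(real k0 + 1) * h \<le> real m * h" using k0 h(1) by (intro mult_right_mono) auto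
          then show ?thesis using True h(2) by (simp add: distrib_right)
        qed
        ultimately show "- real K \<le> s + of_int (g l) * h" "s + of_int (g l) * h < real K"
          unfolding eqg using sk by auto
        have "D (g l)" unfolding g_def Dml by (rule k0(2))
        then show "(s + of_int (g l) * h \<in> T) \<noteq> (s + of_int (g l) * h + 1 / real m \<in> T)"
          unfolding D_def h_def[symmetric] by (simp add: distrib_right add.assoc)
      qed
      have "ennreal \<theta> \<le> ennreal (gauss_sum 1 K (s + real k0 * h))" by (intro ennreal_leI \<theta> sk)
      also have "\<dots> = (\<Sum>l\<in>{- int K..<int K}. ennreal (w (s + of_int (g l) * h)))"
        unfolding eqg by (simp add: gauss_sum_def w_def sum_ennreal)
      also have "\<dots> = (\<Sum>l\<in>{- int K..<int K}. indicator V (s + of_int (g l) * h) * ennreal (w (s + of_int (g l) * h)))"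
        by (intro sum.cong) (auto simp: gV)
      also have "\<dots> = (\<Sum>k\<in>g ` {- int K..<int K}. indicator V (s + of_int k * h) * ennreal (w (s + of_int k * h)))"
        by (subst sum.reindex[OF g_inj]) simp
      also have "\<dots> \<le> (\<Sum>k\<in>J. indicator V (s + of_int k * h) * ennreal (w (s + of_int k * h)))"
        by (rule sum_mono2[OF _ gJ]) (auto simp: J_def)
      finally show ?thesis using True by simp
    qed simp
  qed
  have "ennreal (\<theta> / real m) = ennreal \<theta> * ennreal h"
    using h(1) by (simp add: h_def ennreal_mult''[symmetric])
  also have "\<dots> = (\<integral>\<^sup>+s. ennreal \<theta> * indicator {0..<h} s \<partial>lborel)"
    using h(1) by (subst nn_integral_cmult_indicator) auto
  also have "\<dots> \<le> (\<integral>\<^sup>+s. (\<Sum>k\<in>J. indicator {0..<h} s * (indicator V (s + of_int k * h) * ennreal (w (s + of_int k * h)))) \<partial>lborel)"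
    by (rule nn_integral_mono_AE[OF ae])
  also have "\<dots> = (\<Sum>k\<in>J. \<integral>\<^sup>+s. indicator {0..<h} s * (indicator V (s + of_int k * h) * ennreal (w (s + of_int k * h))) \<partial>lborel)"
    by (rule nn_integral_sum) measurable
  also have "\<dots> = (\<Sum>k\<in>J. \<integral>\<^sup>+s. indicator (C k) s * (indicator V s * ennreal (w s)) \<partial>lborel)"
  proof (rule sum.cong[OF refl])
    fix k
    have [measurable]: "C k \<in> sets borel" by (simp add: C_def)
    have "(\<integral>\<^sup>+s. indicator (C k) s * (indicator V s * ennreal (w s)) \<partial>lborel)
      = (\<integral>\<^sup>+s. indicator (C k) (of_int k * h + 1 * s) * (indicator V (of_int k * h + 1 * s) * ennreal (w (of_int k * h + 1 * s))) \<partial>lborel)"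
      by (subst nn_integral_real_affine[where c=1 and t="of_int k * h"]) auto
    also have "\<dots> = (\<integral>\<^sup>+s. indicator {0..<h} s * (indicator V (s + of_int k * h) * ennreal (w (s + of_int k * h))) \<partial>lborel)"
      by (intro nn_integral_cong) (auto simp: C_def indicator_def add.commute)
    finally show "(\<integral>\<^sup>+s. indicator {0..<h} s * (indicator V (s + of_int k * h) * ennreal (w (s + of_int k * h))) \<partial>lborel)
      = (\<integral>\<^sup>+s. indicator (C k) s * (indicator V s * ennreal (w s)) \<partial>lborel)" ..
  qed
  also have "\<dots> = (\<integral>\<^sup>+s. (\<Sum>k\<in>J. indicator (C k) s * (indicator V s * ennreal (w s))) \<partial>lborel)"
    by (rule nn_integral_sum[symmetric]) (simp add: C_def)
  also have "\<dots> \<le> (\<integral>\<^sup>+s\<in>V. ennreal (w s) \<partial>lborel)"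
  proof (rule nn_integral_mono)
    fix s
    have "(\<Sum>k\<in>J. indicator (C k) s * (indicator V s * ennreal (w s))) \<le> 1 * (indicator V s * ennreal (w s))"
      unfolding sum_distrib_right[symmetric] by (rule mult_right_mono[OF C_le]) simp
    then show "(\<Sum>k\<in>J. indicator (C k) s * (indicator V s * ennreal (w s))) \<le> ennreal (w s) * indicator V s"
      by (simp add: mult.commute)
  qed
  finally show ?thesis by (simp add: w_def)
qed

lemma closed_coordinate_box: "closed {x::real^'n. \<forall>j. \<bar>x $ j\<bar> \<le> a}"
  by (intro closed_Collect_all closed_Collect_le continuous_intros)

lemma bounded_coordinate_box: "bounded {x::real^'n. \<forall>j. \<bar>x $ j\<bar> \<le> a}"
proof -
  have "norm x \<le> real CARD('n) * a" if "\<forall>j. \<bar>x $ j\<bar> \<le> a" for x :: "real^'n"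
    using order_trans[OF norm_le_l1_cart sum_mono[of UNIV "\<lambda>j. \<bar>x $ j\<bar>" "\<lambda>_. a"]] that by simp
  then show ?thesis unfolding bounded_iff by blast
qed

text \<open>
  The Gaussian density is a product in every orthogonal system of coordinates.
\<close>
lemma gaussian_density_slice:
  assumes "norm e = 1" "z \<bullet> e = 0"
  shows "gaussian_density (z + s *\<^sub>R e) = gaussian_density z * exp (- s\<^sup>2 / 2)"
proof -
  have "(norm (z + s *\<^sub>R e))\<^sup>2 = (norm z)\<^sup>2 + s\<^sup>2"
    using assms unfolding power2_norm_eq_inner
    by (simp add: inner_add_left inner_add_right inner_commute norm_eq_1 power2_eq_square)
  then have "- (norm (z + s *\<^sub>R e))\<^sup>2 / 2 = - (norm z)\<^sup>2 / 2 + - s\<^sup>2 / 2" by simp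
  then have "exp (- (norm (z + s *\<^sub>R e))\<^sup>2 / 2) = exp (- (norm z)\<^sup>2 / 2) * exp (- s\<^sup>2 / 2)"
    by (simp only: exp_add)
  then show ?thesis
    unfolding gaussian_density_norm[of "z + s *\<^sub>R e"] gaussian_density_norm[of z] by simp
qed

text \<open>
  The exceptional null set of \<open>\<real>\<^sup>n\<close> meets almost every line in a null set, by slicing.
\<close>
lemma periodic_slices_antiperiodic:
  fixes \<Omega> :: "(real^'n) set" and i :: 'n
  assumes c: "slicing_constant TYPE('n) c" and per: "periodic_set \<Omega>"
  defines "e \<equiv> axis i 1"
  shows "AE z in hyperplane_measure e. AE s in lborel. (z + s *\<^sub>R e \<in> \<Omega>) \<noteq> (z + (s + 1) *\<^sub>R e \<in> \<Omega>)"
proof -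
  have e: "norm e = 1" by (simp add: e_def)
  have "sym_diff ((\<lambda>x. x + e) ` \<Omega>) (- \<Omega>) \<in> null_sets lebesgue"
    using per unfolding periodic_set_def e_def by blast
  then obtain N where N: "N \<in> null_sets lborel" "sym_diff ((\<lambda>x. x + e) ` \<Omega>) (- \<Omega>) \<subseteq> N"
    unfolding null_sets_completion_iff2 by (rule bexE)
  have [measurable]: "N \<in> sets borel" using N(1) by (auto simp: null_sets_def)
  have "(\<integral>\<^sup>+x. indicator N x \<partial>lborel) = 0" using N(1) by (simp add: null_sets_def)
  then have "slice_integral e (indicator N) = 0"
    using c e unfolding slicing_constant_def by simp
  then have "AE z in hyperplane_measure e. (\<integral>\<^sup>+s. indicator N (z + s *\<^sub>R e) \<partial>lborel) = 0"
    unfolding slice_integral_def by (subst (asm) nn_integral_0_iff_AE) auto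
  then show ?thesis
  proof eventually_elim
    case (elim z)
    then have "AE s in lborel. indicator N (z + s *\<^sub>R e) = (0::ennreal)"
      by (subst (asm) nn_integral_0_iff_AE) auto
    then have "AE s in lborel. z + s *\<^sub>R e \<notin> N"
      by eventually_elim (auto simp: indicator_def split: if_splits)
    then have "AE s in lborel. z + (s + 1) *\<^sub>R e \<notin> N" by (rule AE_lborel_shift)
    then show ?case
    proof eventually_elim
      case (elim s)
      have "z + (s + 1) *\<^sub>R e \<in> (\<lambda>x. x + e) ` \<Omega> \<longleftrightarrow> z + s *\<^sub>R e \<in> \<Omega>"
        by (auto simp: image_iff scaleR_add_left add.assoc[symmetric])
      then show ?case using elim N(2) by blast
    qed
  qed
qed

text \<open>
  If exactly one of \<open>x\<close> and \<open>x + h e\<close> lies in \<open>\<Omega>\<close>, the segment between them meets the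
  boundary, so \<open>x\<close> belongs to the swept set. Apply \<open>antiperiodic_crossings\<close> on almost every
  line parallel to \<open>e\<close>. The boxes keep the boundary piece compact; the larger one contains
  the segments that start over the smaller one.
\<close>
lemma swept_mass_lower_bound:
  fixes \<Omega> :: "(real^'n) set" and i :: 'n
  assumes c: "slicing_constant TYPE('n) c" and per: "periodic_set \<Omega>"
    and \<theta>: "0 \<le> \<theta>" "\<And>s. s \<in> {0..1} \<Longrightarrow> \<theta> \<le> gauss_sum 1 K s"
  defines "e \<equiv> axis i 1"
  defines "A \<equiv> frontier \<Omega> \<inter> {x. \<forall>j. \<bar>x $ j\<bar> \<le> real K + 1}"
  shows "ennreal \<theta> * gauss_mass (hyperplane_measure e) {z. \<forall>j. \<bar>z $ j\<bar> \<le> real K}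
    \<le> of_nat (Suc m) * (c * gauss_mass lborel (sweep A (1 / real (Suc m)) e))"
proof -
  let ?Q = "{z::real^'n. \<forall>j. \<bar>z $ j\<bar> \<le> real K}" and ?S = "sweep A (1 / real (Suc m)) e"
  let ?h = "1 / real (Suc m)" and ?H = "hyperplane_measure e"
  have e: "norm e = 1" by (simp add: e_def)
  have h: "0 < ?h" "?h \<le> 1" by auto
  have "compact A"
    unfolding A_def compact_eq_bounded_closed
    using bounded_subset[OF bounded_coordinate_box] closed_coordinate_box by (auto intro!: closed_Int)
  then have S [measurable]: "?S \<in> sets borel" by (rule borel_sweep)
  have Q [measurable]: "?Q \<in> sets borel" by (rule borel_closed[OF closed_coordinate_box])
  have AE: "AE z in ?H. ennreal (\<theta> / real (Suc m)) * (ennreal (gaussian_density z) * indicator ?Q z)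
      \<le> (\<integral>\<^sup>+s. ennreal (gaussian_density (z + s *\<^sub>R e)) * indicator ?S (z + s *\<^sub>R e) \<partial>lborel)"
    using periodic_slices_antiperiodic[OF c per, of i] AE_hyperplane_measure unfolding e_def[symmetric]
  proof eventually_elim
    case (elim z)
    show ?case
    proof (cases "z \<in> ?Q")
      case True
      have zi: "z $ i = 0" using elim(2) by (simp add: e_def inner_axis)
      let ?T = "{s. z + s *\<^sub>R e \<in> \<Omega>}" and ?V = "{s. z + s *\<^sub>R e \<in> ?S}"
      have V [measurable]: "?V \<in> sets borel" by measurable
      have "ennreal (\<theta> / real (Suc m)) \<le> (\<integral>\<^sup>+s\<in>?V. ennreal (exp (- s\<^sup>2 / 2)) \<partial>lborel)"
      proof (rule antiperiodic_crossings[OF V _ _ _ \<theta>(2), where T="?T"])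
        show "AE s in lborel. (s \<in> ?T) \<noteq> (s + 1 \<in> ?T)" using elim(1) by simp
        fix s assume s: "- real K \<le> s" "s < real K" "(s \<in> ?T) \<noteq> (s + ?h \<in> ?T)"
        let ?L = "closed_segment (z + s *\<^sub>R e) (z + (s + ?h) *\<^sub>R e)"
        have "?L \<inter> frontier \<Omega> \<noteq> {}"
          using s(3) by (intro connected_Int_frontier) (auto simp del: of_nat_Suc)
        then obtain u where u: "0 \<le> u" "u \<le> 1"
          and p: "(1 - u) *\<^sub>R (z + s *\<^sub>R e) + u *\<^sub>R (z + (s + ?h) *\<^sub>R e) \<in> frontier \<Omega>"
          unfolding closed_segment_def by auto
        define t where "t = u * ?h"
        have t: "0 \<le> t" "t \<le> ?h" using u h mult_right_mono[of u 1 ?h] by (auto simp: t_def)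
        have "(1 - u) *\<^sub>R (z + s *\<^sub>R e) + u *\<^sub>R (z + (s + ?h) *\<^sub>R e) = z + s *\<^sub>R e + t *\<^sub>R e"
          by (simp add: t_def algebra_simps del: of_nat_Suc)
        with p have "z + s *\<^sub>R e + t *\<^sub>R e \<in> frontier \<Omega>" by simp
        moreover have "\<bar>(z + s *\<^sub>R e + t *\<^sub>R e) $ j\<bar> \<le> real K + 1" for j
        proof (cases "j = i")
          case True
          then have "(z + s *\<^sub>R e + t *\<^sub>R e) $ j = s + t" using zi by (simp add: e_def axis_def)
          moreover have "\<bar>s + t\<bar> \<le> real K + 1" using s(1,2) t(1) order_trans[OF t(2) h(2)] by linarith
          ultimately show ?thesis by simp
        next
          case False
          then have "(z + s *\<^sub>R e + t *\<^sub>R e) $ j = z $ j" by (simp add: e_def axis_def)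
          moreover have "\<bar>z $ j\<bar> \<le> real K" using True by blast
          ultimately show ?thesis by simp
        qed
        ultimately have "z + s *\<^sub>R e + t *\<^sub>R e \<in> A" by (auto simp: A_def)
        then show "s \<in> ?V" using t unfolding sweep_def by auto
      qed simp
      then have "ennreal (gaussian_density z) * ennreal (\<theta> / real (Suc m))
          \<le> ennreal (gaussian_density z) * (\<integral>\<^sup>+s\<in>?V. ennreal (exp (- s\<^sup>2 / 2)) \<partial>lborel)"
        by (rule mult_left_mono) simp
      also have "\<dots> = (\<integral>\<^sup>+s. ennreal (gaussian_density z) * (ennreal (exp (- s\<^sup>2 / 2)) * indicator ?V s) \<partial>lborel)"
        by (rule nn_integral_cmult[symmetric]) measurable
      also have "\<dots> = (\<integral>\<^sup>+s. ennreal (gaussian_density (z + s *\<^sub>R e)) * indicator ?S (z + s *\<^sub>R e) \<partial>lborel)"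
        by (intro nn_integral_cong)
          (auto simp: gaussian_density_slice[OF e elim(2)] indicator_def ennreal_mult' less_imp_le[OF gaussian_density_pos])
      finally show ?thesis using True by (simp add: mult.commute)
    qed simp
  qed
  have "ennreal (\<theta> / real (Suc m)) * gauss_mass ?H ?Q
      = (\<integral>\<^sup>+z. ennreal (\<theta> / real (Suc m)) * (ennreal (gaussian_density z) * indicator ?Q z) \<partial>?H)"
    by (rule nn_integral_cmult[symmetric]) measurable
  also have "\<dots> \<le> slice_integral e (\<lambda>x. ennreal (gaussian_density x) * indicator ?S x)"
    unfolding slice_integral_def by (rule nn_integral_mono_AE[OF AE])
  also have "\<dots> = c * gauss_mass lborel ?S"
    using c e unfolding slicing_constant_def by (auto simp del: of_nat_Suc)
  finally have "of_nat (Suc m) * (ennreal (\<theta> / real (Suc m)) * gauss_mass ?H ?Q)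
      \<le> of_nat (Suc m) * (c * gauss_mass lborel ?S)"
    by (rule mult_left_mono) simp
  moreover have "of_nat (Suc m) * ennreal (\<theta> / real (Suc m)) = ennreal \<theta>"
    using \<theta>(1) by (simp add: ennreal_of_nat_eq_real_of_nat ennreal_mult'[symmetric] del: of_nat_Suc)
  ultimately show ?thesis by (simp add: mult.assoc[symmetric] del: of_nat_Suc)
qed

text \<open>
  For a fixed box the lower bound for the swept mass and the upper bound \<open>global_flux_bound\<close>
  are compared at a small sweeping time; then the errors tend to zero and the box exhausts
  the space. Finiteness of the Gaussian perimeter makes the area of the boundary in a box
  finite, so that the error \<open>\<epsilon>\<close> per unit of area is harmless.
\<close>
lemma normal_flux_lower_bound:
  fixes \<Omega> :: "(real^'n) set" and i :: 'n
  assumes smooth: "smooth_boundary \<Omega>" and per: "periodic_set \<Omega>" and c: "slicing_constant TYPE('n) c"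
    and fin: "gauss_mass surface_measure (frontier \<Omega>) < top"
    and \<theta>: "0 \<le> \<theta>" "\<forall>\<^sub>F K in sequentially. \<forall>s\<in>{0..1}. \<theta> \<le> gauss_sum 1 K s"
  defines "e \<equiv> axis i 1"
  shows "ennreal \<theta> * hyperplane_mass e
    \<le> (\<integral>\<^sup>+x\<in>frontier \<Omega>. ennreal (flux_density \<Omega> e x) \<partial>surface_measure)"
proof -
  let ?H = "hyperplane_measure e"
  let ?I = "\<integral>\<^sup>+x\<in>frontier \<Omega>. ennreal (flux_density \<Omega> e x) \<partial>surface_measure"
  have e: "norm e = 1" by (simp add: e_def)
  define Q where "Q K = {z::real^'n. \<forall>j. \<bar>z $ j\<bar> \<le> real K}" for K :: nat
  have Q [measurable]: "Q K \<in> sets borel" for K unfolding Q_def by (rule borel_closed[OF closed_coordinate_box])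
  have fr [measurable]: "frontier \<Omega> \<in> sets borel" by (rule borel_closed) simp
  have step: "ennreal \<theta> * gauss_mass ?H (Q K) \<le> ?I"
    if K: "\<forall>s\<in>{0..1}. \<theta> \<le> gauss_sum 1 K s" for K
  proof (rule ennreal_le_epsilon)
    fix \<delta> :: real assume \<delta>: "\<delta> > 0"
    define A where "A = frontier \<Omega> \<inter> {x. \<forall>j. \<bar>x $ j\<bar> \<le> real K + 1}"
    have A: "compact A" "A \<subseteq> frontier \<Omega>"
      unfolding A_def compact_eq_bounded_closed
      using bounded_subset[OF bounded_coordinate_box] closed_coordinate_box by (auto intro!: closed_Int)
    have bA [measurable]: "A \<in> sets borel" using A by (simp add: compact_imp_closed)
    have finA: "emeasure surface_measure A < top"
    proof (cases "A = {}")
      case False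
      have "continuous_on A gaussian_density" by (intro continuous_intros)
      from continuous_attains_inf[OF A(1) False this]
      obtain x0 :: "real^'n" where x0: "\<forall>x\<in>A. gaussian_density x0 \<le> gaussian_density x" by blast
      have "ennreal (gaussian_density x0) * emeasure surface_measure A = (\<integral>\<^sup>+x\<in>A. ennreal (gaussian_density x0) \<partial>surface_measure)"
        by (rule nn_integral_cmult_indicator[symmetric]) simp
      also have "\<dots> \<le> gauss_mass surface_measure (frontier \<Omega>)"
        using A(2) x0 by (intro nn_integral_mono) (auto simp: indicator_def intro!: ennreal_leI)
      also have "\<dots> < top" by (rule fin)
      finally show ?thesis using gaussian_density_pos[of x0] by (auto simp: ennreal_mult_less_top)
    qed simp
    define a where "a = enn2real (emeasure surface_measure A)"
    have a: "a \<ge> 0" "emeasure surface_measure A = ennreal a" using finA by (auto simp: a_def)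
    \<comment> \<open>The denominator uses a + 1 because the area a may vanish.\<close>
    define \<epsilon> where "\<epsilon> = \<delta> / (2 * (a + 1))"
    have \<epsilon>: "\<epsilon> > 0" "\<epsilon> * a \<le> \<delta> / 2" using \<delta> a by (auto simp: \<epsilon>_def field_simps)
    have "flux_bound \<Omega> c e \<epsilon> A" by (rule global_flux_bound[OF smooth c e \<epsilon>(1) A finA])
    moreover have "\<delta> / 2 > 0" using \<delta> by simp
    ultimately have "\<forall>\<^sub>F m in sequentially. of_nat (Suc m) * (c * gauss_mass lborel (sweep A (1 / real (Suc m)) e))
     \<le> (\<integral>\<^sup>+x\<in>A. ennreal (flux_density \<Omega> e x + \<epsilon>) \<partial>surface_measure) + ennreal (\<delta> / 2)"
      unfolding flux_bound_def by blast
    then obtain m where m: "of_nat (Suc m) * (c * gauss_mass lborel (sweep A (1 / real (Suc m)) e))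
     \<le> (\<integral>\<^sup>+x\<in>A. ennreal (flux_density \<Omega> e x + \<epsilon>) \<partial>surface_measure) + ennreal (\<delta> / 2)"
      by (auto simp: eventually_sequentially simp del: of_nat_Suc)
    have "ennreal \<theta> * gauss_mass ?H (Q K)
      \<le> of_nat (Suc m) * (c * gauss_mass lborel (sweep A (1 / real (Suc m)) e))"
      unfolding Q_def A_def e_def by (rule swept_mass_lower_bound[OF c per \<theta>(1)]) (use K in blast)
    also note m
    also have "(\<integral>\<^sup>+x\<in>A. ennreal (flux_density \<Omega> e x + \<epsilon>) \<partial>surface_measure)
        \<le> (\<integral>\<^sup>+x. ennreal (flux_density \<Omega> e x) * indicator (frontier \<Omega>) x + ennreal \<epsilon> * indicator A x \<partial>surface_measure)"
    proof (rule nn_integral_mono)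
      fix x
      have "0 \<le> flux_density \<Omega> e x" by (simp add: flux_density_def less_imp_le[OF gaussian_density_pos])
      then show "ennreal (flux_density \<Omega> e x + \<epsilon>) * indicator A x
          \<le> ennreal (flux_density \<Omega> e x) * indicator (frontier \<Omega>) x + ennreal \<epsilon> * indicator A x"
        using A(2) \<epsilon> by (auto simp: indicator_def)
    qed
    also have "\<dots> = ?I + ennreal \<epsilon> * emeasure surface_measure A"
      using flux_measurable[OF smooth fr order_refl, of e 0]
      by (subst nn_integral_add) (auto simp: nn_integral_cmult_indicator cong: measurable_cong_sets)
    also have "ennreal \<epsilon> * emeasure surface_measure A \<le> ennreal (\<delta> / 2)"
      using \<epsilon> a by (simp add: ennreal_mult'[symmetric] ennreal_leI)
    finally have "ennreal \<theta> * gauss_mass ?H (Q K) \<le> ?I + ennreal (\<delta> / 2) + ennreal (\<delta> / 2)"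
      by (simp add: add_left_mono add_right_mono)
    also have "\<dots> = ?I + ennreal \<delta>"
      using \<delta> by (subst add.assoc, subst ennreal_plus[symmetric]) auto
    finally show "ennreal \<theta> * gauss_mass ?H (Q K) \<le> ?I + ennreal \<delta>" .
  qed
  let ?D = "density ?H (\<lambda>z. ennreal (gaussian_density z))"
  have "(\<lambda>K. emeasure ?D (Q K)) \<longlonglongrightarrow> emeasure ?D (\<Union>K. Q K)"
    by (rule Lim_emeasure_incseq) (auto simp: incseq_def Q_def intro: order_trans)
  moreover have "(\<Union>K. Q K) = UNIV"
  proof (intro equalityI subsetI UNIV_I)
    fix z :: "real^'n"
    obtain K :: nat where "norm z \<le> real K" using real_arch_simple by blast
    then have "z \<in> Q K" unfolding Q_def using component_le_norm_cart[of z] order_trans by blast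
    then show "z \<in> (\<Union>K. Q K)" by blast
  qed
  ultimately have "(\<lambda>K. \<integral>\<^sup>+z\<in>Q K. ennreal (gaussian_density z) \<partial>?H) \<longlonglongrightarrow> (\<integral>\<^sup>+z. ennreal (gaussian_density z) \<partial>?H)"
    by (simp add: emeasure_density)
  then have "(\<lambda>K. ennreal \<theta> * gauss_mass ?H (Q K)) \<longlonglongrightarrow> ennreal \<theta> * (\<integral>\<^sup>+z. ennreal (gaussian_density z) \<partial>?H)"
    by (intro ennreal_tendsto_cmult) simp_all
  moreover have "\<forall>\<^sub>F K in sequentially. ennreal \<theta> * gauss_mass ?H (Q K) \<le> ?I"
    using \<theta>(2) by eventually_elim (rule step)
  ultimately show ?thesis by (rule tendsto_upperbound) simp
qed

section \<open>The perimeter of a periodic half space\<close>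

lemma hyperplane_gaussian_mass_eq:
  fixes u v :: "real^'n"
  assumes "norm u = 1" "norm v = 1"
  shows "hyperplane_mass u = hyperplane_mass v"
proof -
  obtain R where R: "orthogonal_transformation R" "R u = v" using orthogonal_axis_to_unit[OF assms] .
  have "gaussian_density (R z) = gaussian_density z" for z
    unfolding gaussian_density_norm[of "R z"] gaussian_density_norm[of z]
    by (simp add: orthogonal_transformation_norm[OF R(1)])
  then show ?thesis
    using nn_integral_hyperplane_orthogonal[OF R(1), of "\<lambda>z. ennreal (gaussian_density z)" u] R(2) by simp
qed

lemma affine_hyperplane_gaussian_mass:
  fixes u :: "real^'n"
  assumes u: "norm u = 1"
  shows "gauss_mass surface_measure {x. x \<bullet> u = a}
    = ennreal (exp (- a\<^sup>2 / 2)) * hyperplane_mass u"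
proof -
  have "gauss_mass surface_measure {x. x \<bullet> u = a}
    = (\<integral>\<^sup>+z. (\<lambda>x. ennreal (gaussian_density x) * indicator {x. x \<bullet> u = a} x) (z + a *\<^sub>R u) \<partial>surface_measure)"
    by (rule nn_integral_surface_translate[symmetric]) measurable
  also have "\<dots> = (\<integral>\<^sup>+z. indicator {z. z \<bullet> u = 0} z * (ennreal (exp (- a\<^sup>2 / 2)) * ennreal (gaussian_density z)) \<partial>surface_measure)"
    using u by (intro nn_integral_cong)
      (auto simp: indicator_def inner_add_left norm_eq_1 gaussian_density_slice[OF u] mult.commute ennreal_mult'
        less_imp_le[OF gaussian_density_pos])
  also have "\<dots> = (\<integral>\<^sup>+z. ennreal (exp (- a\<^sup>2 / 2)) * ennreal (gaussian_density z) \<partial>hyperplane_measure u)"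
    by (rule nn_integral_hyperplane[symmetric]) measurable
  also have "\<dots> = ennreal (exp (- a\<^sup>2 / 2)) * hyperplane_mass u"
    by (rule nn_integral_cmult) measurable
  finally show ?thesis .
qed

lemma frontier_periodic_half_space:
  fixes \<epsilon> :: "real^'n"
  shows "frontier {x. sin (pi * (\<Sum>i\<in>UNIV. \<epsilon> $ i * x $ i)) \<ge> 0} \<subseteq> (\<Union>k::int. {x. x \<bullet> \<epsilon> = of_int k})"
proof
  let ?B = "{x::real^'n. sin (pi * (\<Sum>i\<in>UNIV. \<epsilon> $ i * x $ i)) \<ge> 0}"
  fix x assume "x \<in> frontier ?B"
  then have x: "x \<in> closure ?B" "x \<in> closure (- ?B)" by (auto simp: frontier_closures)
  have "closed ?B" by (intro closed_Collect_le continuous_intros)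
  then have 1: "sin (pi * (\<Sum>i\<in>UNIV. \<epsilon> $ i * x $ i)) \<ge> 0" using x(1) by simp
  have "closure (- ?B) \<subseteq> {x. sin (pi * (\<Sum>i\<in>UNIV. \<epsilon> $ i * x $ i)) \<le> 0}"
    by (intro closure_minimal closed_Collect_le continuous_intros) auto
  with 1 x(2) have "sin (pi * (\<Sum>i\<in>UNIV. \<epsilon> $ i * x $ i)) = 0" by auto
  then obtain k :: int where "pi * (\<Sum>i\<in>UNIV. \<epsilon> $ i * x $ i) = of_int k * pi"
    unfolding sin_zero_iff_int2 by blast
  then have "x \<bullet> \<epsilon> = of_int k" by (simp add: inner_vec_def mult.commute)
  then show "x \<in> (\<Union>k::int. {x. x \<bullet> \<epsilon> = of_int k})" by blast
qed

text \<open>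
  With \<open>v = \<epsilon> / \<surd>n\<close>, the boundary lies in the hyperplanes \<open>x \<bullet> v = k / \<surd>n\<close>. Each of these is
  a translate of a hyperplane through the origin, which multiplies its Gaussian mass by
  \<open>exp (- k\<^sup>2 / (2 n))\<close>.
\<close>
lemma half_space_perimeter_upper_bound:
  fixes B :: "(real^'n) set" and u :: "real^'n"
  assumes B: "periodic_half_space B" and u: "norm u = 1"
    and C: "\<forall>\<^sub>F K in sequentially. gauss_sum (sqrt (real CARD('n))) K 0 \<le> C"
  shows "gauss_mass surface_measure (frontier B)
    \<le> ennreal C * hyperplane_mass u"
proof -
  let ?n = "real CARD('n)"
  let ?D = "density surface_measure (\<lambda>x. ennreal (gaussian_density x)) :: (real^'n) measure"
  let ?m = "hyperplane_mass u"
  obtain \<epsilon> :: "real^'n" where \<epsilon>: "\<And>i. \<epsilon> $ i \<in> {-1, 1}"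
    and Beq: "B = {x. sin (pi * (\<Sum>i\<in>UNIV. \<epsilon> $ i * x $ i)) \<ge> 0}"
    using B unfolding periodic_half_space_def by auto
  define P where "P k = {x::real^'n. x \<bullet> \<epsilon> = of_int k}" for k :: int
  have P [measurable]: "P k \<in> sets borel" for k unfolding P_def by measurable
  define v where "v = (1 / sqrt ?n) *\<^sub>R \<epsilon>"
  have "norm \<epsilon> = sqrt ?n"
  proof -
    have "\<epsilon> $ i * \<epsilon> $ i = 1" for i using \<epsilon>[of i] by auto
    then have "\<epsilon> \<bullet> \<epsilon> = ?n" by (simp add: inner_vec_def)
    then show ?thesis by (simp add: norm_eq_sqrt_inner)
  qed
  then have v: "norm v = 1" by (simp add: v_def)
  have PD: "emeasure ?D (P k) = ennreal (exp (- (of_int k)\<^sup>2 / (2 * ?n))) * ?m" for k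
  proof -
    have Pk: "P k = {x. x \<bullet> v = of_int k / sqrt ?n}" by (auto simp: P_def v_def field_simps)
    have "emeasure ?D (P k) = gauss_mass surface_measure (P k)"
      by (rule emeasure_density) auto
    also have "\<dots> = ennreal (exp (- (of_int k / sqrt ?n)\<^sup>2 / 2)) * ?m"
      unfolding Pk affine_hyperplane_gaussian_mass[OF v] hyperplane_gaussian_mass_eq[OF v u] ..
    finally show ?thesis by (simp add: power_divide mult.commute)
  qed
  define X where "X K = (\<Union>k\<in>{- int K..<int K}. P k)" for K :: nat
  have X [measurable]: "X K \<in> sets borel" for K unfolding X_def by measurable
  have "gauss_mass surface_measure (frontier B) = emeasure ?D (frontier B)"
    by (rule emeasure_density[symmetric]) auto
  also have "\<dots> \<le> emeasure ?D (\<Union>K. X K)"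
  proof (rule emeasure_mono)
    show "frontier B \<subseteq> (\<Union>K. X K)"
    proof
      fix x assume "x \<in> frontier B"
      then obtain k :: int where "x \<in> P k" using frontier_periodic_half_space[of \<epsilon>] unfolding Beq P_def by blast
      moreover have "k \<in> {- int (Suc (nat \<bar>k\<bar>))..<int (Suc (nat \<bar>k\<bar>))}" by auto
      ultimately show "x \<in> (\<Union>K. X K)" unfolding X_def by blast
    qed
  qed simp
  also have "\<dots> \<le> ennreal C * ?m"
  proof (rule tendsto_upperbound)
    show "(\<lambda>K. emeasure ?D (X K)) \<longlonglongrightarrow> emeasure ?D (\<Union>K. X K)"
    proof (rule Lim_emeasure_incseq)
      show "incseq X" unfolding X_def by (intro incseq_SucI UN_mono) auto
    qed auto
    show "\<forall>\<^sub>F K in sequentially. emeasure ?D (X K) \<le> ennreal C * ?m"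
      using C
    proof eventually_elim
      case (elim K)
      have "emeasure ?D (X K) \<le> (\<Sum>k\<in>{- int K..<int K}. emeasure ?D (P k))"
        unfolding X_def by (rule emeasure_subadditive_finite) auto
      also have "\<dots> = ennreal (gauss_sum (sqrt ?n) K 0) * ?m"
        unfolding PD sum_distrib_right[symmetric] by (simp add: gauss_sum_def sum_ennreal)
      also have "\<dots> \<le> ennreal C * ?m" using elim by (intro mult_right_mono ennreal_leI) auto
      finally show ?case .
    qed
  qed simp
  finally show ?thesis .
qed

section \<open>Numerical bounds and the theorem\<close>

text \<open>
  Since \<open>16 * 1.233 < 2 \<pi>\<^sup>2\<close>, the sixteenth power of a partial sum of the series of
  \<open>exp 1.233\<close> is a lower bound. The true value is about \<open>3.7 \<cdot> 10\<^sup>8\<close>.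
\<close>
lemma exp_two_pi_squared: "exp (2 * pi\<^sup>2) \<ge> (350000000 :: real)"
proof -
  have "(\<Sum>k<8. (1233/1000) ^ k /\<^sub>R fact k) \<le> exp (1233/1000 :: real)"
    unfolding exp_def by (intro sum_le_suminf summable_exp_generic) auto
  moreover have "(\<Sum>k<8. (1233/1000) ^ k /\<^sub>R fact k) \<ge> (342/100 :: real)"
    by (simp add: eval_nat_numeral)
  ultimately have "(342/100) ^ 16 \<le> exp (1233/1000 :: real) ^ 16"
    by (intro power_mono) auto
  moreover have "exp (1233/1000 :: real) ^ 16 = exp (16 * (1233/1000))"
    by (subst exp_of_nat_mult[symmetric]) simp
  moreover have "16 * (1233/1000) \<le> 2 * pi\<^sup>2"
  proof -
    have "3.1415\<^sup>2 \<le> pi\<^sup>2" using pi_approx by (intro power_mono) auto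
    then show ?thesis by (simp add: power2_eq_square)
  qed
  then have "exp (16 * (1233/1000)) \<le> exp (2 * pi\<^sup>2)" by (simp only: exp_le_cancel_iff)
  moreover have "(350000000 :: real) \<le> (342/100) ^ 16" by (simp add: power_divide)
  ultimately show ?thesis by linarith
qed

text \<open>
  The true relative error is about \<open>5.4 \<cdot> 10\<^sup>-\<^sup>9\<close>. The bound \<open>5.9 \<cdot> 10\<^sup>-\<^sup>9\<close> leaves room for
  the error on the side of the half space within the total of \<open>6 \<cdot> 10\<^sup>-\<^sup>9\<close>.
\<close>
lemma gauss_sum_unit_variance_lower:
  "\<forall>\<^sub>F K in sequentially. \<forall>s\<in>{0..1}. sqrt (2 * pi) * (1 - 59 / 10 ^ 10) \<le> gauss_sum 1 K s"
proof -
  define c where "c = sqrt (2 * pi)"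
  have c: "c > 0" by (simp add: c_def)
  define q where "q = exp (- 2 * pi\<^sup>2 * 1\<^sup>2)"
  have "q \<le> 1 / 350000000" "q > 0"
    using exp_two_pi_squared by (auto simp: q_def exp_minus field_simps)
  then have r: "2 * q / (1 - q) \<le> 58 / 10 ^ 10" by (simp add: divide_le_eq)
  define r where "r = 2 * q / (1 - q)"
  have "c * r \<le> c * (58 / 10 ^ 10)" using c r unfolding r_def[symmetric] by (intro mult_left_mono) auto
  then have le: "c * (1 - 59 / 10 ^ 10) \<le> c - (c * r + c / 10 ^ 10)"
    by (simp add: algebra_simps)
  have "c / 10 ^ 10 > 0" using c by simp
  from gauss_sum_approx[of 1, OF zero_less_one this]
  have "\<forall>\<^sub>F K in sequentially. \<forall>s\<in>{0..1}. \<bar>gauss_sum 1 K s - c\<bar> \<le> c * r + c / 10 ^ 10"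
    by (simp add: c_def q_def r_def)
  then show ?thesis
  proof eventually_elim
    case (elim K)
    show ?case
    proof
      fix s :: real assume "s \<in> {0..1}"
      with elim have "\<bar>gauss_sum 1 K s - c\<bar> \<le> c * r + c / 10 ^ 10" by blast
      with le show "sqrt (2 * pi) * (1 - 59 / 10 ^ 10) \<le> gauss_sum 1 K s"
        unfolding c_def[symmetric] by linarith
    qed
  qed
qed

text \<open>
  For variance \<open>N \<ge> 2\<close> the parameter \<open>q\<close> of \<open>gauss_sum_approx\<close> is at most the square of its
  value for variance 1.
\<close>
lemma gauss_sum_large_variance_upper:
  assumes N: "N \<ge> 2"
  shows "\<forall>\<^sub>F K in sequentially. gauss_sum (sqrt N) K 0 \<le> sqrt N * sqrt (2 * pi) * (1 + 1 / 10 ^ 10)"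
proof -
  define c where "c = sqrt N * sqrt (2 * pi)"
  have c: "c > 0" using N by (simp add: c_def)
  define q where "q = exp (- 2 * pi\<^sup>2 * (sqrt N)\<^sup>2)"
  have "q \<le> exp (- (2 * pi\<^sup>2) - 2 * pi\<^sup>2)"
    using N mult_left_mono[OF N, of "2 * pi\<^sup>2"] by (simp add: q_def)
  also have "\<dots> = 1 / (exp (2 * pi\<^sup>2) * exp (2 * pi\<^sup>2))"
    by (simp only: diff_conv_add_uminus exp_add exp_minus) (simp add: field_simps)
  also have "\<dots> \<le> 1 / (350000000 * 350000000)"
    using exp_two_pi_squared by (intro divide_left_mono mult_mono) auto
  finally have "q \<le> 1 / (350000000 * 350000000)" "q > 0" by (auto simp: q_def)
  then have r: "2 * q / (1 - q) \<le> 1 / (2 * 10 ^ 10)" by (simp add: divide_le_eq)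
  define r where "r = 2 * q / (1 - q)"
  have "c * r \<le> c * (1 / (2 * 10 ^ 10))" using c r unfolding r_def[symmetric] by (intro mult_left_mono) auto
  then have le: "c + (c * r + c / (2 * 10 ^ 10)) \<le> c * (1 + 1 / 10 ^ 10)"
    by (simp add: algebra_simps)
  have "c / (2 * 10 ^ 10) > 0" "sqrt N > 0" using c N by simp_all
  from gauss_sum_approx[OF this(2,1)]
  have "\<forall>\<^sub>F K in sequentially. \<forall>s\<in>{0..1}. \<bar>gauss_sum (sqrt N) K s - c\<bar> \<le> c * r + c / (2 * 10 ^ 10)"
    by (simp only: c_def q_def r_def)
  then show ?thesis
  proof eventually_elim
    case (elim K)
    have "\<bar>gauss_sum (sqrt N) K 0 - c\<bar> \<le> c * r + c / (2 * 10 ^ 10)"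
      using elim by (rule bspec) simp
    with le show ?case unfolding c_def[symmetric] by linarith
  qed
qed

text \<open>
  The Cauchy--Schwarz inequality for \<open>x\<close> and the vector of its signs.
\<close>
lemma l1_norm_le_sqrt:
  fixes x :: "real^'n"
  shows "l1_norm x \<le> sqrt (real CARD('n)) * norm x"
proof -
  define s :: "real^'n" where "s = (\<chi> i. if x $ i \<ge> 0 then 1 else -1)"
  have "s $ i * s $ i = 1" for i by (simp add: s_def)
  then have "norm s = sqrt (real CARD('n))" by (simp add: norm_eq_sqrt_inner inner_vec_def)
  moreover have "l1_norm x = x \<bullet> s" unfolding l1_norm_def inner_vec_def s_def by (intro sum.cong) auto
  ultimately show ?thesis using norm_cauchy_schwarz[of x s] by (simp add: mult.commute)
qed

lemma sum_flux_density: "(\<Sum>i\<in>UNIV. flux_density \<Omega> (axis i 1) x) = l1_norm (exterior_normal \<Omega> x) * gaussian_density x"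
  by (simp add: flux_density_def l1_norm_def inner_axis sum_distrib_right)

text \<open>
  The flux bound in each of the \<open>n\<close> coordinate directions; the absolute values of the
  components of the normal add up to its \<open>l\<^sub>1\<close> norm.
\<close>
lemma l1_perimeter_lower_bound:
  fixes \<Omega> :: "(real^'n) set" and u :: "real^'n"
  assumes smooth: "smooth_boundary \<Omega>" and per: "periodic_set \<Omega>" and u: "norm u = 1"
    and fin: "gauss_mass surface_measure (frontier \<Omega>) < top"
  shows "ennreal (real CARD('n) * (sqrt (2 * pi) * (1 - 59 / 10 ^ 10))) * hyperplane_mass u
    \<le> (\<integral>\<^sup>+x\<in>frontier \<Omega>. ennreal (l1_norm (exterior_normal \<Omega> x) * gaussian_density x) \<partial>surface_measure)"
proof -
  define \<theta> where "\<theta> = sqrt (2 * pi) * (1 - 59 / 10 ^ 10)"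
  let ?D = "hyperplane_mass u"
  have \<theta>: "0 \<le> \<theta>" by (simp add: \<theta>_def)
  obtain c where c: "slicing_constant TYPE('n) c" by (rule slicing_constant_exists)
  have fr: "frontier \<Omega> \<in> sets borel" by (rule borel_closed) simp
  have each: "ennreal \<theta> * ?D \<le> (\<integral>\<^sup>+x\<in>frontier \<Omega>. ennreal (flux_density \<Omega> (axis i 1) x) \<partial>surface_measure)" for i :: 'n
  proof -
    have "norm (axis i 1 :: real^'n) = 1" by simp
    from hyperplane_gaussian_mass_eq[OF u this]
    show ?thesis using normal_flux_lower_bound[OF smooth per c fin \<theta> gauss_sum_unit_variance_lower[folded \<theta>_def], of i] by simp
  qed
  have "ennreal (real CARD('n) * \<theta>) * ?D = (\<Sum>i\<in>(UNIV::'n set). ennreal \<theta> * ?D)"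
    using \<theta> by (simp add: ennreal_mult' ennreal_of_nat_eq_real_of_nat mult.assoc)
  also have "\<dots> \<le> (\<Sum>i\<in>UNIV. \<integral>\<^sup>+x\<in>frontier \<Omega>. ennreal (flux_density \<Omega> (axis i 1) x) \<partial>surface_measure)"
    by (intro sum_mono each)
  also have "\<dots> = (\<integral>\<^sup>+x. (\<Sum>i\<in>UNIV. ennreal (flux_density \<Omega> (axis i 1) x) * indicator (frontier \<Omega>) x) \<partial>surface_measure)"
    using flux_measurable[OF smooth fr order_refl, of _ 0]
    by (subst nn_integral_sum) (auto cong: measurable_cong_sets)
  also have "\<dots> = (\<integral>\<^sup>+x\<in>frontier \<Omega>. ennreal (l1_norm (exterior_normal \<Omega> x) * gaussian_density x) \<partial>surface_measure)"
  proof (intro nn_integral_cong)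
    fix x
    have "flux_density \<Omega> (axis i 1) x \<ge> 0" for i
      by (simp add: flux_density_def less_imp_le[OF gaussian_density_pos])
    then show "(\<Sum>i\<in>UNIV. ennreal (flux_density \<Omega> (axis i 1) x) * indicator (frontier \<Omega>) x)
      = ennreal (l1_norm (exterior_normal \<Omega> x) * gaussian_density x) * indicator (frontier \<Omega>) x"
      unfolding sum_flux_density[symmetric] by (simp add: sum_ennreal sum_distrib_right[symmetric])
  qed
  finally show ?thesis unfolding \<theta>_def .
qed

theorem theorem1p10:
  fixes \<Omega> B :: "(real^'n) set"
  assumes "CARD('n) \<ge> 2"
    and "periodic_set \<Omega>"
    and "smooth_boundary \<Omega>"
    and "periodic_half_space B"
  shows "(\<integral>\<^sup>+x\<in>frontier \<Omega>. ennreal (gaussian_density x) \<partial>surface_measure) \<ge>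
           ennreal (1 - 6 / 10 ^ 9) *
             (\<integral>\<^sup>+x\<in>frontier B. ennreal (gaussian_density x) \<partial>surface_measure) +
           (\<integral>\<^sup>+x\<in>frontier \<Omega>.
              ennreal ((1 - l1_norm (exterior_normal \<Omega> x) / sqrt (real CARD('n))) *
                       gaussian_density x) \<partial>surface_measure)
       \<and> (\<integral>\<^sup>+x\<in>frontier \<Omega>. ennreal (gaussian_density x) \<partial>surface_measure) \<ge>
           ennreal (1 - 6 / 10 ^ 9) *
             (\<integral>\<^sup>+x\<in>frontier B. ennreal (gaussian_density x) \<partial>surface_measure)"
proof -
  let ?n = "real CARD('n)" and ?N = "exterior_normal \<Omega>" and ?M = "frontier \<Omega>"
  let ?G = "gaussian_density :: real^'n \<Rightarrow> real"
  define P where "P = gauss_mass surface_measure ?M"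
  define PB where "PB = gauss_mass surface_measure (frontier B)"
  define E where "E = (\<integral>\<^sup>+x\<in>?M. ennreal ((1 - l1_norm (?N x) / sqrt ?n) * ?G x) \<partial>surface_measure)"
  \<comment> \<open>If P is infinite there is nothing to prove; otherwise the flux bounds apply and
    P splits into E and the l1 part of the perimeter.\<close>
  have "ennreal (1 - 6 / 10 ^ 9) * PB + E \<le> P"
  proof (cases "P = top")
    case False
    then have fin: "P < top" by (simp add: less_top)
    have n: "?n \<ge> 2" using assms(1) by simp
    obtain u :: "real^'n" where u: "norm u = 1" using norm_axis_1 by blast
    define D where "D = hyperplane_mass u"
    define L where "L = (\<integral>\<^sup>+x\<in>?M. ennreal (l1_norm (?N x) * ?G x) \<partial>surface_measure)"
    have fr: "?M \<in> sets borel" by (rule borel_closed) simp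
    have meas: "(\<lambda>x. ennreal (f (?N x) * ?G x) * indicator ?M x) \<in> borel_measurable surface_measure"
      if f: "continuous_on UNIV f" for f :: "real^'n \<Rightarrow> real"
    proof -
      have "continuous_on ?M (\<lambda>x. f (?N x) * ?G x)"
        by (intro continuous_intros continuous_on_compose2[OF f] continuous_on_exterior_normal assms(3)) auto
      then have "(\<lambda>x. indicator ?M x *\<^sub>R (f (?N x) * ?G x)) \<in> borel_measurable borel"
        by (rule borel_measurable_continuous_on_indicator[OF fr])
      then have "(\<lambda>x. ennreal (indicator ?M x *\<^sub>R (f (?N x) * ?G x))) \<in> borel_measurable surface_measure"
        by measurable
      moreover have "(\<lambda>x. ennreal (indicator ?M x *\<^sub>R (f (?N x) * ?G x))) = (\<lambda>x. ennreal (f (?N x) * ?G x) * indicator ?M x)"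
        by (auto simp: fun_eq_iff indicator_def)
      ultimately show ?thesis by simp
    qed
    have l1c: "continuous_on UNIV (l1_norm :: real^'n \<Rightarrow> real)"
      unfolding l1_norm_def by (intro continuous_intros)
    have l1c': "continuous_on UNIV (\<lambda>v::real^'n. 1 - l1_norm v / sqrt ?n)"
      using n by (intro continuous_intros l1c) auto
    have "P = (\<integral>\<^sup>+x. ennreal (1 / sqrt ?n) * (ennreal (l1_norm (?N x) * ?G x) * indicator ?M x)
        + ennreal ((1 - l1_norm (?N x) / sqrt ?n) * ?G x) * indicator ?M x \<partial>surface_measure)"
      unfolding P_def
    proof (rule nn_integral_cong)
      fix x
      show "ennreal (?G x) * indicator ?M x = ennreal (1 / sqrt ?n) * (ennreal (l1_norm (?N x) * ?G x) * indicator ?M x)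
        + ennreal ((1 - l1_norm (?N x) / sqrt ?n) * ?G x) * indicator ?M x"
      proof (cases "x \<in> ?M")
        case True
        have "l1_norm (?N x) \<le> sqrt ?n"
          using l1_norm_le_sqrt[of "?N x"] norm_exterior_normal[OF assms(3) True] by simp
        then have 1: "l1_norm (?N x) / sqrt ?n \<le> 1" using n by (simp add: divide_le_eq)
        have 2: "l1_norm (?N x) \<ge> 0" by (simp add: l1_norm_def sum_nonneg)
        have G: "?G x \<ge> 0" by (simp add: less_imp_le[OF gaussian_density_pos])
        have "ennreal (1 / sqrt ?n) * ennreal (l1_norm (?N x) * ?G x) + ennreal ((1 - l1_norm (?N x) / sqrt ?n) * ?G x)
            = ennreal (1 / sqrt ?n * (l1_norm (?N x) * ?G x) + (1 - l1_norm (?N x) / sqrt ?n) * ?G x)"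
          using 1 2 G by (subst ennreal_mult[symmetric], simp, simp, subst ennreal_plus) auto
        also have "1 / sqrt ?n * (l1_norm (?N x) * ?G x) + (1 - l1_norm (?N x) / sqrt ?n) * ?G x = ?G x"
          by (simp add: algebra_simps)
        finally show ?thesis using True by simp
      qed simp
    qed
    also have "\<dots> = ennreal (1 / sqrt ?n) * L + E"
      unfolding L_def E_def
      using meas[OF l1c] meas[OF l1c'] by (subst nn_integral_add) (auto simp: nn_integral_cmult)
    finally have P: "P = ennreal (1 / sqrt ?n) * L + E" .
    have L: "ennreal (?n * (sqrt (2 * pi) * (1 - 59 / 10 ^ 10))) * D \<le> L"
      unfolding D_def L_def
      by (rule l1_perimeter_lower_bound[OF assms(3,2) u]) (use fin in \<open>simp add: P_def\<close>)
    have PB: "PB \<le> ennreal (sqrt ?n * sqrt (2 * pi) * (1 + 1 / 10 ^ 10)) * D"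
      unfolding PB_def D_def
      by (rule half_space_perimeter_upper_bound[OF assms(4) u gauss_sum_large_variance_upper[OF n]])
    have "ennreal (1 - 6 / 10 ^ 9) * PB \<le> ennreal (1 - 6 / 10 ^ 9) * (ennreal (sqrt ?n * sqrt (2 * pi) * (1 + 1 / 10 ^ 10)) * D)"
      by (rule mult_left_mono[OF PB]) simp
    also have "\<dots> = ennreal ((1 - 6 / 10 ^ 9) * (sqrt ?n * sqrt (2 * pi) * (1 + 1 / 10 ^ 10))) * D"
      by (subst ennreal_mult) (auto simp: mult.assoc)
    also have "\<dots> \<le> ennreal (1 / sqrt ?n * (?n * (sqrt (2 * pi) * (1 - 59 / 10 ^ 10)))) * D"
    proof (intro mult_right_mono ennreal_leI)
      have "(1 - 6 / 10 ^ 9) * (1 + 1 / 10 ^ 10) \<le> (1 - 59 / 10 ^ 10 :: real)" by simp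
      then have "(sqrt ?n * sqrt (2 * pi)) * ((1 - 6 / 10 ^ 9) * (1 + 1 / 10 ^ 10)) \<le> (sqrt ?n * sqrt (2 * pi)) * (1 - 59 / 10 ^ 10)"
        by (rule mult_left_mono) simp
      moreover have "1 / sqrt ?n * ?n = sqrt ?n" by (simp add: real_div_sqrt)
      ultimately show "(1 - 6 / 10 ^ 9) * (sqrt ?n * sqrt (2 * pi) * (1 + 1 / 10 ^ 10))
          \<le> 1 / sqrt ?n * (?n * (sqrt (2 * pi) * (1 - 59 / 10 ^ 10)))"
        by (simp only: mult.assoc[symmetric]) (simp add: mult_ac)
    qed simp
    also have "\<dots> = ennreal (1 / sqrt ?n) * (ennreal (?n * (sqrt (2 * pi) * (1 - 59 / 10 ^ 10))) * D)"
      by (subst ennreal_mult) (auto simp: mult.assoc)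
    also have "\<dots> \<le> ennreal (1 / sqrt ?n) * L" by (rule mult_left_mono[OF L]) simp
    finally show ?thesis unfolding P by (rule add_right_mono)
  qed simp
  moreover have "ennreal (1 - 6 / 10 ^ 9) * PB \<le> ennreal (1 - 6 / 10 ^ 9) * PB + E" by simp
  ultimately show ?thesis unfolding P_def PB_def E_def by (meson order_trans)
qed

end
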